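(* Let $(\bar u,\bar b)$ be a canonical intermediate local minimizer (i.e., a canonical control pair that is an intermediate local minimizer) for problem $(P)$ with the corresponding sweeping trajectory $\bar x(\cdot)$, and let $(P_k)$, $k\in\mathbb{N}$, be the associated discrete approximation problems described in the context. Then: (i) If the cost function $\varphi$ is lower semicontinuous around $\bar x(T)$, then each problem $(P_k)$ admits an optimal solution whenever $k\in\mathbb{N}$ is sufficiently large. (ii) If in addition $\varphi$ is continuous around $\bar x(T)$, then every sequence of optimal solutions $\{(\bar u^k,\bar b^k)\}$ to $(P_k)$ and the corresponding sequence of discrete trajectories $\{\bar x^k\}$, being piecewise linearly extended to $[0,T]$, converge to $(\bar u,\bar b,\bar x)$ as $k\to\infty$ in the norm topology of $W^{1,2}([0,T],\mathbb{R}^{mn}\times\mathbb{R}^m\times\mathbb{R}^n)$.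
   Context: Setting. Fix $T>0$, $x_0\in\mathbb{R}^n$, a closed set $\Omega\subseteq\mathbb{R}^n$, and $\varphi:\mathbb{R}^n\to\mathbb{R}$. For $(u,b)\in\mathbb{R}^{nm}\times\mathbb{R}^m$, $u=(u_1,\dots,u_m)$, $u_i\in\mathbb{R}^n$, put $C(u,b):=\{x\in\mathbb{R}^n\mid\langle u_i,x\rangle\le b_i,\ i=1,\dots,m\}$ and $F(u,b,x):=N_{C(u,b)}(x)$, where for convex $C$, $N_C(x):=\{v\mid\langle v,y-x\rangle\le0\ \forall y\in C\}$ if $x\in C$ and $N_C(x):=\emptyset$ otherwise. For control functions put $C_{(u,b)}(t):=C(u(t),b(t))$, and let $x_{(u,b)}$ denote the unique trajectory of the sweeping process $-\dot x(t)\in N_{C_{(u,b)}(t)}(x(t))$ a.e. $t\in[0,T]$, $x(0)=x_0\in C_{(u,b)}(0)$. Problem $(P)$: minimize $\varphi(x_{(u,b)}(T))$ over $(u,b)\in W^{1,2}([0,T],\mathbb{R}^{nm}\times\mathbb{R}^m)$ subject to $\|u_i(t)\|=1$ for all $t\in[0,T]$, $i=1,\dots,m$, and $x_{(u,b)}(T)\in\Omega$. Control pairs satisfying these constraints are called feasible. Canonical control pair: $(u,b)\in W^{1,2}([0,T],\mathbb{R}^{nm}\times\mathbb{R}^m)$ such that $u,b$ are Lipschitz continuous; the uniform Slater condition holds (for every $t\in[0,T]$ there is $x$ with $\langle u_i(t),x\rangle<b_i(t)$ for all $i$); $\|u_i(t)\|=1$ for all $t$ and $i$; and $\dot u$, $\dot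 b$ and the derivative of the unique Lipschitz continuous trajectory $x_{(u,b)}$ are of bounded variation on $[0,T]$. Intermediate local minimizer: a feasible $(\bar u,\bar b)$ for which there is $\varepsilon>0$ such that $\varphi(x_{(\bar u,\bar b)}(T))\le\varphi(x_{(u,b)}(T))$ for every feasible $(u,b)$ with $\|(u,b)-(\bar u,\bar b)\|_{W^{1,2}}+\|x_{(u,b)}-x_{(\bar u,\bar b)}\|_{W^{1,2}}\le\varepsilon$. Approximating data. For the canonical pair $(\bar u,\bar b)$ with trajectory $\bar x$, fix meshes $\Delta_k=\{0=t^k_0<\dots<t^k_{\nu(k)}=T\}$ with $h^k_j:=t^k_{j+1}-t^k_j\downarrow0$ as $k\to\infty$, functions $(\widetilde u^k,\widetilde b^k,\widetilde x^k)$ piecewise linear on $\Delta_k$, and $\delta_k\downarrow0$, $\delta_k>0$, such that $(\widetilde u^k(0),\widetilde b^k(0),\widetilde x^k(0))=(\bar u(0),\bar b(0),x_0)$; $1-\delta_k\le\|\widetilde u^k_i(t^k_j)\|\le1+\delta_k$ for all $i,j$ ($\delta_k$ can be chosen so that these inequalities are strict); $-\big(\widetilde x^k(t^k_{j+1})-\widetilde x^k(t^k_j)\big)/h^k_j\in F(\widetilde u^k(t^k_j),\widetilde b^k(t^k_j),\widetilde x^k(t^k_j))$ for $j=0,\dots,\nu(k)-1$; and $(\widetilde u^k,\widetilde b^k,\widetilde x^k)\to(\bar u,\bar b,\bar x)$ in $W^{1,2}$ on $[0,T]$. (Such data exist for every canonical pair.) Put $\xi_k:=\|\widetilde x^k(T)-\bar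 x(T)\|\to0$. Problem $(P_k)$: over discrete triples $(u^k,b^k,x^k)=(u^k_0,\dots,u^k_{\nu(k)},b^k_0,\dots,b^k_{\nu(k)},x^k_0,\dots,x^k_{\nu(k)})$ with $u^k_j=(u^k_{1j},\dots,u^k_{mj})\in\mathbb{R}^{nm}$, $b^k_j\in\mathbb{R}^m$, $x^k_j\in\mathbb{R}^n$, minimize $$\varphi(x^k_{\nu(k)})+\frac12\sum_{j=0}^{\nu(k)-1}\int_{t^k_j}^{t^k_{j+1}}\Big\|\Big(\tfrac{u^k_{j+1}-u^k_j}{h^k_j},\tfrac{b^k_{j+1}-b^k_j}{h^k_j},\tfrac{x^k_{j+1}-x^k_j}{h^k_j}\Big)-(\dot{\bar u}(t),\dot{\bar b}(t),\dot{\bar x}(t))\Big\|^2dt$$ subject to: (1) $x^k_{j+1}\in x^k_j-h^k_jF(u^k_j,b^k_j,x^k_j)$, $j=0,\dots,\nu(k)-1$; (2) $x^k_0=x_0\in C_{(\bar u,\bar b)}(0)$, $(u^k_0,b^k_0)=(\bar u(0),\bar b(0))$, $x^k_{\nu(k)}\in\Omega+\xi_k\mathbb{B}$ ($\mathbb{B}$ the closed unit ball); (3) $1-\delta_k\le\|u^k_{ij}\|\le1+\delta_k$ for $j=0,\dots,\nu(k)$, $i=1,\dots,m$; (4) $\sum_{j=0}^{\nu(k)-1}\int_{t^k_j}^{t^k_{j+1}}\|(u^k_j,b^k_j,x^k_j)-(\bar u(t),\bar b(t),\bar x(t))\|^2dt\le\varepsilon/2$; (5) $\sum_{j=0}^{\nu(k)-1}\int_{t^k_j}^{t^k_{j+1}}\big\|\big(\tfrac{u^k_{j+1}-u^k_j}{h^k_j},\tfrac{b^k_{j+1}-b^k_j}{h^k_j},\tfrac{x^k_{j+1}-x^k_j}{h^k_j}\big)-(\dot{\bar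 u}(t),\dot{\bar b}(t),\dot{\bar x}(t))\big\|^2dt\le\varepsilon/2$, where $\varepsilon>0$ is the number from the definition of the intermediate local minimizer $(\bar u,\bar b)$.
   Formalization: The number ε in (P_k) is taken sufficiently small (all 0<ε≤ε0, each still valid in the definition of intermediate local minimizer), since (ii) can fail for an arbitrary such ε: constraints (4),(5) bound squared norms, while the definition bounds norms. *)

theory Defs
  imports "HOL-Analysis.Analysis"
begin

section \<open>Sobolev functions on an interval\<close>

text \<open>
  \<open>f\<close> is absolutely continuous on \<open>[0,T]\<close> with almost-everywhere derivative \<open>g\<close>.
  Only the class of \<open>g\<close> modulo null sets matters.
\<close>

definition has_ac_deriv ::
  "real \<Rightarrow> (real \<Rightarrow> 'a::euclidean_space) \<Rightarrow> (real \<Rightarrow> 'a) \<Rightarrow> bool" where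
  "has_ac_deriv T f g \<longleftrightarrow>
     g absolutely_integrable_on {0..T} \<and> (\<forall>t\<in>{0..T}. f t = f 0 + integral {0..t} g)"

text \<open>
  The choice is unique up to a null set of \<open>[0,T]\<close>, so the integrals below do not depend on it.
\<close>

definition ac_deriv :: "real \<Rightarrow> (real \<Rightarrow> 'a::euclidean_space) \<Rightarrow> real \<Rightarrow> 'a" where
  "ac_deriv T f = (SOME g. has_ac_deriv T f g)"

definition W12 :: "real \<Rightarrow> (real \<Rightarrow> 'a::euclidean_space) \<Rightarrow> bool" where
  "W12 T f \<longleftrightarrow>
     (\<exists>g. has_ac_deriv T f g \<and> (\<lambda>t. (norm (g t))\<^sup>2) integrable_on {0..T})"

definition W12_norm :: "real \<Rightarrow> (real \<Rightarrow> 'a::euclidean_space) \<Rightarrow> real" where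
  "W12_norm T f =
     sqrt (integral {0..T} (\<lambda>t. (norm (f t))\<^sup>2)
         + integral {0..T} (\<lambda>t. (norm (ac_deriv T f t))\<^sup>2))"

definition converges_W12 ::
  "real \<Rightarrow> (nat \<Rightarrow> real \<Rightarrow> 'a::euclidean_space) \<Rightarrow> (real \<Rightarrow> 'a) \<Rightarrow> bool" where
  "converges_W12 T F f \<longleftrightarrow>
     (\<forall>k. W12 T (F k)) \<and> W12 T f \<and> (\<lambda>k. W12_norm T (\<lambda>t. F k t - f t)) \<longlonglongrightarrow> 0"

definition bounded_variation_on :: "real set \<Rightarrow> (real \<Rightarrow> 'a::real_normed_vector) \<Rightarrow> bool" where
  "bounded_variation_on S g \<longleftrightarrow>
     (\<exists>M. \<forall>N s. s ` {..N} \<subseteq> S \<and> mono_on {..N} s \<longrightarrow>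
        (\<Sum>i<N. norm (g (s (Suc i)) - g (s i))) \<le> M)"

text \<open>A derivative exists almost everywhere only, so bounded variation concerns a representative.\<close>

definition has_bv_deriv :: "real \<Rightarrow> (real \<Rightarrow> 'a::euclidean_space) \<Rightarrow> bool" where
  "has_bv_deriv T f \<longleftrightarrow> (\<exists>g. has_ac_deriv T f g \<and> bounded_variation_on {0..T} g)"


section \<open>Semicontinuity and continuity around a point\<close>

definition lsc_at :: "('a::topological_space \<Rightarrow> real) \<Rightarrow> 'a \<Rightarrow> bool" where
  "lsc_at f x \<longleftrightarrow> (\<forall>c<f x. \<forall>\<^sub>F y in nhds x. c < f y)"

definition lsc_around :: "('a::metric_space \<Rightarrow> real) \<Rightarrow> 'a \<Rightarrow> bool" where
  "lsc_around f x \<longleftrightarrow> (\<exists>r>0. \<forall>y\<in>ball x r. lsc_at f y)"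

definition continuous_around :: "('a::metric_space \<Rightarrow> real) \<Rightarrow> 'a \<Rightarrow> bool" where
  "continuous_around f x \<longleftrightarrow> (\<exists>r>0. continuous_on (ball x r) f)"


section \<open>The controlled polyhedral sweeping process\<close>

definition polyhedron_of :: "real^'n^'m \<Rightarrow> real^'m \<Rightarrow> (real^'n) set" where
  "polyhedron_of u b = {x. \<forall>i. u $ i \<bullet> x \<le> b $ i}"

definition normal_cone :: "'a::real_inner set \<Rightarrow> 'a \<Rightarrow> 'a set" where
  "normal_cone C x = (if x \<in> C then {v. \<forall>y\<in>C. v \<bullet> (y - x) \<le> 0} else {})"

definition sweep_map :: "real^'n^'m \<Rightarrow> real^'m \<Rightarrow> real^'n \<Rightarrow> (real^'n) set" where
  "sweep_map u b x = normal_cone (polyhedron_of u b) x"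

text \<open>
  Normal cones are monotone, so for given controls the trajectory is unique on \<open>[0,T]\<close>; it is
  treated as a relation between controls and states.
\<close>

definition sweeping_trajectory ::
  "real \<Rightarrow> real^'n \<Rightarrow> (real \<Rightarrow> real^'n^'m) \<Rightarrow> (real \<Rightarrow> real^'m) \<Rightarrow> (real \<Rightarrow> real^'n) \<Rightarrow> bool" where
  "sweeping_trajectory T x0 u b x \<longleftrightarrow>
     x 0 = x0 \<and> x0 \<in> polyhedron_of (u 0) (b 0) \<and>
     (\<exists>v. has_ac_deriv T x v \<and>
        (AE t in lebesgue. t \<in> {0..T} \<longrightarrow> - v t \<in> sweep_map (u t) (b t) (x t)))"

definition feasible_P ::
  "real \<Rightarrow> real^'n \<Rightarrow> (real^'n) set \<Rightarrow>
   (real \<Rightarrow> real^'n^'m) \<Rightarrow> (real \<Rightarrow> real^'m) \<Rightarrow> (real \<Rightarrow> real^'n) \<Rightarrow> bool" where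
  "feasible_P T x0 \<Omega> u b x \<longleftrightarrow>
     W12 T (\<lambda>t. (u t, b t)) \<and> (\<forall>t\<in>{0..T}. \<forall>i. norm (u t $ i) = 1) \<and>
     sweeping_trajectory T x0 u b x \<and> x T \<in> \<Omega>"

definition canonical_pair ::
  "real \<Rightarrow> real^'n \<Rightarrow> (real \<Rightarrow> real^'n^'m) \<Rightarrow> (real \<Rightarrow> real^'m) \<Rightarrow> (real \<Rightarrow> real^'n) \<Rightarrow> bool" where
  "canonical_pair T x0 u b x \<longleftrightarrow>
     W12 T (\<lambda>t. (u t, b t)) \<and>
     (\<exists>L. L-lipschitz_on {0..T} u) \<and> (\<exists>L. L-lipschitz_on {0..T} b) \<and>
     (\<forall>t\<in>{0..T}. \<exists>y. \<forall>i. u t $ i \<bullet> y < b t $ i) \<and>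
     (\<forall>t\<in>{0..T}. \<forall>i. norm (u t $ i) = 1) \<and>
     sweeping_trajectory T x0 u b x \<and> (\<exists>L. L-lipschitz_on {0..T} x) \<and>
     has_bv_deriv T u \<and> has_bv_deriv T b \<and> has_bv_deriv T x"

text \<open>
  Local minimality with a given radius \<open>\<epsilon>\<close>. The trajectories need not lie in \<open>W\<^sup>1\<^sup>,\<^sup>2\<close> a priori;
  a difference outside \<open>W\<^sup>1\<^sup>,\<^sup>2\<close> has infinite norm, hence the explicit membership test. Any smaller positive number is again a radius.
  The discrete problems use squared distances, while here the norms themselves are bounded, so
  they localise around the minimizer as intended only for sufficiently small radii.
\<close>

definition local_minimizer_radius ::
  "real \<Rightarrow> real^'n \<Rightarrow> (real^'n) set \<Rightarrow> (real^'n \<Rightarrow> real) \<Rightarrow>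
   (real \<Rightarrow> real^'n^'m) \<Rightarrow> (real \<Rightarrow> real^'m) \<Rightarrow> (real \<Rightarrow> real^'n) \<Rightarrow> real \<Rightarrow> bool" where
  "local_minimizer_radius T x0 \<Omega> \<phi> ub bb xb \<epsilon> \<longleftrightarrow>
     0 < \<epsilon> \<and>
     (\<forall>u b x. feasible_P T x0 \<Omega> u b x \<and> W12 T (\<lambda>t. x t - xb t) \<and>
        W12_norm T (\<lambda>t. (u t, b t) - (ub t, bb t)) + W12_norm T (\<lambda>t. x t - xb t) \<le> \<epsilon> \<longrightarrow>
        \<phi> (xb T) \<le> \<phi> (x T))"

definition intermediate_local_minimizer ::
  "real \<Rightarrow> real^'n \<Rightarrow> (real^'n) set \<Rightarrow> (real^'n \<Rightarrow> real) \<Rightarrow>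
   (real \<Rightarrow> real^'n^'m) \<Rightarrow> (real \<Rightarrow> real^'m) \<Rightarrow> (real \<Rightarrow> real^'n) \<Rightarrow> bool" where
  "intermediate_local_minimizer T x0 \<Omega> \<phi> ub bb xb \<longleftrightarrow>
     feasible_P T x0 \<Omega> ub bb xb \<and> (\<exists>\<epsilon>. local_minimizer_radius T x0 \<Omega> \<phi> ub bb xb \<epsilon>)"


section \<open>Meshes and approximating data\<close>

text \<open>A mesh with nodes \<open>t 0, \<dots>, t \<nu>\<close>; values of sequences beyond index \<open>\<nu>\<close> are irrelevant.\<close>

definition mesh :: "real \<Rightarrow> (nat \<Rightarrow> real) \<Rightarrow> nat \<Rightarrow> bool" where
  "mesh T t \<nu> \<longleftrightarrow> t 0 = 0 \<and> t \<nu> = T \<and> (\<forall>j<\<nu>. t j < t (Suc j))"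

definition mesh_size :: "(nat \<Rightarrow> real) \<Rightarrow> nat \<Rightarrow> real" where
  "mesh_size t \<nu> = Max ((\<lambda>j. t (Suc j) - t j) ` {..<\<nu>})"

text \<open>The piecewise linear function with nodal values \<open>v j\<close> at \<open>t j\<close>.\<close>

definition pl_extension :: "(nat \<Rightarrow> real) \<Rightarrow> (nat \<Rightarrow> 'a::real_vector) \<Rightarrow> real \<Rightarrow> 'a" where
  "pl_extension t v s =
     (let j = (LEAST j. s \<le> t (Suc j))
      in v j + ((s - t j) / (t (Suc j) - t j)) *\<^sub>R (v (Suc j) - v j))"

definition piecewise_linear :: "real \<Rightarrow> (nat \<Rightarrow> real) \<Rightarrow> (real \<Rightarrow> 'a::real_vector) \<Rightarrow> bool" where
  "piecewise_linear T t f \<longleftrightarrow> (\<forall>s\<in>{0..T}. f s = pl_extension t (\<lambda>j. f (t j)) s)"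

definition approximating_data ::
  "real \<Rightarrow> real^'n \<Rightarrow> (real \<Rightarrow> real^'n^'m) \<Rightarrow> (real \<Rightarrow> real^'m) \<Rightarrow> (real \<Rightarrow> real^'n) \<Rightarrow>
   (nat \<Rightarrow> nat \<Rightarrow> real) \<Rightarrow> (nat \<Rightarrow> nat) \<Rightarrow> (nat \<Rightarrow> real) \<Rightarrow>
   (nat \<Rightarrow> real \<Rightarrow> real^'n^'m) \<Rightarrow> (nat \<Rightarrow> real \<Rightarrow> real^'m) \<Rightarrow> (nat \<Rightarrow> real \<Rightarrow> real^'n) \<Rightarrow> bool"
where
  "approximating_data T x0 ub bb xb t \<nu> \<delta> ut bt xt \<longleftrightarrow>
     (\<forall>k. mesh T (t k) (\<nu> k)) \<and> (\<lambda>k. mesh_size (t k) (\<nu> k)) \<longlonglongrightarrow> 0 \<and>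
     (\<forall>k. 0 < \<delta> k) \<and> \<delta> \<longlonglongrightarrow> 0 \<and>
     (\<forall>k. piecewise_linear T (t k) (ut k) \<and> piecewise_linear T (t k) (bt k) \<and>
          piecewise_linear T (t k) (xt k)) \<and>
     (\<forall>k. ut k 0 = ub 0 \<and> bt k 0 = bb 0 \<and> xt k 0 = x0) \<and>
     (\<forall>k. \<forall>j\<le>\<nu> k. \<forall>i. 1 - \<delta> k \<le> norm (ut k (t k j) $ i) \<and> norm (ut k (t k j) $ i) \<le> 1 + \<delta> k) \<and>
     (\<forall>k. \<forall>j<\<nu> k.
        - ((1 / (t k (Suc j) - t k j)) *\<^sub>R (xt k (t k (Suc j)) - xt k (t k j)))
          \<in> sweep_map (ut k (t k j)) (bt k (t k j)) (xt k (t k j))) \<and>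
     converges_W12 T (\<lambda>k s. (ut k s, bt k s, xt k s)) (\<lambda>s. (ub s, bb s, xb s))"


section \<open>The discrete approximation problems\<close>

definition rate_defect ::
  "real \<Rightarrow> (real \<Rightarrow> 'a::euclidean_space) \<Rightarrow> (nat \<Rightarrow> real) \<Rightarrow> nat \<Rightarrow> (nat \<Rightarrow> 'a) \<Rightarrow> real" where
  "rate_defect T zb t \<nu> z =
     (\<Sum>j<\<nu>. integral {t j..t (Suc j)}
        (\<lambda>s. (norm ((1 / (t (Suc j) - t j)) *\<^sub>R (z (Suc j) - z j) - ac_deriv T zb s))\<^sup>2))"

definition value_defect ::
  "(real \<Rightarrow> 'a::euclidean_space) \<Rightarrow> (nat \<Rightarrow> real) \<Rightarrow> nat \<Rightarrow> (nat \<Rightarrow> 'a) \<Rightarrow> real" where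
  "value_defect zb t \<nu> z =
     (\<Sum>j<\<nu>. integral {t j..t (Suc j)} (\<lambda>s. (norm (z j - zb s))\<^sup>2))"

definition discrete_cost ::
  "real \<Rightarrow> (real^'n \<Rightarrow> real) \<Rightarrow>
   (real \<Rightarrow> real^'n^'m) \<Rightarrow> (real \<Rightarrow> real^'m) \<Rightarrow> (real \<Rightarrow> real^'n) \<Rightarrow>
   (nat \<Rightarrow> real) \<Rightarrow> nat \<Rightarrow>
   (nat \<Rightarrow> real^'n^'m) \<Rightarrow> (nat \<Rightarrow> real^'m) \<Rightarrow> (nat \<Rightarrow> real^'n) \<Rightarrow> real" where
  "discrete_cost T \<phi> ub bb xb t \<nu> U B X =
     \<phi> (X \<nu>) + 1/2 * rate_defect T (\<lambda>s. (ub s, bb s, xb s)) t \<nu> (\<lambda>j. (U j, B j, X j))"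

definition discrete_feasible ::
  "real \<Rightarrow> real^'n \<Rightarrow> (real^'n) set \<Rightarrow>
   (real \<Rightarrow> real^'n^'m) \<Rightarrow> (real \<Rightarrow> real^'m) \<Rightarrow> (real \<Rightarrow> real^'n) \<Rightarrow>
   real \<Rightarrow> real \<Rightarrow> real \<Rightarrow> (nat \<Rightarrow> real) \<Rightarrow> nat \<Rightarrow>
   (nat \<Rightarrow> real^'n^'m) \<Rightarrow> (nat \<Rightarrow> real^'m) \<Rightarrow> (nat \<Rightarrow> real^'n) \<Rightarrow> bool" where
  "discrete_feasible T x0 \<Omega> ub bb xb \<epsilon> \<delta> \<xi> t \<nu> U B X \<longleftrightarrow>
     (\<forall>j<\<nu>. \<exists>v\<in>sweep_map (U j) (B j) (X j). X (Suc j) = X j - (t (Suc j) - t j) *\<^sub>R v) \<and>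
     X 0 = x0 \<and> x0 \<in> polyhedron_of (ub 0) (bb 0) \<and> U 0 = ub 0 \<and> B 0 = bb 0 \<and>
     (\<exists>w\<in>\<Omega>. \<exists>y\<in>cball 0 1. X \<nu> = w + \<xi> *\<^sub>R y) \<and>
     (\<forall>j\<le>\<nu>. \<forall>i. 1 - \<delta> \<le> norm (U j $ i) \<and> norm (U j $ i) \<le> 1 + \<delta>) \<and>
     value_defect (\<lambda>s. (ub s, bb s, xb s)) t \<nu> (\<lambda>j. (U j, B j, X j)) \<le> \<epsilon> / 2 \<and>
     rate_defect T (\<lambda>s. (ub s, bb s, xb s)) t \<nu> (\<lambda>j. (U j, B j, X j)) \<le> \<epsilon> / 2"

definition discrete_optimal ::
  "real \<Rightarrow> real^'n \<Rightarrow> (real^'n) set \<Rightarrow> (real^'n \<Rightarrow> real) \<Rightarrow>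
   (real \<Rightarrow> real^'n^'m) \<Rightarrow> (real \<Rightarrow> real^'m) \<Rightarrow> (real \<Rightarrow> real^'n) \<Rightarrow>
   real \<Rightarrow> real \<Rightarrow> real \<Rightarrow> (nat \<Rightarrow> real) \<Rightarrow> nat \<Rightarrow>
   (nat \<Rightarrow> real^'n^'m) \<Rightarrow> (nat \<Rightarrow> real^'m) \<Rightarrow> (nat \<Rightarrow> real^'n) \<Rightarrow> bool" where
  "discrete_optimal T x0 \<Omega> \<phi> ub bb xb \<epsilon> \<delta> \<xi> t \<nu> U B X \<longleftrightarrow>
     discrete_feasible T x0 \<Omega> ub bb xb \<epsilon> \<delta> \<xi> t \<nu> U B X \<and>
     (\<forall>U' B' X'. discrete_feasible T x0 \<Omega> ub bb xb \<epsilon> \<delta> \<xi> t \<nu> U' B' X' \<longrightarrow>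
        discrete_cost T \<phi> ub bb xb t \<nu> U B X \<le> discrete_cost T \<phi> ub bb xb t \<nu> U' B' X')"

end

theory Submission
  imports Defs "HOL-Complex_Analysis.Great_Picard"
begin

text \<open>
  All discrete controls start at the same point as the minimizer, so the bound on the rates makes
  every feasible discrete triple uniformly close to it, within \<open>sqrt (T * \<epsilon> / 2)\<close>. For small \<open>\<epsilon>\<close> the
  uniform Slater condition is inherited by the discrete controls; this closes the graph of the
  sweeping map, and a discrete minimizer exists by compactness and lower semicontinuity.

  For the convergence let the rate defects of optimal solutions stay above some \<open>\<eta> > 0\<close> along a
  subsequence. By Arzela--Ascoli a further subsequence converges uniformly. Its limit is absolutely
  continuous with a square integrable derivative and satisfies the sweeping inclusion, so it competes
  with the local minimizer. Comparing the costs of the optimal solutions with those of the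
  approximating data gives \<open>\<phi> (x T) + \<eta> / 2 \<le> \<phi> (xb T) \<le> \<phi> (x T)\<close>, a contradiction.
\<close>

subsection \<open>Square integrable functions\<close>

text \<open>The obstacle is that the velocities of the discrete trajectories are only bounded in L2,
  so the differential inclusion cannot be passed to the limit at a given time. It is replaced by the
  decay of the squared distance to points that remain strictly feasible; uniform limits preserve
  this decay, and differentiating it recovers the normal cone. Controls and state form a single
  function whose deviation from the minimizer vanishes at time 0, so the L2 norm of its derivative
  controls everything else. Three demands bound \<open>\<epsilon>\<close>: the tube around the
  minimizer must keep Slater points, the end points must stay where \<open>\<phi>\<close> is
  regular, and the limit must lie within the given radius of minimality. The last one compares a
  bound on squares with a bound on norms, hence the square of the radius in
  \<open>\<epsilon>0\<close>. The tolerances of the norm and end point constraints tend to 0, so the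
  limit obeys the exact constraints.\<close>

definition square_integrable_on :: "(real \<Rightarrow> 'a::euclidean_space) \<Rightarrow> real set \<Rightarrow> bool"
  (infixr "square'_integrable'_on" 46) where
  "g square_integrable_on S \<longleftrightarrow>
     g absolutely_integrable_on S \<and> (\<lambda>t. (norm (g t))\<^sup>2) integrable_on S"

abbreviation sq_int :: "real \<Rightarrow> real \<Rightarrow> (real \<Rightarrow> 'a::euclidean_space) \<Rightarrow> real" where
  "sq_int a b g \<equiv> integral {a..b} (\<lambda>t. (norm (g t))\<^sup>2)"

lemma power2_norm_add_le:
  fixes x y :: "'a::real_inner"
  shows "(norm (x + y))\<^sup>2 \<le> 2 * (norm x)\<^sup>2 + 2 * (norm y)\<^sup>2"
proof -
  have "(norm (x + y))\<^sup>2 + (norm (x - y))\<^sup>2 = 2 * (norm x)\<^sup>2 + 2 * (norm y)\<^sup>2"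
    by (simp add: power2_norm_eq_inner algebra_simps inner_commute)
  then show ?thesis
    using zero_le_power2[of "norm (x - y)"] by linarith
qed

lemma square_integrableD:
  assumes "g square_integrable_on S"
  shows "g absolutely_integrable_on S" "g integrable_on S"
    "(\<lambda>t. norm (g t)) integrable_on S" "(\<lambda>t. (norm (g t))\<^sup>2) integrable_on S"
  using assms unfolding square_integrable_on_def absolutely_integrable_on_def by auto

lemma square_integrable_measurable:
  assumes "g square_integrable_on {a..b}"
  shows "g \<in> borel_measurable (lebesgue_on {a..b})"
  using assms unfolding square_integrable_on_def
  by (simp add: absolutely_integrable_measurable)

text \<open>On a bounded interval the function \<open>1 + (norm (g t))\<^sup>2\<close> is integrable
  and dominates \<open>norm (g t)\<close>, so measurability and an integrable square are
  enough.\<close>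

lemma square_integrableI:
  fixes g :: "real \<Rightarrow> 'a::euclidean_space"
  assumes "g \<in> borel_measurable (lebesgue_on {a..b})"
    and "(\<lambda>t. (norm (g t))\<^sup>2) integrable_on {a..b}"
  shows "g square_integrable_on {a..b}"
  unfolding square_integrable_on_def
proof (intro conjI assms(2))
  show "g absolutely_integrable_on {a..b}"
  proof (rule measurable_bounded_by_integrable_imp_absolutely_integrable)
    show "(\<lambda>t. 1 + (norm (g t))\<^sup>2) integrable_on {a..b}"
      by (intro integrable_add assms(2)) auto
    show "norm (g t) \<le> 1 + (norm (g t))\<^sup>2" if "t \<in> {a..b}" for t
    proof -
      have "0 \<le> (norm (g t) - 1)\<^sup>2" by simp
      then show ?thesis
        unfolding power2_diff using norm_ge_zero[of "g t"] by (simp, linarith)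
    qed
  qed (use assms in auto)
qed

lemma square_integrable_bound:
  fixes g :: "real \<Rightarrow> 'a::euclidean_space" and h :: "real \<Rightarrow> real"
  assumes "g \<in> borel_measurable (lebesgue_on {a..b})" "h integrable_on {a..b}"
    and "\<And>t. t \<in> {a..b} \<Longrightarrow> (norm (g t))\<^sup>2 \<le> h t"
  shows "g square_integrable_on {a..b}"
proof (rule square_integrableI[OF assms(1)])
  show "(\<lambda>t. (norm (g t))\<^sup>2) integrable_on {a..b}"
    by (rule measurable_bounded_by_integrable_imp_integrable[OF _ assms(2)])
      (use assms in auto)
qed

lemma square_integrable_add:
  assumes "g square_integrable_on {a..b}" "h square_integrable_on {a..b}"
  shows "(\<lambda>t. g t + h t) square_integrable_on {a..b}"
proof (rule square_integrable_bound)
  show "(\<lambda>t. 2 * (norm (g t))\<^sup>2 + 2 * (norm (h t))\<^sup>2) integrable_on {a..b}"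
    using assms[THEN square_integrableD(4)]
    by (intro integrable_add integrable_on_mult_right)
qed (use assms[THEN square_integrable_measurable] power2_norm_add_le in auto)

lemma square_integrable_scaleR:
  assumes "g square_integrable_on {a..b}"
  shows "(\<lambda>t. c *\<^sub>R g t) square_integrable_on {a..b}"
proof (rule square_integrable_bound)
  show "(\<lambda>t. c\<^sup>2 * (norm (g t))\<^sup>2) integrable_on {a..b}"
    using square_integrableD(4)[OF assms] by (intro integrable_on_mult_right)
qed (use square_integrable_measurable[OF assms] in \<open>auto simp: power_mult_distrib\<close>)

lemma square_integrable_diff:
  assumes "g square_integrable_on {a..b}" "h square_integrable_on {a..b}"
  shows "(\<lambda>t. g t - h t) square_integrable_on {a..b}"
  using square_integrable_add[OF assms(1) square_integrable_scaleR[OF assms(2), of "-1"]] by simp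

lemma square_integrable_continuous:
  fixes g :: "real \<Rightarrow> 'a::euclidean_space"
  assumes "continuous_on {a..b} g"
  shows "g square_integrable_on {a..b}"
  unfolding square_integrable_on_def
  by (intro conjI absolutely_integrable_continuous_real integrable_continuous_real
      continuous_intros assms)

lemma square_integrable_subinterval:
  assumes "g square_integrable_on {a..b}" "{c..d} \<subseteq> {a..b}"
  shows "g square_integrable_on {c..d}"
  unfolding square_integrable_on_def
  using absolutely_integrable_on_subinterval[OF square_integrableD(1)[OF assms(1)] assms(2)]
    integrable_on_subinterval[OF square_integrableD(4)[OF assms(1)] assms(2)] by simp

text \<open>Serves the derivative \<open>ac_deriv\<close>, which is fixed only up to a null
  set.\<close>

lemma square_integrable_spike:
  assumes "g square_integrable_on S" "negligible N" "\<And>t. t \<in> S - N \<Longrightarrow> h t = g t"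
  shows "h square_integrable_on S" and "integral S (\<lambda>t. (norm (h t))\<^sup>2) = integral S (\<lambda>t. (norm (g t))\<^sup>2)"
proof -
  have "h absolutely_integrable_on S"
    using square_integrableD(1)[OF assms(1)] assms(2,3) by (rule absolutely_integrable_spike)
  moreover have "(\<lambda>t. (norm (h t))\<^sup>2) integrable_on S"
    using integrable_spike[OF square_integrableD(4)[OF assms(1)] assms(2)] assms(3) by simp
  ultimately show "h square_integrable_on S"
    by (simp add: square_integrable_on_def)
  show "integral S (\<lambda>t. (norm (h t))\<^sup>2) = integral S (\<lambda>t. (norm (g t))\<^sup>2)"
    by (rule integral_spike[OF assms(2)]) (use assms(3) in simp)
qed

lemma sq_int_nonneg: "0 \<le> integral S (\<lambda>t. (norm (g t))\<^sup>2)"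
  by (cases "(\<lambda>t. (norm (g t))\<^sup>2) integrable_on S")
    (auto simp: integral_nonneg not_integrable_integral)

lemma sq_int_subinterval_le:
  assumes "g square_integrable_on {a..b}" "{c..d} \<subseteq> {a..b}"
  shows "sq_int c d g \<le> sq_int a b g"
  using square_integrableD(4)[OF assms(1)]
    square_integrableD(4)[OF square_integrable_subinterval[OF assms]]
  by (intro integral_subset_le[OF assms(2)]) auto

text \<open>The variance of \<open>norm (g t)\<close> is nonnegative: \<open>c\<close> is the mean
  value, and expanding the square around it gives the inequality.\<close>

lemma Cauchy_Schwarz_norm_integral:
  assumes "g square_integrable_on {a..b}" "a \<le> b"
  shows "(integral {a..b} (\<lambda>t. norm (g t)))\<^sup>2 \<le> (b - a) * sq_int a b g"
proof (cases "a = b")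
  case False
  let ?I = "integral {a..b} (\<lambda>t. norm (g t))"
  define c where "c = ?I / (b - a)"
  note int = square_integrableD[OF assms(1)]
  have "0 \<le> integral {a..b} (\<lambda>t. (norm (g t) - c)\<^sup>2)"
    using sq_int_nonneg[of "{a..b}" "\<lambda>t. norm (g t) - c"] by simp
  also have "\<dots> = integral {a..b} (\<lambda>t. (norm (g t))\<^sup>2 - 2 * c * norm (g t) + c\<^sup>2)"
    by (simp add: power2_diff algebra_simps)
  also have "\<dots> = sq_int a b g - 2 * c * ?I + c\<^sup>2 * (b - a)"
  proof (rule integral_unique)
    have "((\<lambda>t. c\<^sup>2) has_integral (b - a) *\<^sub>R c\<^sup>2) {a..b}"
      using has_integral_const_real[of "c\<^sup>2" a b] assms(2) by simp
    then show "((\<lambda>t. (norm (g t))\<^sup>2 - 2 * c * norm (g t) + c\<^sup>2) has_integral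
      sq_int a b g - 2 * c * ?I + c\<^sup>2 * (b - a)) {a..b}"
      using int by (auto intro!: has_integral_add has_integral_diff has_integral_mult_right integrable_integral
        simp: mult.commute[of "c\<^sup>2"])
  qed
  also have "\<dots> = sq_int a b g - ?I\<^sup>2 / (b - a)"
    using False by (simp add: c_def power2_eq_square divide_simps)
  finally show ?thesis
    using False assms(2) by (simp add: divide_simps mult.commute)
qed auto

lemma Cauchy_Schwarz_integral:
  assumes "g square_integrable_on {a..b}" "a \<le> b"
  shows "(norm (integral {a..b} g))\<^sup>2 \<le> (b - a) * sq_int a b g"
proof -
  have "norm (integral {a..b} g) \<le> integral {a..b} (\<lambda>t. norm (g t))"
    using square_integrableD[OF assms(1)] by (intro integral_norm_bound_integral) auto
  then show ?thesis
    using Cauchy_Schwarz_norm_integral[OF assms] by (meson norm_ge_zero order_trans power_mono)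
qed

text \<open>The right-hand side is a quadratic polynomial in \<open>c\<close>. In the defects
  \<open>c\<close> is built from nodal values, so their continuity in the nodes becomes plain limit
  arithmetic.\<close>

lemma integral_sq_norm_const_diff:
  fixes c :: "'a::euclidean_space"
  assumes "g square_integrable_on {a..b}" "a \<le> b"
  shows "integral {a..b} (\<lambda>t. (norm (c - g t))\<^sup>2)
       = (b - a) * (norm c)\<^sup>2 - 2 * (c \<bullet> integral {a..b} g) + sq_int a b g"
proof -
  note int = square_integrableD[OF assms(1)]
  have gi: "(\<lambda>t. c \<bullet> g t) integrable_on {a..b}"
    using integrable_linear[OF int(2) bounded_linear_inner_right[of c]] by (simp add: o_def)
  have eq: "integral {a..b} (\<lambda>t. c \<bullet> g t) = c \<bullet> integral {a..b} g"
    using integral_linear[OF int(2) bounded_linear_inner_right[of c]] by (simp add: o_def)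
  have cc: "((\<lambda>t. (norm c)\<^sup>2) has_integral (b - a) * (norm c)\<^sup>2) {a..b}"
    using has_integral_const_real[of "(norm c)\<^sup>2" a b] assms(2) by simp
  have "((\<lambda>t. (norm c)\<^sup>2 - 2 * (c \<bullet> g t) + (norm (g t))\<^sup>2) has_integral
     (b - a) * (norm c)\<^sup>2 - 2 * (c \<bullet> integral {a..b} g) + sq_int a b g) {a..b}"
    unfolding eq[symmetric]
    by (intro has_integral_add has_integral_diff has_integral_mult_right integrable_integral gi int cc)
  moreover have "(\<lambda>t. (norm (c - g t))\<^sup>2) = (\<lambda>t. (norm c)\<^sup>2 - 2 * (c \<bullet> g t) + (norm (g t))\<^sup>2)"
    by (simp add: power2_norm_eq_inner algebra_simps inner_commute)
  ultimately show ?thesis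
    by (simp add: integral_unique)
qed

section \<open>Completeness of L2 on an interval\<close>

lemma convergent_if_summable_diff:
  fixes f :: "nat \<Rightarrow> 'a::real_normed_vector"
  assumes "summable (\<lambda>n. f (Suc n) - f n)"
  shows "convergent f"
proof -
  have "(\<lambda>n. \<Sum>k<n. f (Suc k) - f k) \<longlonglongrightarrow> (\<Sum>k. f (Suc k) - f k)"
    by (rule summable_LIMSEQ[OF assms])
  then have "(\<lambda>n. (f n - f 0) + f 0) \<longlonglongrightarrow> (\<Sum>k. f (Suc k) - f k) + f 0"
    unfolding sum_lessThan_telescope by (intro tendsto_intros)
  then show ?thesis
    by (auto simp: convergent_def)
qed

text \<open>Riesz-Fischer: the increments of a fast subsequence are summable in L1, hence the
  subsequence converges almost everywhere, and Fatou's lemma turns the Cauchy estimates into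
  convergence of the whole sequence.\<close>

lemma L2_complete:
  fixes h :: "nat \<Rightarrow> real \<Rightarrow> 'a::euclidean_space"
  assumes ab: "a \<le> b" and sq: "\<And>n. h n square_integrable_on {a..b}"
    and Cauchy: "\<And>e. 0 < e \<Longrightarrow> \<exists>N. \<forall>m\<ge>N. \<forall>n\<ge>N. sq_int a b (\<lambda>t. h m t - h n t) < e"
  obtains g where "g square_integrable_on {a..b}"
    "(\<lambda>n. sq_int a b (\<lambda>t. g t - h n t)) \<longlonglongrightarrow> 0"
proof -
  let ?M = "lebesgue_on {a..b}"
  have meas[measurable]: "h n \<in> borel_measurable ?M" for n
    by (rule square_integrable_measurable[OF sq])
  have nn: "(\<integral>\<^sup>+t. ennreal (f t) \<partial>?M) = ennreal (integral {a..b} f)"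
    if "f integrable_on {a..b}" "\<And>t. 0 \<le> f t" for f :: "real \<Rightarrow> real"
  proof -
    have "integrable ?M f"
      by (intro absolutely_integrable_imp_integrable nonnegative_absolutely_integrable_1 that) auto
    then show ?thesis
      using that by (simp add: nn_integral_eq_integral lebesgue_integral_eq_integral)
  qed
  have nn_sq: "(\<integral>\<^sup>+t. ennreal ((norm (f t))\<^sup>2) \<partial>?M) = ennreal (sq_int a b f)"
    if "f square_integrable_on {a..b}" for f :: "real \<Rightarrow> 'a"
    using nn square_integrableD(4)[OF that] by simp
  have nn_norm: "(\<integral>\<^sup>+t. ennreal (norm (f t)) \<partial>?M) = ennreal (integral {a..b} (\<lambda>t. norm (f t)))"
    if "f square_integrable_on {a..b}" for f :: "real \<Rightarrow> 'a"
    using nn square_integrableD(3)[OF that] by simp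
  \<comment> \<open>Squared distances below \<open>(1/4)^i\<close> become L1 distances of order
    \<open>(1/2)^i\<close> after Cauchy-Schwarz.\<close>
  have "\<forall>i. \<exists>N. \<forall>m\<ge>N. \<forall>n\<ge>N. sq_int a b (\<lambda>t. h m t - h n t) < (1/4)^i"
    using Cauchy by simp
  then obtain N where N: "\<And>i m n. m \<ge> N i \<Longrightarrow> n \<ge> N i \<Longrightarrow> sq_int a b (\<lambda>t. h m t - h n t) < (1/4)^i"
    by metis
  \<comment> \<open>The partial sums dominate each \<open>N k\<close>, and the summand
    \<open>k\<close> makes \<open>r\<close> strictly increasing.\<close>
  define r where "r k = (\<Sum>i\<le>k. N i) + k" for k
  have rN: "N k \<le> r k" for k unfolding r_def using member_le_sum[of k "{..k}" N] by simp
  have r_Suc: "r k < r (Suc k)" for k by (simp add: r_def)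
  then have r: "strict_mono r" by (simp add: strict_mono_Suc_iff)
  define d where "d k t = h (r (Suc k)) t - h (r k) t" for k t
  have d_sq: "d k square_integrable_on {a..b}" for k
    unfolding d_def[abs_def] by (intro square_integrable_diff sq)
  have d_meas[measurable]: "d k \<in> borel_measurable ?M" for k
    by (rule square_integrable_measurable[OF d_sq])
  have d_le: "integral {a..b} (\<lambda>t. norm (d k t)) \<le> sqrt (b - a) * (1/2)^k" for k
  proof -
    have "sq_int a b (d k) \<le> (1/4)^k"
      unfolding d_def[abs_def] by (rule less_imp_le[OF N]) (use rN r_Suc[of k] in \<open>auto intro: le_trans less_imp_le\<close>)
    then have "(integral {a..b} (\<lambda>t. norm (d k t)))\<^sup>2 \<le> (b - a) * (1/4)^k"
      using Cauchy_Schwarz_norm_integral[OF d_sq ab, of k] ab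
      by (meson diff_ge_0_iff_ge mult_left_mono order_trans)
    also have "\<dots> = (sqrt (b - a) * (1/2)^k)\<^sup>2"
    proof -
      have "(4::real)^k = (2^k)\<^sup>2" by (simp add: power2_eq_square flip: power_mult_distrib)
      then show ?thesis using ab by (simp add: power_mult_distrib power_divide)
    qed
    finally have "(integral {a..b} (\<lambda>t. norm (d k t)))\<^sup>2 \<le> (sqrt (b - a) * (1/2)^k)\<^sup>2" .
    from power2_le_imp_le[OF this] ab show ?thesis
      by simp
  qed
  have "(\<integral>\<^sup>+t. (\<Sum>k. ennreal (norm (d k t))) \<partial>?M) = (\<Sum>k. \<integral>\<^sup>+t. ennreal (norm (d k t)) \<partial>?M)"
    by (rule nn_integral_suminf) measurable
  also have "\<dots> \<le> (\<Sum>k. ennreal (sqrt (b - a) * (1/2)^k))"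
    using d_sq d_le by (intro suminf_le) (auto simp: nn_norm intro: ennreal_leI)
  also have "\<dots> = ennreal (\<Sum>k. sqrt (b - a) * (1/2)^k)"
    using ab by (intro suminf_ennreal2) (auto intro: summable_mult)
  also have "\<dots> < \<infinity>" by simp
  finally have "AE t in ?M. (\<Sum>k. ennreal (norm (d k t))) \<noteq> \<infinity>"
    by (intro nn_integral_PInf_AE) auto
  then have conv: "AE t in ?M. convergent (\<lambda>k. h (r k) t)"
  proof (eventually_elim)
    case (elim t)
    then have "summable (\<lambda>k. norm (d k t))"
      by (intro summable_suminf_not_top) (auto simp: top_ennreal_def infinity_ennreal_def)
    then have "summable (\<lambda>k. h (r (Suc k)) t - h (r k) t)"
      unfolding d_def by (rule summable_norm_cancel)
    then show ?case
      by (rule convergent_if_summable_diff)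
  qed
  \<comment> \<open>On the null set where the subsequence diverges the value of \<open>lim\<close>
    is immaterial; \<open>g\<close> is measurable nonetheless.\<close>
  define g where "g t = lim (\<lambda>k. h (r k) t)" for t
  have g_meas[measurable]: "g \<in> borel_measurable ?M"
    unfolding g_def[abs_def] by measurable
  \<comment> \<open>Fatou along the subsequence with \<open>n\<close> fixed: a bound valid for all
    late \<open>m\<close> survives the passage from \<open>h m\<close> to \<open>g\<close>.\<close>
  have est: "(\<integral>\<^sup>+t. ennreal ((norm (g t - h n t))\<^sup>2) \<partial>?M) \<le> ennreal e"
    if e: "\<forall>m\<ge>K. sq_int a b (\<lambda>t. h m t - h n t) < e" for n e K
  proof -
    have "(\<integral>\<^sup>+t. ennreal ((norm (g t - h n t))\<^sup>2) \<partial>?M)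
        = (\<integral>\<^sup>+t. liminf (\<lambda>k. ennreal ((norm (h (r k) t - h n t))\<^sup>2)) \<partial>?M)"
    proof (rule nn_integral_cong_AE, use conv in eventually_elim)
      case (elim t)
      then have "(\<lambda>k. h (r k) t) \<longlonglongrightarrow> g t"
        by (simp add: g_def convergent_LIMSEQ_iff)
      then have "(\<lambda>k. ennreal ((norm (h (r k) t - h n t))\<^sup>2)) \<longlonglongrightarrow> ennreal ((norm (g t - h n t))\<^sup>2)"
        by (intro tendsto_ennrealI tendsto_intros)
      from lim_imp_Liminf[OF _ this] show ?case
        by simp
    qed
    also have "\<dots> \<le> liminf (\<lambda>k. \<integral>\<^sup>+t. ennreal ((norm (h (r k) t - h n t))\<^sup>2) \<partial>?M)"
      by (rule nn_integral_liminf) measurable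
    also have "\<dots> = liminf (\<lambda>k. ennreal (sq_int a b (\<lambda>t. h (r k) t - h n t)))"
      by (simp add: nn_sq square_integrable_diff sq)
    also have "\<dots> \<le> ennreal e"
    proof (rule Liminf_le)
      show "\<forall>\<^sub>F k in sequentially. ennreal (sq_int a b (\<lambda>t. h (r k) t - h n t)) \<le> ennreal e"
        using eventually_ge_at_top[of K]
        by eventually_elim (use e seq_suble[OF r] in \<open>meson ennreal_leI le_trans less_imp_le\<close>)
    qed simp
    finally show ?thesis .
  qed
  have sq_diff: "(\<lambda>t. g t - h n t) square_integrable_on {a..b} \<and> sq_int a b (\<lambda>t. g t - h n t) \<le> e"
    if e: "\<forall>m\<ge>K. sq_int a b (\<lambda>t. h m t - h n t) < e" for n e K
  proof -
    have e0: "0 \<le> e"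
      using e sq_int_nonneg[of "{a..b}" "\<lambda>t. h K t - h n t"] by fastforce
    have "integrable ?M (\<lambda>t. (norm (g t - h n t))\<^sup>2)"
      using le_less_trans[OF est[OF e]] by (intro integrableI_nonneg) auto
    then have "(\<lambda>t. (norm (g t - h n t))\<^sup>2) integrable_on {a..b}"
      by (intro integrable_on_lebesgue_on) auto
    then have sqi: "(\<lambda>t. g t - h n t) square_integrable_on {a..b}"
      by (intro square_integrableI) measurable
    moreover have "ennreal (sq_int a b (\<lambda>t. g t - h n t)) \<le> ennreal e"
      using est[OF e] nn_sq[OF sqi] by simp
    ultimately show ?thesis
      using e0 by (simp add: ennreal_le_iff)
  qed
  show ?thesis
  proof
    obtain K where "\<forall>m\<ge>K. \<forall>n\<ge>K. sq_int a b (\<lambda>t. h m t - h n t) < 1"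
      using Cauchy[of 1] by auto
    then have "(\<lambda>t. g t - h K t) square_integrable_on {a..b}"
      using sq_diff[of K K 1] by auto
    then have "(\<lambda>t. (g t - h K t) + h K t) square_integrable_on {a..b}"
      by (intro square_integrable_add sq)
    then show "g square_integrable_on {a..b}" by simp
    show "(\<lambda>n. sq_int a b (\<lambda>t. g t - h n t)) \<longlonglongrightarrow> 0"
    proof (rule LIMSEQ_I)
      fix e :: real assume "0 < e"
      then obtain K where K: "\<forall>m\<ge>K. \<forall>n\<ge>K. sq_int a b (\<lambda>t. h m t - h n t) < e/2"
        using Cauchy[of "e/2"] by auto
      have "sq_int a b (\<lambda>t. g t - h n t) \<le> e/2" if "n \<ge> K" for n
        using sq_diff[of K n "e/2"] K that by auto
      then show "\<exists>no. \<forall>n\<ge>no. norm (sq_int a b (\<lambda>t. g t - h n t) - 0) < e"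
        using \<open>0 < e\<close> by (intro exI[of _ K]) (fastforce simp: sq_int_nonneg)
    qed
  qed
qed

text \<open>Young's inequality with a free weight. A small \<open>c\<close> keeps the factor of the
  first term near 1, so that sharp bounds survive limits; \<open>c = 1\<close> gives the crude
  estimate with factors 2.\<close>

lemma sq_int_le_weighted:
  fixes f k :: "real \<Rightarrow> 'a::euclidean_space"
  assumes "f square_integrable_on {a..b}" "k square_integrable_on {a..b}" "0 < c"
  shows "sq_int a b f \<le> (1 + c) * sq_int a b k + (1 + 1/c) * sq_int a b (\<lambda>t. f t - k t)"
proof -
  have int: "(\<lambda>t. (norm (f t))\<^sup>2) integrable_on {a..b}" "(\<lambda>t. (norm (k t))\<^sup>2) integrable_on {a..b}"
    "(\<lambda>t. (norm (f t - k t))\<^sup>2) integrable_on {a..b}"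
    using square_integrableD(4) assms square_integrable_diff[OF assms(1,2)] by auto
  have pt: "(norm (f t))\<^sup>2 \<le> (1 + c) * (norm (k t))\<^sup>2 + (1 + 1/c) * (norm (f t - k t))\<^sup>2" for t
  proof -
    define x y where "x = norm (k t)" and "y = norm (f t - k t)"
    have "norm (f t) \<le> x + y"
      unfolding x_def y_def by norm
    then have "(norm (f t))\<^sup>2 \<le> (x + y)\<^sup>2"
      by (intro power_mono) auto
    also have "\<dots> \<le> (1 + c) * x\<^sup>2 + (1 + 1/c) * y\<^sup>2"
    proof -
      have "0 \<le> (c * x - y)\<^sup>2 / c" using assms(3) by simp
      also have "(c * x - y)\<^sup>2 / c = (1 + c) * x\<^sup>2 + (1 + 1/c) * y\<^sup>2 - (x + y)\<^sup>2"
        using assms(3) by (simp add: power2_eq_square field_simps)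
      finally show ?thesis by simp
    qed
    finally show ?thesis unfolding x_def y_def .
  qed
  have rhs: "((\<lambda>t. (1 + c) * (norm (k t))\<^sup>2 + (1 + 1/c) * (norm (f t - k t))\<^sup>2) has_integral
      (1 + c) * sq_int a b k + (1 + 1/c) * sq_int a b (\<lambda>t. f t - k t)) {a..b}"
    by (intro has_integral_add has_integral_mult_right integrable_integral int)
  show ?thesis
    by (rule has_integral_le[OF integrable_integral[OF int(1)] rhs pt])
qed

lemma sq_int_parallelogram:
  fixes f k :: "real \<Rightarrow> 'a::euclidean_space"
  assumes "f square_integrable_on {a..b}" "k square_integrable_on {a..b}"
  shows "sq_int a b (\<lambda>t. f t - k t)
       = 2 * sq_int a b f + 2 * sq_int a b k - 4 * sq_int a b (\<lambda>t. (1/2) *\<^sub>R (f t + k t))"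
proof (rule integral_unique)
  have half: "(\<lambda>t. (1/2) *\<^sub>R (f t + k t)) square_integrable_on {a..b}"
    by (intro square_integrable_scaleR square_integrable_add assms)
  have eq: "(norm (x - y))\<^sup>2 = 2 * (norm x)\<^sup>2 + 2 * (norm y)\<^sup>2 - 4 * (norm ((1/2) *\<^sub>R (x + y)))\<^sup>2" for x y :: 'a
    unfolding norm_scaleR power_mult_distrib
    by (simp add: power2_norm_eq_inner power_divide algebra_simps inner_commute)
  show "((\<lambda>t. (norm (f t - k t))\<^sup>2) has_integral
     2 * sq_int a b f + 2 * sq_int a b k - 4 * sq_int a b (\<lambda>t. (1/2) *\<^sub>R (f t + k t))) {a..b}"
    unfolding eq
    by (intro has_integral_add has_integral_diff has_integral_mult_right integrable_integral
        square_integrableD(4) assms half)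
qed

text \<open>The limit density is the element of least norm, over a shrinking family of convex sets, which
  the parallelogram law turns into a Cauchy sequence; this replaces weak compactness of balls in
  \<open>L\<^sup>2\<close>.\<close>

lemma L2_density_of_uniform_limit:
  fixes G :: "real \<Rightarrow> 'a::euclidean_space"
  assumes T: "0 \<le> T"
    and approx: "\<And>e. 0 < e \<Longrightarrow> \<exists>g. g square_integrable_on {0..T} \<and> sq_int 0 T g \<le> M \<and>
        (\<forall>t\<in>{0..T}. norm (integral {0..t} g - G t) \<le> e)"
  obtains h where "h square_integrable_on {0..T}" "sq_int 0 T h \<le> M"
    "\<And>t. t \<in> {0..T} \<Longrightarrow> G t = integral {0..t} h"
proof -
  define \<eta> where "\<eta> n = 1 / (real n + 1)" for n
  define S where "S n = {h. h square_integrable_on {0..T} \<and>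
      (\<forall>t\<in>{0..T}. norm (integral {0..t} h - G t) \<le> \<eta> n)}" for n
  have \<eta>0: "0 < \<eta> n" for n by (simp add: \<eta>_def)
  have \<eta>mono: "\<eta> n \<le> \<eta> N" if "N \<le> n" for n N using that by (simp add: \<eta>_def frac_le)
  have \<eta>lim: "\<eta> \<longlonglongrightarrow> 0"
    unfolding \<eta>_def[abs_def] using LIMSEQ_inverse_real_of_nat by (simp add: inverse_eq_divide add.commute)
  have S_mono: "S n \<subseteq> S N" if "N \<le> n" for n N
    unfolding S_def using \<eta>mono[OF that] by fastforce
  \<comment> \<open>The sets \<open>S n\<close> shrink, so these infima increase; they stay below
    \<open>M\<close> and hence converge, which makes almost minimal elements a Cauchy
    sequence.\<close>
  define D where "D n = Inf (sq_int 0 T ` S n)" for n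
  have bdd: "bdd_below (sq_int 0 T ` S n)" for n
    by (intro bdd_belowI2[of _ 0]) (rule sq_int_nonneg)
  have ex: "\<exists>h\<in>S n. sq_int 0 T h \<le> M" for n
    using approx[OF \<eta>0] unfolding S_def by blast
  have ne: "sq_int 0 T ` S n \<noteq> {}" for n using ex[of n] by auto
  have D_le: "D n \<le> sq_int 0 T h" if "h \<in> S n" for n h
    unfolding D_def by (intro cInf_lower imageI that bdd)
  have D_M: "D n \<le> M" for n
    using ex[of n] D_le by force
  have D_mono: "incseq D"
    unfolding D_def by (intro incseq_SucI cInf_superset_mono ne bdd image_mono S_mono) simp
  obtain L where L: "D \<longlonglongrightarrow> L" "\<And>n. D n \<le> L"
    using incseq_convergent[OF D_mono, of M] D_M by blast
  have "\<exists>h\<in>S n. sq_int 0 T h < D n + \<eta> n" for n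
    using cInf_lessD[OF ne, of n "D n + \<eta> n"] \<eta>0[of n] unfolding D_def by auto
  then obtain h where h: "\<And>n. h n \<in> S n" "\<And>n. sq_int 0 T (h n) < D n + \<eta> n"
    by metis
  have sq: "h n square_integrable_on {0..T}" for n
    using h(1)[of n] by (simp add: S_def)
  have half: "(\<lambda>t. (1/2) *\<^sub>R (h m t + h n t)) \<in> S N" if "N \<le> m" "N \<le> n" for m n N
  proof -
    have "norm (integral {0..t} (\<lambda>t. (1/2) *\<^sub>R (h m t + h n t)) - G t) \<le> \<eta> N" if t: "t \<in> {0..T}" for t
    proof -
      have int: "h k integrable_on {0..t}" for k
        using square_integrableD(2)[OF square_integrable_subinterval[OF sq]] t by simp
      have "integral {0..t} (\<lambda>t. (1/2) *\<^sub>R (h m t + h n t)) - G t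
          = (1/2) *\<^sub>R (integral {0..t} (h m) - G t) + (1/2) *\<^sub>R (integral {0..t} (h n) - G t)"
        using int by (simp add: integral_add algebra_simps flip: scaleR_left_distrib)
      also have "norm \<dots> \<le> (1/2) * norm (integral {0..t} (h m) - G t) + (1/2) * norm (integral {0..t} (h n) - G t)"
        by (rule order_trans[OF norm_triangle_ineq]) simp
      also have "\<dots> \<le> (1/2) * \<eta> N + (1/2) * \<eta> N"
      proof -
        have "norm (integral {0..t} (h k) - G t) \<le> \<eta> N" if "N \<le> k" for k
          using h(1)[of k] S_mono[OF that] t by (auto simp: S_def)
        from this[OF \<open>N \<le> m\<close>] this[OF \<open>N \<le> n\<close>] show ?thesis by simp
      qed
      finally show ?thesis by simp
    qed
    then show ?thesis
      unfolding S_def by (auto intro!: square_integrable_scaleR square_integrable_add sq)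
  qed
  \<comment> \<open>Both functions have squared norm at most \<open>L + \<eta> N\<close>, while
    their midpoint lies in the convex set \<open>S N\<close> and so has squared norm at least
    \<open>D N\<close>.\<close>
  have est: "sq_int 0 T (\<lambda>t. h m t - h n t) \<le> 4 * (L - D N) + 4 * \<eta> N" if "N \<le> m" "N \<le> n" for m n N
  proof -
    have "sq_int 0 T (h k) \<le> L + \<eta> N" if "N \<le> k" for k
      using h(2)[of k] L(2)[of k] \<eta>mono[OF that] by linarith
    from this[OF that(1)] this[OF that(2)] show ?thesis
      using sq_int_parallelogram[OF sq sq, of m n] D_le[OF half[OF that]] by argo
  qed
  have Cauchy: "\<exists>N. \<forall>m\<ge>N. \<forall>n\<ge>N. sq_int 0 T (\<lambda>t. h m t - h n t) < e" if "0 < e" for e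
  proof -
    have "(\<lambda>N. 4 * (L - D N) + 4 * \<eta> N) \<longlonglongrightarrow> 4 * (L - L) + 4 * 0"
      by (intro tendsto_intros L \<eta>lim)
    then have "\<forall>\<^sub>F N in sequentially. 4 * (L - D N) + 4 * \<eta> N < e"
      using that by (intro order_tendstoD) auto
    then obtain N where "4 * (L - D N) + 4 * \<eta> N < e"
      using eventually_happens'[OF sequentially_bot] by blast
    then show ?thesis
      using est le_less_trans by blast
  qed
  obtain g where g: "g square_integrable_on {0..T}" "(\<lambda>n. sq_int 0 T (\<lambda>t. g t - h n t)) \<longlonglongrightarrow> 0"
    using L2_complete[OF T sq Cauchy] by blast
  show ?thesis
  proof
    show "g square_integrable_on {0..T}" by fact
    \<comment> \<open>The weight \<open>c\<close> is fixed while \<open>n\<close> grows, so that the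
      error term vanishes; only then does \<open>c\<close> tend to 0, which leaves exactly
      \<open>M\<close>.\<close>
    have "sq_int 0 T g \<le> (1 + c) * M" if c: "0 < c" for c
    proof (rule LIMSEQ_le_const)
      show "(\<lambda>n. (1 + c) * (M + \<eta> n) + (1 + 1/c) * sq_int 0 T (\<lambda>t. g t - h n t)) \<longlonglongrightarrow> (1 + c) * M"
        by (rule tendsto_eq_intros \<eta>lim g(2) refl | simp)+
      have "sq_int 0 T g \<le> (1 + c) * (M + \<eta> n) + (1 + 1/c) * sq_int 0 T (\<lambda>t. g t - h n t)" for n
      proof -
        have "(1 + c) * sq_int 0 T (h n) \<le> (1 + c) * (M + \<eta> n)"
          using h(2)[of n] D_M[of n] c by (intro mult_left_mono) auto
        then show ?thesis
          using sq_int_le_weighted[OF g(1) sq c, of n] by linarith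
      qed
      then show "\<exists>N. \<forall>n\<ge>N. sq_int 0 T g \<le> (1 + c) * (M + \<eta> n) + (1 + 1/c) * sq_int 0 T (\<lambda>t. g t - h n t)"
        by blast
    qed
    moreover have "((\<lambda>c. (1 + c) * M) \<longlongrightarrow> (1 + 0) * M) (at_right 0)"
      by (intro tendsto_intros)
    ultimately show "sq_int 0 T g \<le> M"
      by (intro tendsto_lowerbound[of "\<lambda>c. (1 + c) * M" M "at_right 0"])
        (auto simp: eventually_at_right_field intro: exI[of _ 1])
    fix t assume t: "t \<in> {0..T}"
    have "norm (integral {0..t} g - G t) \<le> sqrt (T * sq_int 0 T (\<lambda>t. g t - h n t)) + \<eta> n" for n
    proof -
      have gh: "(\<lambda>t. g t - h n t) square_integrable_on {0..T}"
        by (intro square_integrable_diff g sq)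
      have sub: "{0..t} \<subseteq> {0..T}" using t by auto
      have "norm (integral {0..t} (\<lambda>t. g t - h n t)) \<le> sqrt (T * sq_int 0 T (\<lambda>t. g t - h n t))"
      proof (rule real_le_rsqrt)
        have "(norm (integral {0..t} (\<lambda>t. g t - h n t)))\<^sup>2 \<le> (t - 0) * sq_int 0 t (\<lambda>t. g t - h n t)"
          using t by (intro Cauchy_Schwarz_integral square_integrable_subinterval[OF gh sub]) auto
        also have "\<dots> \<le> T * sq_int 0 T (\<lambda>t. g t - h n t)"
          using t sq_int_subinterval_le[OF gh sub] T by (intro mult_mono sq_int_nonneg) auto
        finally show "(norm (integral {0..t} (\<lambda>t. g t - h n t)))\<^sup>2 \<le> T * sq_int 0 T (\<lambda>t. g t - h n t)" .
      qed
      moreover have "integral {0..t} (\<lambda>t. g t - h n t) = integral {0..t} g - integral {0..t} (h n)"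
        by (intro integral_diff square_integrableD(2) square_integrable_subinterval[OF _ sub] g sq)
      moreover have "norm (integral {0..t} (h n) - G t) \<le> \<eta> n"
        using h(1)[of n] t by (simp add: S_def)
      ultimately show ?thesis
        using norm_triangle_ineq[of "integral {0..t} g - integral {0..t} (h n)" "integral {0..t} (h n) - G t"]
        by simp
    qed
    moreover have "(\<lambda>n. sqrt (T * sq_int 0 T (\<lambda>t. g t - h n t)) + \<eta> n) \<longlonglongrightarrow> 0"
      by (rule tendsto_eq_intros \<eta>lim g(2) refl | simp)+
    ultimately have "norm (integral {0..t} g - G t) \<le> 0"
      by (intro LIMSEQ_le_const) auto
    then show "G t = integral {0..t} g" by simp
  qed
qed

subsection \<open>Absolutely continuous functions\<close>

lemma has_ac_derivD:
  assumes "has_ac_deriv T f g"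
  shows "g absolutely_integrable_on {0..T}" "g integrable_on {0..T}"
    "t \<in> {0..T} \<Longrightarrow> f t = f 0 + integral {0..t} g"
  using assms unfolding has_ac_deriv_def absolutely_integrable_on_def by blast+

lemma has_ac_deriv_increment:
  assumes "has_ac_deriv T f g" "0 \<le> s" "s \<le> t" "t \<le> T"
  shows "f t - f s = integral {s..t} g"
proof -
  have "integral {0..s} g + integral {s..t} g = integral {0..t} g"
    by (rule Henstock_Kurzweil_Integration.integral_combine[OF assms(2,3)])
      (use integrable_on_subinterval[OF has_ac_derivD(2)[OF assms(1)]] assms in auto)
  then show ?thesis
    using has_ac_derivD(3)[OF assms(1), of s] has_ac_derivD(3)[OF assms(1), of t] assms
    by (simp add: algebra_simps)
qed

lemma has_ac_deriv_continuous:
  assumes "has_ac_deriv T f g"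
  shows "continuous_on {0..T} f"
proof -
  have "continuous_on {0..T} (\<lambda>t. f 0 + integral {0..t} g)"
    by (intro continuous_intros indefinite_integral_continuous_1 has_ac_derivD[OF assms])
  then show ?thesis
    by (rule continuous_on_eq) (rule has_ac_derivD(3)[OF assms, symmetric])
qed

lemma has_ac_deriv_add:
  assumes "has_ac_deriv T f g" "has_ac_deriv T f' g'"
  shows "has_ac_deriv T (\<lambda>t. f t + f' t) (\<lambda>t. g t + g' t)"
  unfolding has_ac_deriv_def
proof (intro conjI ballI)
  show "(\<lambda>t. g t + g' t) absolutely_integrable_on {0..T}"
    by (intro set_integral_add has_ac_derivD(1)[OF assms(1)] has_ac_derivD(1)[OF assms(2)])
  fix t assume t: "t \<in> {0..T}"
  then have "integral {0..t} (\<lambda>t. g t + g' t) = integral {0..t} g + integral {0..t} g'"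
    by (intro integral_add integrable_on_subinterval[OF has_ac_derivD(2)[OF assms(1)]]
        integrable_on_subinterval[OF has_ac_derivD(2)[OF assms(2)]]) auto
  then show "f t + f' t = f 0 + f' 0 + integral {0..t} (\<lambda>t. g t + g' t)"
    using has_ac_derivD(3)[OF assms(1) t] has_ac_derivD(3)[OF assms(2) t] by simp
qed

lemma has_ac_deriv_linear:
  assumes "has_ac_deriv T f g" and l: "bounded_linear l"
  shows "has_ac_deriv T (\<lambda>t. l (f t)) (\<lambda>t. l (g t))"
  unfolding has_ac_deriv_def
proof (intro conjI ballI)
  show "(\<lambda>t. l (g t)) absolutely_integrable_on {0..T}"
    using absolutely_integrable_linear[OF has_ac_derivD(1)[OF assms(1)] l] by (simp add: o_def)
  fix t assume t: "t \<in> {0..T}"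
  have "integral {0..t} (l \<circ> g) = l (integral {0..t} g)"
    by (rule integral_linear[OF _ l], rule integrable_on_subinterval[OF has_ac_derivD(2)[OF assms(1)]])
      (use t in auto)
  then show "l (f t) = l (f 0) + integral {0..t} (\<lambda>t. l (g t))"
    using has_ac_derivD(3)[OF assms(1) t] linear_add[OF bounded_linear.linear[OF l]] by (simp add: o_def)
qed

lemma has_ac_deriv_diff:
  assumes "has_ac_deriv T f g" "has_ac_deriv T f' g'"
  shows "has_ac_deriv T (\<lambda>t. f t - f' t) (\<lambda>t. g t - g' t)"
  using has_ac_deriv_add[OF assms(1) has_ac_deriv_linear[OF assms(2) bounded_linear_minus[OF bounded_linear_ident]]]
  by simp

text \<open>Lebesgue differentiation over the intervals \<open>{t..t + h}\<close>, for the density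
  extended by 0 to the line. One-sided quotients suffice for the uniqueness of the density and for
  the sweeping inclusion, which is tested forward in time.\<close>

lemma has_ac_deriv_right_derivative:
  assumes "has_ac_deriv T f g"
  obtains N where "negligible N"
    "\<And>t. t \<in> {0..<T} - N \<Longrightarrow> ((\<lambda>h. (1/h) *\<^sub>R (f (t + h) - f t)) \<longlongrightarrow> g t) (at_right 0)"
proof -
  define g0 where "g0 t = (if t \<in> {0..T} then g t else 0)" for t
  have g0: "g0 integrable_on UNIV"
    unfolding g0_def[abs_def] integrable_restrict_UNIV by (rule has_ac_derivD(2)[OF assms])
  have "g0 integrable_on cbox a b" for a b
    by (rule integrable_on_subcbox[OF g0]) simp
  then obtain N where N: "negligible N" "\<And>x e. x \<notin> N \<Longrightarrow> 0 < e \<Longrightarrow>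
      \<exists>d>0. \<forall>h. 0 < h \<and> h < d \<longrightarrow> norm (integral (cbox x (x + h *\<^sub>R One)) g0 /\<^sub>R h ^ DIM(real) - g0 x) < e"
    using integrable_ccontinuous_explicit[of g0] by blast
  show ?thesis
  proof
    fix t assume t: "t \<in> {0..<T} - N"
    show "((\<lambda>h. (1/h) *\<^sub>R (f (t + h) - f t)) \<longlongrightarrow> g t) (at_right 0)"
    proof (rule tendstoI)
      fix e :: real assume "0 < e"
      then obtain d where d: "0 < d" "\<And>h. 0 < h \<Longrightarrow> h < d \<Longrightarrow> norm (integral {t..t + h} g0 /\<^sub>R h - g0 t) < e"
        using N(2)[of t e] t by auto
      have "dist ((1/h) *\<^sub>R (f (t + h) - f t)) (g t) < e" if h: "0 < h" "h < min d (T - t)" for h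
      proof -
        have "integral {t..t + h} g0 = integral {t..t + h} g"
          by (rule integral_cong) (use h t in \<open>auto simp: g0_def\<close>)
        also have "\<dots> = f (t + h) - f t"
          using has_ac_deriv_increment[OF assms, of t "t + h"] h t by simp
        finally have "integral {t..t + h} g0 /\<^sub>R h - g0 t = (1/h) *\<^sub>R (f (t + h) - f t) - g t"
          using t by (simp add: g0_def divide_inverse)
        with d(2)[of h] h show ?thesis
          by (simp add: dist_norm)
      qed
      then show "\<forall>\<^sub>F h in at_right 0. dist ((1/h) *\<^sub>R (f (t + h) - f t)) (g t) < e"
        unfolding eventually_at_right_field using d(1) t by (intro exI[of _ "min d (T - t)"]) auto
    qed
  qed (rule N)
qed

text \<open>Both densities are the right derivative almost everywhere; the end point
  \<open>T\<close> has no forward quotient and joins the exceptional set.\<close>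

lemma has_ac_deriv_unique:
  assumes "has_ac_deriv T f g" "has_ac_deriv T f g'"
  obtains N where "negligible N" "\<And>t. t \<in> {0..T} - N \<Longrightarrow> g t = g' t"
proof -
  obtain N where N: "negligible N"
    "\<And>t. t \<in> {0..<T} - N \<Longrightarrow> ((\<lambda>h. (1/h) *\<^sub>R (f (t + h) - f t)) \<longlongrightarrow> g t) (at_right 0)"
    by (rule has_ac_deriv_right_derivative[OF assms(1)]) blast
  obtain N' where N': "negligible N'"
    "\<And>t. t \<in> {0..<T} - N' \<Longrightarrow> ((\<lambda>h. (1/h) *\<^sub>R (f (t + h) - f t)) \<longlongrightarrow> g' t) (at_right 0)"
    by (rule has_ac_deriv_right_derivative[OF assms(2)]) blast
  show ?thesis
  proof
    show "negligible (insert T (N \<union> N'))"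
      using N N' by (simp add: negligible_insert)
    fix t assume "t \<in> {0..T} - insert T (N \<union> N')"
    then have "t \<in> {0..<T} - N" "t \<in> {0..<T} - N'" by auto
    from tendsto_unique[OF trivial_limit_at_right_real N(2)[OF this(1)] N'(2)[OF this(2)]]
    show "g t = g' t" .
  qed
qed

section \<open>Sobolev functions: the chosen derivative and bounds on the norm\<close>

lemma W12I:
  assumes "has_ac_deriv T f g" "g square_integrable_on {0..T}"
  shows "W12 T f"
  unfolding W12_def using assms(1) square_integrableD(4)[OF assms(2)] by auto

text \<open>The choice in \<open>ac_deriv\<close> may pick a density other than the square
  integrable one, but all densities agree almost everywhere.\<close>

lemma W12D:
  assumes "W12 T f"
  shows "has_ac_deriv T f (ac_deriv T f)" "ac_deriv T f square_integrable_on {0..T}"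
proof -
  obtain g where g: "has_ac_deriv T f g" "g square_integrable_on {0..T}"
  proof -
    obtain g where "has_ac_deriv T f g" "(\<lambda>t. (norm (g t))\<^sup>2) integrable_on {0..T}"
      using assms unfolding W12_def by auto
    with that show ?thesis
      using has_ac_derivD(1) by (auto simp: square_integrable_on_def)
  qed
  show 1: "has_ac_deriv T f (ac_deriv T f)"
    unfolding ac_deriv_def using someI[of "has_ac_deriv T f", OF g(1)] .
  obtain N where N: "negligible N" "\<And>t. t \<in> {0..T} - N \<Longrightarrow> ac_deriv T f t = g t"
    by (rule has_ac_deriv_unique[OF 1 g(1)]) blast
  show "ac_deriv T f square_integrable_on {0..T}"
    by (rule square_integrable_spike(1)[OF g(2) N])
qed

lemma sq_int_ac_deriv:
  assumes "has_ac_deriv T f g" "g square_integrable_on {0..T}"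
  shows "sq_int 0 T (ac_deriv T f) = sq_int 0 T g"
proof -
  obtain N where N: "negligible N" "\<And>t. t \<in> {0..T} - N \<Longrightarrow> ac_deriv T f t = g t"
    by (rule has_ac_deriv_unique[OF W12D(1)[OF W12I[OF assms]] assms(1)]) blast
  show ?thesis
    by (rule square_integrable_spike(2)[OF assms(2) N])
qed

lemma norm_sq_ac_le:
  assumes "has_ac_deriv T f g" "g square_integrable_on {0..T}" "f 0 = 0" "t \<in> {0..T}"
  shows "(norm (f t))\<^sup>2 \<le> T * sq_int 0 T g"
proof -
  have sub: "{0..t} \<subseteq> {0..T}" using assms by auto
  have "(norm (f t))\<^sup>2 = (norm (integral {0..t} g))\<^sup>2"
    using has_ac_derivD(3)[OF assms(1,4)] assms(3) by simp
  also have "\<dots> \<le> (t - 0) * sq_int 0 t g"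
    using assms by (intro Cauchy_Schwarz_integral square_integrable_subinterval[OF assms(2) sub]) auto
  also have "\<dots> \<le> T * sq_int 0 T g"
    using assms sq_int_subinterval_le[OF assms(2) sub] by (intro mult_mono sq_int_nonneg) auto
  finally show ?thesis .
qed

text \<open>As \<open>f\<close> starts at 0, \<open>norm_sq_ac_le\<close> bounds its square
  pointwise by \<open>T\<close> times the energy of the derivative. Integrating over
  \<open>{0..T}\<close> gives the factor \<open>T\<^sup>2\<close>, and the derivative itself adds
  the 1.\<close>

lemma W12_norm_le:
  assumes "has_ac_deriv T f g" "g square_integrable_on {0..T}" "f 0 = 0" "0 \<le> T" "sq_int 0 T g \<le> M"
  shows "W12_norm T f \<le> sqrt ((T\<^sup>2 + 1) * M)"
proof -
  have cont: "continuous_on {0..T} f" by (rule has_ac_deriv_continuous[OF assms(1)])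
  have c: "((\<lambda>t. T * sq_int 0 T g) has_integral T * (T * sq_int 0 T g)) {0..T}"
    using has_integral_const_real[of "T * sq_int 0 T g" 0 T] assms(4) by simp
  have "sq_int 0 T f \<le> T * (T * sq_int 0 T g)"
    by (rule has_integral_le[OF integrable_integral c])
      (use norm_sq_ac_le[OF assms(1-3)] square_integrableD(4)[OF square_integrable_continuous[OF cont]] in auto)
  also have "\<dots> = T\<^sup>2 * sq_int 0 T g" by (simp add: power2_eq_square)
  finally have "sq_int 0 T f + sq_int 0 T g \<le> (T\<^sup>2 + 1) * sq_int 0 T g"
    by (simp add: algebra_simps)
  also have "\<dots> \<le> (T\<^sup>2 + 1) * M"
    using assms(5) by (intro mult_left_mono) auto
  finally show ?thesis
    unfolding W12_norm_def sq_int_ac_deriv[OF assms(1,2)] by simp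
qed

subsection \<open>Meshes and piecewise linear functions\<close>

text \<open>The cells are left-open to match \<open>pl_extension\<close>: a node \<open>t j\<close>
  with \<open>0 < j\<close> belongs to cell \<open>j - 1\<close>, and time 0 to cell 0.\<close>

definition mesh_index :: "(nat \<Rightarrow> real) \<Rightarrow> real \<Rightarrow> nat" where
  "mesh_index t s = (LEAST j. s \<le> t (Suc j))"

definition pl_slope :: "(nat \<Rightarrow> real) \<Rightarrow> (nat \<Rightarrow> 'a::real_vector) \<Rightarrow> real \<Rightarrow> 'a" where
  "pl_slope t v s = (let j = mesh_index t s in (1 / (t (Suc j) - t j)) *\<^sub>R (v (Suc j) - v j))"

lemma pl_extension_eq:
  "pl_extension t v s = v (mesh_index t s) + (s - t (mesh_index t s)) *\<^sub>R pl_slope t v s"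
  by (simp add: pl_extension_def pl_slope_def mesh_index_def Let_def)

context
  fixes T :: real and t :: "nat \<Rightarrow> real" and \<nu> :: nat
  assumes mesh: "mesh T t \<nu>"
begin

lemma mesh_ends: "t 0 = 0" "t \<nu> = T"
  and mesh_step: "j < \<nu> \<Longrightarrow> t j < t (Suc j)"
  using mesh by (auto simp: mesh_def)

lemma mesh_mono: "i \<le> j \<Longrightarrow> j \<le> \<nu> \<Longrightarrow> t i \<le> t j"
proof (induction j rule: dec_induct)
  case (step n)
  then show ?case using mesh_step[of n] by simp
qed simp

lemma mesh_node: "j \<le> \<nu> \<Longrightarrow> t j \<in> {0..T}"
  using mesh_mono[of 0 j] mesh_mono[of j \<nu>] mesh_ends by auto

lemma mesh_cell: "j < \<nu> \<Longrightarrow> {t j..t (Suc j)} \<subseteq> {0..T}"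
  using mesh_node[of j] mesh_node[of "Suc j"] by auto

lemma mesh_size_ge: "j < \<nu> \<Longrightarrow> t (Suc j) - t j \<le> mesh_size t \<nu>"
  unfolding mesh_size_def by (intro Max_ge) auto

lemma mesh_index_eq: "j < \<nu> \<Longrightarrow> s \<in> {t j<..t (Suc j)} \<Longrightarrow> mesh_index t s = j"
  unfolding mesh_index_def
proof (rule Least_equality)
  fix i assume j: "j < \<nu>" and s: "s \<in> {t j<..t (Suc j)}" and i: "s \<le> t (Suc i)"
  show "j \<le> i"
  proof (rule ccontr)
    assume "\<not> j \<le> i"
    then have "t (Suc i) \<le> t j" using mesh_mono[of "Suc i" j] j by simp
    with s i show False by simp
  qed
qed auto

lemma mesh_index_0: "s \<le> t (Suc 0) \<Longrightarrow> mesh_index t s = 0"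
  unfolding mesh_index_def by (intro Least_equality) auto

lemma mesh_index_cell:
  assumes "0 < T" "s \<in> {0..T}"
  shows "mesh_index t s < \<nu>" "t (mesh_index t s) \<le> s" "s \<le> t (Suc (mesh_index t s))"
proof -
  have \<nu>: "0 < \<nu>" using assms(1) mesh_ends by (cases \<nu>) auto
  have last: "s \<le> t (Suc (\<nu> - 1))" using assms(2) mesh_ends \<nu> by simp
  show "s \<le> t (Suc (mesh_index t s))"
    unfolding mesh_index_def by (rule LeastI[of "\<lambda>j. s \<le> t (Suc j)", OF last])
  have "mesh_index t s \<le> \<nu> - 1"
    unfolding mesh_index_def by (rule Least_le[of "\<lambda>j. s \<le> t (Suc j)", OF last])
  then show "mesh_index t s < \<nu>" using \<nu> by simp
  show "t (mesh_index t s) \<le> s"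
  proof (cases "mesh_index t s")
    case 0
    then show ?thesis using assms(2) mesh_ends by simp
  next
    case (Suc i)
    then have "\<not> s \<le> t (Suc i)"
      using not_less_Least[of i "\<lambda>j. s \<le> t (Suc j)"] by (simp add: mesh_index_def)
    then show ?thesis using Suc by simp
  qed
qed

lemma pl_slope_cell:
  "j < \<nu> \<Longrightarrow> s \<in> {t j<..t (Suc j)} \<Longrightarrow> pl_slope t v s = (1 / (t (Suc j) - t j)) *\<^sub>R (v (Suc j) - v j)"
  by (simp add: pl_slope_def mesh_index_eq)

lemma pl_extension_cell:
  assumes "j < \<nu>" "s \<in> {t j..t (Suc j)}"
  shows "pl_extension t v s = v j + (s - t j) *\<^sub>R ((1 / (t (Suc j) - t j)) *\<^sub>R (v (Suc j) - v j))"
proof (cases "s = t j")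
  case False
  then have "mesh_index t s = j" using assms by (intro mesh_index_eq) auto
  then show ?thesis by (simp add: pl_extension_eq pl_slope_def)
next
  \<comment> \<open>For \<open>0 < j\<close> the left end point of the cell is counted to the
    preceding cell, whose value at its right end is the same \<open>v j\<close>.\<close>
  case True
  show ?thesis
  proof (cases j)
    case 0
    then have "mesh_index t s = 0"
      using True mesh_step[OF assms(1)] by (intro mesh_index_0) auto
    then show ?thesis using True 0 by (simp add: pl_extension_eq)
  next
    case (Suc i)
    then have "mesh_index t s = i" "t i < t j"
      using assms True mesh_step[of i] by (auto intro!: mesh_index_eq)
    then show ?thesis using True Suc by (simp add: pl_extension_eq pl_slope_def)
  qed
qed

lemma pl_extension_node:
  assumes "0 < T" "j \<le> \<nu>"
  shows "pl_extension t v (t j) = v j"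
proof (cases "j = \<nu>")
  case False
  then show ?thesis using pl_extension_cell[of j "t j"] mesh_step[of j] assms by auto
next
  case True
  then obtain i where i: "\<nu> = Suc i" using assms mesh_ends by (cases \<nu>) auto
  then show ?thesis
    using pl_extension_cell[of i "t j"] mesh_step[of i] True by auto
qed

section \<open>Integration over the mesh and regularity of piecewise linear functions\<close>

lemma has_integral_mesh:
  fixes f :: "real \<Rightarrow> 'a::banach"
  assumes "\<And>j. j < \<nu> \<Longrightarrow> (f has_integral I j) {t j..t (Suc j)}"
  shows "(f has_integral (\<Sum>j<\<nu>. I j)) {0..T}"
proof -
  have "(f has_integral (\<Sum>j<n. I j)) {t 0..t n}" if "n \<le> \<nu>" for n
    using that
  proof (induction n)
    case (Suc n)
    then show ?case
      using has_integral_combine[of "t 0" "t n" "t (Suc n)" f "\<Sum>j<n. I j" "I n"]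
        assms[of n] mesh_mono[of 0 n] mesh_mono[of n "Suc n"] by simp
  qed auto
  from this[of \<nu>] show ?thesis using mesh_ends by simp
qed

lemma integral_mesh:
  fixes f :: "real \<Rightarrow> 'a::banach"
  assumes "f integrable_on {0..T}"
  shows "(\<Sum>j<\<nu>. integral {t j..t (Suc j)} f) = integral {0..T} f"
proof -
  have "(f has_integral (\<Sum>j<\<nu>. integral {t j..t (Suc j)} f)) {0..T}"
    by (rule has_integral_mesh, rule integrable_integral,
        rule integrable_on_subinterval[OF assms], rule mesh_cell)
  then show ?thesis
    by (simp add: integral_unique)
qed

text \<open>A step function composed with any \<open>F\<close> is again a step function; the general
  \<open>F\<close> covers the slope, its norm and its squared norm at once.\<close>

lemma pl_slope_comp_integrable: "(\<lambda>s. F (pl_slope t v s)) integrable_on {0..T}"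
  for F :: "'a::real_vector \<Rightarrow> 'b::euclidean_space"
proof -
  define c where "c j = F ((1 / (t (Suc j) - t j)) *\<^sub>R (v (Suc j) - v j))" for j
  have "((\<lambda>s. F (pl_slope t v s)) has_integral (t (Suc j) - t j) *\<^sub>R c j) {t j..t (Suc j)}" if j: "j < \<nu>" for j
  proof (rule has_integral_spike[of "{t j}"])
    show "((\<lambda>s. c j) has_integral (t (Suc j) - t j) *\<^sub>R c j) {t j..t (Suc j)}"
      using has_integral_const_real[of "c j" "t j" "t (Suc j)"] mesh_step[OF j] by simp
    show "F (pl_slope t v s) = c j" if "s \<in> {t j..t (Suc j)} - {t j}" for s
      using pl_slope_cell[OF j, of s v] that by (auto simp: c_def)
  qed auto
  from has_integral_mesh[OF this] show ?thesis by auto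
qed

lemma pl_slope_square_integrable:
  fixes v :: "nat \<Rightarrow> 'a::euclidean_space"
  shows "pl_slope t v square_integrable_on {0..T}"
  unfolding square_integrable_on_def absolutely_integrable_on_def
  using pl_slope_comp_integrable[of "\<lambda>x. x" v] pl_slope_comp_integrable[of norm v]
    pl_slope_comp_integrable[of "\<lambda>x. (norm x)\<^sup>2" v] by simp

lemma mesh_cover: "0 < T \<Longrightarrow> {0..T} = (\<Union>j\<in>{..<\<nu>}. {t j..t (Suc j)})"
proof (intro equalityI subsetI)
  fix s assume "0 < T" "s \<in> {0..T}"
  from mesh_index_cell[OF this] show "s \<in> (\<Union>j\<in>{..<\<nu>}. {t j..t (Suc j)})"
    by (intro UN_I[of "mesh_index t s"]) auto
next
  fix s assume "s \<in> (\<Union>j\<in>{..<\<nu>}. {t j..t (Suc j)})"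
  then obtain j where "j < \<nu>" "s \<in> {t j..t (Suc j)}" by auto
  then show "s \<in> {0..T}" using mesh_cell[of j] by blast
qed

lemma pl_extension_continuous:
  fixes v :: "nat \<Rightarrow> 'a::euclidean_space"
  assumes "0 < T"
  shows "continuous_on {0..T} (pl_extension t v)"
  unfolding mesh_cover[OF assms]
proof (rule continuous_on_closed_Union)
  fix j assume "j \<in> {..<\<nu>}"
  then have j: "j < \<nu>" by simp
  have "continuous_on {t j..t (Suc j)} (\<lambda>s. v j + (s - t j) *\<^sub>R ((1 / (t (Suc j) - t j)) *\<^sub>R (v (Suc j) - v j)))"
    by (intro continuous_intros)
  then show "continuous_on {t j..t (Suc j)} (pl_extension t v)"
    by (rule continuous_on_eq) (rule pl_extension_cell[OF j, symmetric])
qed auto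

lemma pl_extension_derivative:
  fixes v :: "nat \<Rightarrow> 'a::euclidean_space"
  assumes "0 < T" "s \<in> {0<..<T} - t ` {..\<nu>}"
  shows "(pl_extension t v has_vector_derivative pl_slope t v s) (at s)"
proof -
  define j where "j = mesh_index t s"
  have j: "j < \<nu>" "t j \<le> s" "s \<le> t (Suc j)"
    unfolding j_def using mesh_index_cell[OF assms(1), of s] assms(2) by auto
  have s: "s \<in> {t j<..<t (Suc j)}"
  proof -
    have "s \<noteq> t i" if "i \<le> \<nu>" for i using assms(2) that by auto
    from this[of j] this[of "Suc j"] show ?thesis using j by auto
  qed
  define c where "c = (1 / (t (Suc j) - t j)) *\<^sub>R (v (Suc j) - v j)"
  have "((\<lambda>s. v j + (s - t j) *\<^sub>R c) has_vector_derivative c) (at s)"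
    by (auto intro!: derivative_eq_intros simp: has_vector_derivative_def)
  moreover have "v j + (r - t j) *\<^sub>R c = pl_extension t v r" if "r \<in> {t j<..<t (Suc j)}" for r
    using pl_extension_cell[OF j(1), of r v] that by (simp add: c_def)
  ultimately have "(pl_extension t v has_vector_derivative c) (at s)"
    by (rule has_vector_derivative_transform_within_open[OF _ open_greaterThanLessThan s])
  moreover have "c = pl_slope t v s"
    by (simp add: c_def pl_slope_def j_def Let_def)
  ultimately show ?thesis by simp
qed

text \<open>The nodes form a finite exceptional set in the fundamental theorem of calculus.\<close>

lemma pl_extension_has_ac_deriv:
  fixes v :: "nat \<Rightarrow> 'a::euclidean_space"
  assumes "0 < T"
  shows "has_ac_deriv T (pl_extension t v) (pl_slope t v)"
  unfolding has_ac_deriv_def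
proof (intro conjI ballI)
  show "pl_slope t v absolutely_integrable_on {0..T}"
    by (rule square_integrableD(1)[OF pl_slope_square_integrable])
  fix s assume s: "s \<in> {0..T}"
  have "(pl_slope t v has_integral pl_extension t v s - pl_extension t v 0) {0..s}"
  proof (rule fundamental_theorem_of_calculus_interior_strong[of "t ` {..\<nu>}"])
    show "continuous_on {0..s} (pl_extension t v)"
      by (rule continuous_on_subset[OF pl_extension_continuous[OF assms]]) (use s in simp)
    show "(pl_extension t v has_vector_derivative pl_slope t v x) (at x)" if "x \<in> {0<..<s} - t ` {..\<nu>}" for x
      by (rule pl_extension_derivative[OF assms]) (use that s in auto)
  qed (use s in auto)
  then show "pl_extension t v s = pl_extension t v 0 + integral {0..s} (pl_slope t v)"
    by (simp add: integral_unique)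
qed

lemma pl_extension_W12:
  fixes v :: "nat \<Rightarrow> 'a::euclidean_space"
  shows "0 < T \<Longrightarrow> W12 T (pl_extension t v)"
  by (rule W12I[OF pl_extension_has_ac_deriv pl_slope_square_integrable])

text \<open>The discrete penalty is a squared L2 distance of derivatives: the difference quotients
  are the slopes of the piecewise linear extension except at the left ends of cells, which are
  negligible.\<close>

lemma rate_defect_eq:
  fixes v :: "nat \<Rightarrow> 'a::euclidean_space"
  assumes "W12 T zb"
  shows "rate_defect T zb t \<nu> v = sq_int 0 T (\<lambda>s. pl_slope t v s - ac_deriv T zb s)"
proof -
  have "rate_defect T zb t \<nu> v
      = (\<Sum>j<\<nu>. integral {t j..t (Suc j)} (\<lambda>s. (norm (pl_slope t v s - ac_deriv T zb s))\<^sup>2))"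
    unfolding rate_defect_def
  proof (rule sum.cong[OF refl], rule integral_spike[of "{t _}"])
    fix j s assume "j \<in> {..<\<nu>}" "s \<in> {t j..t (Suc j)} - {t j}"
    then show "(norm (pl_slope t v s - ac_deriv T zb s))\<^sup>2
       = (norm ((1 / (t (Suc j) - t j)) *\<^sub>R (v (Suc j) - v j) - ac_deriv T zb s))\<^sup>2"
      using pl_slope_cell[of j s v] by auto
  qed auto
  also have "\<dots> = sq_int 0 T (\<lambda>s. pl_slope t v s - ac_deriv T zb s)"
    by (intro integral_mesh square_integrableD(4) square_integrable_diff pl_slope_square_integrable W12D assms)
  finally show ?thesis .
qed

text \<open>By the last estimate, convergence of discrete solutions in \<open>W12_norm\<close>
  reduces to convergence of their rate defects to 0.\<close>

lemma pl_extension_deviation: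
  fixes v :: "nat \<Rightarrow> 'a::euclidean_space"
  assumes "0 < T" "W12 T zb" "v 0 = zb 0"
  shows "has_ac_deriv T (\<lambda>s. pl_extension t v s - zb s) (\<lambda>s. pl_slope t v s - ac_deriv T zb s)"
    and "(\<lambda>s. pl_slope t v s - ac_deriv T zb s) square_integrable_on {0..T}"
    and "s \<in> {0..T} \<Longrightarrow> (norm (pl_extension t v s - zb s))\<^sup>2 \<le> T * rate_defect T zb t \<nu> v"
    and "W12_norm T (\<lambda>s. pl_extension t v s - zb s) \<le> sqrt ((T\<^sup>2 + 1) * rate_defect T zb t \<nu> v)"
proof -
  show 1: "has_ac_deriv T (\<lambda>s. pl_extension t v s - zb s) (\<lambda>s. pl_slope t v s - ac_deriv T zb s)"
    by (intro has_ac_deriv_diff pl_extension_has_ac_deriv W12D assms)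
  show 2: "(\<lambda>s. pl_slope t v s - ac_deriv T zb s) square_integrable_on {0..T}"
    by (intro square_integrable_diff pl_slope_square_integrable W12D assms)
  have 3: "pl_extension t v 0 - zb 0 = 0"
    using pl_extension_node[OF assms(1), of 0 v] mesh_ends assms(3) by simp
  show "s \<in> {0..T} \<Longrightarrow> (norm (pl_extension t v s - zb s))\<^sup>2 \<le> T * rate_defect T zb t \<nu> v"
    using norm_sq_ac_le[OF 1 2 3] by (simp add: rate_defect_eq[OF assms(2)])
  show "W12_norm T (\<lambda>s. pl_extension t v s - zb s) \<le> sqrt ((T\<^sup>2 + 1) * rate_defect T zb t \<nu> v)"
    by (rule W12_norm_le[OF 1 2 3]) (use assms rate_defect_eq[OF assms(2)] in simp_all)
qed

text \<open>A velocity bound that does not depend on the mesh: it yields equicontinuity and makes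
  the error term of \<open>pl_distance_decrease\<close> vanish with the mesh size.\<close>

lemma sq_int_pl_slope_le:
  fixes v :: "nat \<Rightarrow> 'a::euclidean_space"
  assumes "W12 T zb"
  shows "sq_int 0 T (pl_slope t v) \<le> 2 * sq_int 0 T (ac_deriv T zb) + 2 * rate_defect T zb t \<nu> v"
  using sq_int_le_weighted[OF pl_slope_square_integrable W12D(2)[OF assms], of 1 v]
  by (simp add: rate_defect_eq[OF assms])

text \<open>Testing the explicit inclusion at the left node instead of the current point costs one factor
  of the mesh size.\<close>

lemma pl_distance_decrease:
  fixes x :: "nat \<Rightarrow> 'a::euclidean_space"
  assumes T: "0 < T" and ab: "0 \<le> a" "a \<le> b" "b \<le> T"
    and vi: "\<And>j. j < \<nu> \<Longrightarrow> a \<le> t (Suc j) \<Longrightarrow> t j \<le> b \<Longrightarrow>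
      ((1 / (t (Suc j) - t j)) *\<^sub>R (x (Suc j) - x j)) \<bullet> (x j - y) \<le> 0"
  shows "(norm (pl_extension t x b - y))\<^sup>2 - (norm (pl_extension t x a - y))\<^sup>2
       \<le> 2 * mesh_size t \<nu> * sq_int 0 T (pl_slope t x)"
proof -
  let ?f = "\<lambda>s. (pl_extension t x s - y) \<bullet> (pl_extension t x s - y)"
  have sub: "{a..b} \<subseteq> {0..T}" using ab by auto
  have lhs: "((\<lambda>s. 2 * (pl_slope t x s \<bullet> (pl_extension t x s - y))) has_integral ?f b - ?f a) {a..b}"
  proof (rule fundamental_theorem_of_calculus_interior_strong[of "t ` {..\<nu>}"])
    show "continuous_on {a..b} ?f"
      by (intro continuous_intros continuous_on_subset[OF pl_extension_continuous[OF T] sub])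
    show "(?f has_vector_derivative 2 * (pl_slope t x s \<bullet> (pl_extension t x s - y))) (at s)"
      if s: "s \<in> {a<..<b} - t ` {..\<nu>}" for s
    proof -
      have "(pl_extension t x has_derivative (\<lambda>h. h *\<^sub>R pl_slope t x s)) (at s)"
        using pl_extension_derivative[OF T, of s x] s ab by (auto simp: has_vector_derivative_def)
      note this[derivative_intros]
      show ?thesis
        unfolding has_vector_derivative_def
        by (rule derivative_eq_intros refl | simp)+ (auto simp: algebra_simps inner_commute)
    qed
  qed (use ab in auto)
  have sq: "pl_slope t x square_integrable_on {a..b}"
    by (rule square_integrable_subinterval[OF pl_slope_square_integrable sub])
  have rhs: "((\<lambda>s. 2 * mesh_size t \<nu> * (norm (pl_slope t x s))\<^sup>2) has_integral
      2 * mesh_size t \<nu> * sq_int a b (pl_slope t x)) {a..b}"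
    by (intro has_integral_mult_right integrable_integral square_integrableD(4)[OF sq])
  have pt: "2 * (pl_slope t x s \<bullet> (pl_extension t x s - y)) \<le> 2 * mesh_size t \<nu> * (norm (pl_slope t x s))\<^sup>2"
    if s: "s \<in> {a..b}" for s
  proof -
    define j where "j = mesh_index t s"
    have j: "j < \<nu>" "t j \<le> s" "s \<le> t (Suc j)"
      unfolding j_def using mesh_index_cell[OF T, of s] s sub by auto
    have c: "pl_slope t x s = (1 / (t (Suc j) - t j)) *\<^sub>R (x (Suc j) - x j)"
      by (simp add: pl_slope_def j_def Let_def)
    \<comment> \<open>The first summand is nonpositive by \<open>vi\<close>; the second measures the
      offset \<open>s - t j\<close> from the left node.\<close>
    have "pl_slope t x s \<bullet> (pl_extension t x s - y)
        = pl_slope t x s \<bullet> (x j - y) + (s - t j) * (norm (pl_slope t x s))\<^sup>2"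
      by (simp add: pl_extension_eq flip: j_def) (simp add: algebra_simps power2_norm_eq_inner)
    also have "\<dots> \<le> 0 + mesh_size t \<nu> * (norm (pl_slope t x s))\<^sup>2"
      using vi[OF j(1)] j s mesh_size_ge[OF j(1)] unfolding c
      by (intro add_mono mult_right_mono) auto
    finally show ?thesis by simp
  qed
  have "?f b - ?f a \<le> 2 * mesh_size t \<nu> * sq_int a b (pl_slope t x)"
    by (rule has_integral_le[OF lhs rhs pt])
  also have "\<dots> \<le> 2 * mesh_size t \<nu> * sq_int 0 T (pl_slope t x)"
  proof (intro mult_left_mono sq_int_subinterval_le[OF pl_slope_square_integrable sub])
    have "0 < \<nu>" using T mesh_ends by (cases \<nu>) auto
    then show "0 \<le> 2 * mesh_size t \<nu>"
      using mesh_size_ge[of 0] mesh_step[of 0] by linarith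
  qed
  finally show ?thesis by (simp add: power2_norm_eq_inner)
qed

end

subsection \<open>Slater points\<close>

definition slater :: "real^'n^'m \<Rightarrow> real^'m \<Rightarrow> bool" where
  "slater u b \<longleftrightarrow> (\<exists>y. \<forall>i. u $ i \<bullet> y < b $ i)"

lemma open_strictly_inside:
  "open {p :: (real^'n^'m) \<times> (real^'m). \<forall>i. fst p $ i \<bullet> y < snd p $ i}"
proof -
  have "open (\<Inter>i. {p :: (real^'n^'m) \<times> (real^'m). fst p $ i \<bullet> y < snd p $ i})"
    by (intro open_INT finite ballI open_Collect_less continuous_intros)
  moreover have "(\<Inter>i. {p :: (real^'n^'m) \<times> (real^'m). fst p $ i \<bullet> y < snd p $ i})
      = {p. \<forall>i. fst p $ i \<bullet> y < snd p $ i}"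
    by auto
  ultimately show ?thesis by simp
qed

text \<open>The pairs that admit a Slater point form an open set, and the curve of controls over
  \<open>{0..T}\<close> is a compact subset of it, so a tube of uniform radius fits in
  between.\<close>

lemma slater_radius:
  fixes u :: "real \<Rightarrow> real^'n^'m"
  assumes "continuous_on {0..T} (\<lambda>t. (u t, b t))" and "\<And>t. t \<in> {0..T} \<Longrightarrow> slater (u t) (b t)"
  obtains \<rho> where "0 < \<rho>"
    "\<And>t u' b'. t \<in> {0..T} \<Longrightarrow> dist (u t, b t) (u', b') \<le> \<rho> \<Longrightarrow> slater u' b'"
proof -
  let ?O = "\<Union>y. {p :: (real^'n^'m) \<times> (real^'m). \<forall>i. fst p $ i \<bullet> y < snd p $ i}"
  have "compact ((\<lambda>t. (u t, b t)) ` {0..T})"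
    by (intro compact_continuous_image assms compact_Icc)
  moreover have "open ?O"
    by (intro open_UN ballI open_strictly_inside)
  moreover have "(\<lambda>t. (u t, b t)) ` {0..T} \<subseteq> ?O"
    using assms(2) by (auto simp: slater_def)
  ultimately obtain \<rho> where \<rho>: "0 < \<rho>" "(\<Union>x\<in>(\<lambda>t. (u t, b t)) ` {0..T}. cball x \<rho>) \<subseteq> ?O"
    by (rule compact_subset_open_imp_cball_epsilon_subset)
  show ?thesis
  proof
    fix t u' b' assume "t \<in> {0..T}" "dist (u t, b t) (u', b') \<le> \<rho>"
    then have "(u', b') \<in> ?O"
      using \<rho>(2) by (meson UN_I image_eqI mem_cball subset_iff)
    then show "slater u' b'" by (auto simp: slater_def)
  qed (rule \<rho>)
qed

text \<open>Moving \<open>y\<close> slightly towards a Slater point makes it strictly feasible, and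
  the inequality is closed as the shift tends to 0. Strictly feasible points are the convenient test
  points because they stay feasible under small changes of the controls.\<close>

lemma variational_inequality_from_strict:
  assumes "slater u b" and y: "y \<in> polyhedron_of u b"
    and strict: "\<And>z. (\<And>i. u $ i \<bullet> z < b $ i) \<Longrightarrow> v \<bullet> (z - x) \<le> 0"
  shows "v \<bullet> (y - x) \<le> 0"
proof -
  obtain y0 where y0: "\<And>i. u $ i \<bullet> y0 < b $ i"
    using assms(1) by (auto simp: slater_def)
  have "v \<bullet> (((1 - s) *\<^sub>R y + s *\<^sub>R y0) - x) \<le> 0" if s: "0 < s" "s < 1" for s
  proof (rule strict)
    fix i
    have "(1 - s) * (u $ i \<bullet> y) \<le> (1 - s) * b $ i"
      using y s by (intro mult_left_mono) (auto simp: polyhedron_of_def)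
    moreover have "s * (u $ i \<bullet> y0) < s * b $ i"
      using y0 s by simp
    ultimately have "(1 - s) * (u $ i \<bullet> y) + s * (u $ i \<bullet> y0) < (1 - s) * b $ i + s * b $ i"
      by linarith
    then show "u $ i \<bullet> ((1 - s) *\<^sub>R y + s *\<^sub>R y0) < b $ i"
      by (simp add: inner_add_right algebra_simps)
  qed
  then have "\<forall>\<^sub>F s in at_right 0. v \<bullet> (((1 - s) *\<^sub>R y + s *\<^sub>R y0) - x) \<le> 0"
    unfolding eventually_at_right_field by (intro exI[of _ 1]) auto
  moreover have "((\<lambda>s. v \<bullet> (((1 - s) *\<^sub>R y + s *\<^sub>R y0) - x)) \<longlongrightarrow> v \<bullet> (((1 - 0) *\<^sub>R y + 0 *\<^sub>R y0) - x)) (at_right 0)"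
    by (intro tendsto_intros)
  ultimately show ?thesis
    using tendsto_upperbound[of "\<lambda>s. v \<bullet> (((1 - s) *\<^sub>R y + s *\<^sub>R y0) - x)" "v \<bullet> (y - x)" "at_right 0" 0]
    by simp
qed

lemma polyhedron_of_limit:
  fixes u :: "nat \<Rightarrow> real^'n^'m"
  assumes "u \<longlonglongrightarrow> u'" "b \<longlonglongrightarrow> b'" "x \<longlonglongrightarrow> x'"
    and "\<forall>\<^sub>F n in sequentially. x n \<in> polyhedron_of (u n) (b n)"
  shows "x' \<in> polyhedron_of u' b'"
  unfolding polyhedron_of_def
proof (intro CollectI allI)
  fix i
  show "u' $ i \<bullet> x' \<le> b' $ i"
  proof (rule tendsto_le[OF sequentially_bot])
    show "(\<lambda>n. u n $ i \<bullet> x n) \<longlonglongrightarrow> u' $ i \<bullet> x'" "(\<lambda>n. b n $ i) \<longlonglongrightarrow> b' $ i"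
      by (intro tendsto_intros assms)+
    show "\<forall>\<^sub>F n in sequentially. u n $ i \<bullet> x n \<le> b n $ i"
      using assms(4) by eventually_elim (simp add: polyhedron_of_def)
  qed
qed

text \<open>Without a Slater point of the limit the graph of the sweeping map need not be closed.\<close>

lemma sweep_map_limit:
  fixes u :: "nat \<Rightarrow> real^'n^'m"
  assumes lim: "u \<longlonglongrightarrow> u'" "b \<longlonglongrightarrow> b'" "x \<longlonglongrightarrow> x'" "v \<longlonglongrightarrow> v'"
    and mem: "\<And>n. v n \<in> sweep_map (u n) (b n) (x n)" and "slater u' b'"
  shows "v' \<in> sweep_map u' b' x'"
proof -
  have nc: "x n \<in> polyhedron_of (u n) (b n)" "\<And>y. y \<in> polyhedron_of (u n) (b n) \<Longrightarrow> v n \<bullet> (y - x n) \<le> 0" for n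
    using mem[of n] by (auto simp: sweep_map_def normal_cone_def split: if_splits)
  have "x' \<in> polyhedron_of u' b'"
    by (rule polyhedron_of_limit[OF lim(1-3)]) (simp add: nc)
  moreover have "v' \<bullet> (y - x') \<le> 0" if "y \<in> polyhedron_of u' b'" for y
  proof (rule variational_inequality_from_strict[OF assms(6) that])
    fix z assume z: "\<And>i. u' $ i \<bullet> z < b' $ i"
    \<comment> \<open>A point strictly feasible for the limit is feasible for all late terms, so
      their inequalities may be tested with it.\<close>
    have "(\<lambda>n. (u n, b n)) \<longlonglongrightarrow> (u', b')"
      by (intro tendsto_intros lim)
    then have "\<forall>\<^sub>F n in sequentially. (u n, b n) \<in> {p. \<forall>i. fst p $ i \<bullet> z < snd p $ i}"
      using z by (intro topological_tendstoD[OF _ open_strictly_inside]) auto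
    then have "\<forall>\<^sub>F n in sequentially. v n \<bullet> (z - x n) \<le> 0"
      by eventually_elim (intro nc(2), auto intro: less_imp_le simp: polyhedron_of_def)
    moreover have "(\<lambda>n. v n \<bullet> (z - x n)) \<longlonglongrightarrow> v' \<bullet> (z - x')"
      by (intro tendsto_intros lim)
    ultimately show "v' \<bullet> (z - x') \<le> 0"
      by (intro tendsto_upperbound[of "\<lambda>n. v n \<bullet> (z - x n)"]) auto
  qed
  ultimately show ?thesis
    by (simp add: sweep_map_def normal_cone_def)
qed

subsection \<open>Existence of discrete minimizers\<close>

text \<open>Otherwise every \<open>x\<close> is beaten by some \<open>g x\<close>, and values near
  \<open>x\<close> still exceed \<open>f (g x)\<close>. Take a finite subcover and let
  \<open>x0\<close> be the index with least \<open>f (g x0)\<close>: the point \<open>g x0\<close>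
  lies in some \<open>U x1\<close>, hence \<open>f (g x1) < f (g x0)\<close>, a
  contradiction.\<close>

lemma lsc_attains_min:
  fixes f :: "'a::topological_space \<Rightarrow> real"
  assumes "compact S" "S \<noteq> {}"
    and lsc: "\<And>x c. x \<in> S \<Longrightarrow> c < f x \<Longrightarrow> \<exists>U. open U \<and> x \<in> U \<and> (\<forall>y\<in>U \<inter> S. c < f y)"
  shows "\<exists>x\<in>S. \<forall>y\<in>S. f x \<le> f y"
proof (rule ccontr)
  assume "\<not> ?thesis"
  then have "\<forall>x\<in>S. \<exists>y\<in>S. f y < f x" by (meson not_le)
  then obtain g where g: "\<And>x. x \<in> S \<Longrightarrow> g x \<in> S" "\<And>x. x \<in> S \<Longrightarrow> f (g x) < f x" by metis
  have "\<forall>x\<in>S. \<exists>U. open U \<and> x \<in> U \<and> (\<forall>y\<in>U \<inter> S. f (g x) < f y)"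
    using lsc g(2) by blast
  then obtain U where U: "\<And>x. x \<in> S \<Longrightarrow> open (U x)" "\<And>x. x \<in> S \<Longrightarrow> x \<in> U x"
    "\<And>x y. x \<in> S \<Longrightarrow> y \<in> U x \<Longrightarrow> y \<in> S \<Longrightarrow> f (g x) < f y"
    by (metis IntI)
  obtain C where C: "C \<subseteq> S" "finite C" "S \<subseteq> (\<Union>x\<in>C. U x)"
    by (rule compactE_image[OF assms(1), of S U]) (use U in auto)
  have "C \<noteq> {}" using C assms(2) by auto
  then obtain x0 where x0: "x0 \<in> C" "\<And>x. x \<in> C \<Longrightarrow> f (g x0) \<le> f (g x)"
    using ex_min_if_finite[of "(\<lambda>x. f (g x)) ` C"] C(2) by (fastforce simp: not_less)
  have "g x0 \<in> S" using g x0 C by auto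
  then obtain x1 where "x1 \<in> C" "g x0 \<in> U x1" using C by auto
  then show False
    using U(3)[of x1 "g x0"] x0(2)[of x1] \<open>g x0 \<in> S\<close> C(1) by force
qed

text \<open>Tychonoff's theorem; discrete triples are kept as sequences over all of
  \<open>nat\<close> with the product topology.\<close>

lemma compact_cball_sequences:
  fixes a :: "nat \<Rightarrow> 'a::euclidean_space"
  shows "compact {z. \<forall>j. z j \<in> cball (a j) R}"
proof -
  have "compactin (product_topology (\<lambda>j. euclidean) UNIV) (PiE UNIV (\<lambda>j. cball (a j) R))"
    unfolding compactin_PiE by simp
  then show ?thesis
    unfolding euclidean_product_topology compactin_euclidean_iff by (simp add: PiE_UNIV_domain Pi_def)
qed

lemma tendsto_coordinate_fun:
  fixes z :: "nat \<Rightarrow> 'a \<Rightarrow> 'b::topological_space"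
  assumes "z \<longlonglongrightarrow> l"
  shows "(\<lambda>n. z n j) \<longlonglongrightarrow> l j"
  using continuous_on_tendsto_compose[OF continuous_on_product_coordinates[of j] assms] by simp

section \<open>Closedness of the discrete constraints\<close>

lemma explicit_step_iff:
  fixes x :: "'a::real_vector"
  assumes "0 < h"
  shows "(\<exists>v\<in>S. x' = x - h *\<^sub>R v) \<longleftrightarrow> - ((1/h) *\<^sub>R (x' - x)) \<in> S"
proof
  assume "\<exists>v\<in>S. x' = x - h *\<^sub>R v"
  then obtain v where "v \<in> S" "x' = x - h *\<^sub>R v" by blast
  then show "- ((1/h) *\<^sub>R (x' - x)) \<in> S" using assms by simp
next
  assume "- ((1/h) *\<^sub>R (x' - x)) \<in> S"
  then show "\<exists>v\<in>S. x' = x - h *\<^sub>R v"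
    by (intro bexI[of _ "- ((1/h) *\<^sub>R (x' - x))"]) (use assms in simp_all)
qed

lemma closed_enlargement:
  fixes \<Omega> :: "'a::euclidean_space set"
  assumes "closed \<Omega>"
  shows "closed {p. \<exists>w\<in>\<Omega>. \<exists>y\<in>cball 0 1. p = w + \<xi> *\<^sub>R y}"
proof -
  have "closed (\<Union>x\<in>\<Omega>. \<Union>y\<in>(\<lambda>y. \<xi> *\<^sub>R y) ` cball 0 1. {x + y})"
    by (intro closed_compact_sums assms compact_scaling compact_cball)
  moreover have "(\<Union>x\<in>\<Omega>. \<Union>y\<in>(\<lambda>y. \<xi> *\<^sub>R y) ` cball 0 1. {x + y})
      = {p. \<exists>w\<in>\<Omega>. \<exists>y\<in>cball 0 1. p = w + \<xi> *\<^sub>R y}"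
    by auto
  ultimately show ?thesis by simp
qed

lemma rate_defect_tendsto:
  fixes zb :: "real \<Rightarrow> 'a::euclidean_space"
  assumes m: "mesh T t \<nu>" and W: "W12 T zb" and z: "\<And>j. (\<lambda>n. z n j) \<longlonglongrightarrow> l j"
  shows "(\<lambda>n. rate_defect T zb t \<nu> (z n)) \<longlonglongrightarrow> rate_defect T zb t \<nu> l"
  unfolding rate_defect_def
proof (rule tendsto_sum)
  fix j assume "j \<in> {..<\<nu>}"
  then have j: "j < \<nu>" by simp
  have sq: "ac_deriv T zb square_integrable_on {t j..t (Suc j)}"
    by (rule square_integrable_subinterval[OF W12D(2)[OF W] mesh_cell[OF m j]])
  show "(\<lambda>n. integral {t j..t (Suc j)} (\<lambda>s. (norm ((1 / (t (Suc j) - t j)) *\<^sub>R (z n (Suc j) - z n j) - ac_deriv T zb s))\<^sup>2))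
    \<longlonglongrightarrow> integral {t j..t (Suc j)} (\<lambda>s. (norm ((1 / (t (Suc j) - t j)) *\<^sub>R (l (Suc j) - l j) - ac_deriv T zb s))\<^sup>2)"
    unfolding integral_sq_norm_const_diff[OF sq less_imp_le[OF mesh_step[OF m j]]]
    by (intro tendsto_intros z)
qed

lemma value_defect_tendsto:
  fixes zb :: "real \<Rightarrow> 'a::euclidean_space"
  assumes m: "mesh T t \<nu>" and c: "continuous_on {0..T} zb" and z: "\<And>j. (\<lambda>n. z n j) \<longlonglongrightarrow> l j"
  shows "(\<lambda>n. value_defect zb t \<nu> (z n)) \<longlonglongrightarrow> value_defect zb t \<nu> l"
  unfolding value_defect_def
proof (rule tendsto_sum)
  fix j assume "j \<in> {..<\<nu>}"
  then have j: "j < \<nu>" by simp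
  have sq: "zb square_integrable_on {t j..t (Suc j)}"
    by (rule square_integrable_subinterval[OF square_integrable_continuous[OF c] mesh_cell[OF m j]])
  show "(\<lambda>n. integral {t j..t (Suc j)} (\<lambda>s. (norm (z n j - zb s))\<^sup>2))
    \<longlonglongrightarrow> integral {t j..t (Suc j)} (\<lambda>s. (norm (l j - zb s))\<^sup>2)"
    unfolding integral_sq_norm_const_diff[OF sq less_imp_le[OF mesh_step[OF m j]]]
    by (intro tendsto_intros z)
qed

lemma rate_defect_cong:
  assumes "\<And>j. j \<le> \<nu> \<Longrightarrow> z j = w j"
  shows "rate_defect T zb t \<nu> z = rate_defect T zb t \<nu> w"
  unfolding rate_defect_def using assms by (intro sum.cong) auto

lemma value_defect_cong:
  assumes "\<And>j. j \<le> \<nu> \<Longrightarrow> z j = w j"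
  shows "value_defect zb t \<nu> z = value_defect zb t \<nu> w"
  unfolding value_defect_def using assms by (intro sum.cong) auto

text \<open>Only the nodes up to \<open>\<nu>\<close> count, so later entries may be set to 0; with
  this truncation the competitors form a compact set of sequences.\<close>

lemma discrete_cong:
  assumes "\<And>j. j \<le> \<nu> \<Longrightarrow> U j = U' j" "\<And>j. j \<le> \<nu> \<Longrightarrow> B j = B' j" "\<And>j. j \<le> \<nu> \<Longrightarrow> X j = X' j"
  shows "discrete_feasible T x0 \<Omega> ub bb xb \<epsilon> \<delta> \<xi> t \<nu> U B X
      \<longleftrightarrow> discrete_feasible T x0 \<Omega> ub bb xb \<epsilon> \<delta> \<xi> t \<nu> U' B' X'"
    and "discrete_cost T \<phi> ub bb xb t \<nu> U B X = discrete_cost T \<phi> ub bb xb t \<nu> U' B' X'"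
proof -
  have z: "(U j, B j, X j) = (U' j, B' j, X' j)" if "j \<le> \<nu>" for j
    using assms that by simp
  have r: "rate_defect T zb t \<nu> (\<lambda>j. (U j, B j, X j)) = rate_defect T zb t \<nu> (\<lambda>j. (U' j, B' j, X' j))" for zb
    by (rule rate_defect_cong[OF z])
  have v: "value_defect zb t \<nu> (\<lambda>j. (U j, B j, X j)) = value_defect zb t \<nu> (\<lambda>j. (U' j, B' j, X' j))" for zb
    by (rule value_defect_cong[OF z])
  show "discrete_feasible T x0 \<Omega> ub bb xb \<epsilon> \<delta> \<xi> t \<nu> U B X
      \<longleftrightarrow> discrete_feasible T x0 \<Omega> ub bb xb \<epsilon> \<delta> \<xi> t \<nu> U' B' X'"
    unfolding discrete_feasible_def r v using assms by simp
  show "discrete_cost T \<phi> ub bb xb t \<nu> U B X = discrete_cost T \<phi> ub bb xb t \<nu> U' B' X'"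
    unfolding discrete_cost_def r using assms by simp
qed

lemma norm_triple_le:
  fixes z :: "'a::real_normed_vector \<times> 'b::real_normed_vector \<times> 'c::real_normed_vector"
  shows "norm (fst z, fst (snd z)) \<le> norm z" "norm (snd (snd z)) \<le> norm z"
    "norm (fst z) \<le> norm z" "norm (fst (snd z)) \<le> norm z"
  by (cases z; auto simp: norm_Pair real_le_rsqrt intro: real_le_rsqrt)+

text \<open>Nodal values are values of the piecewise linear extension, to which the uniform
  deviation estimate and the rate constraint apply.\<close>

lemma discrete_feasible_node:
  assumes "0 < T" "mesh T t \<nu>" "W12 T (\<lambda>s. (ub s, bb s, xb s))" "xb 0 = x0" "j \<le> \<nu>"
    and "discrete_feasible T x0 \<Omega> ub bb xb \<epsilon> \<delta> \<xi> t \<nu> U B X"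
  shows "(norm ((U j, B j, X j) - (ub (t j), bb (t j), xb (t j))))\<^sup>2 \<le> T * (\<epsilon> / 2)"
proof -
  let ?z = "\<lambda>j. (U j, B j, X j)"
  have z0: "?z 0 = (ub 0, bb 0, xb 0)" and rd: "rate_defect T (\<lambda>s. (ub s, bb s, xb s)) t \<nu> ?z \<le> \<epsilon> / 2"
    using assms(4,6) by (auto simp: discrete_feasible_def)
  have "(norm (pl_extension t ?z (t j) - (ub (t j), bb (t j), xb (t j))))\<^sup>2
      \<le> T * rate_defect T (\<lambda>s. (ub s, bb s, xb s)) t \<nu> ?z"
    by (rule pl_extension_deviation(3)[OF assms(2,1,3)]) (use z0 mesh_node[OF assms(2,5)] in auto)
  also have "\<dots> \<le> T * (\<epsilon> / 2)" using rd assms(1) by simp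
  finally show ?thesis
    by (simp only: pl_extension_node[OF assms(2,1,5)])
qed

text \<open>The sweeping inclusion is the delicate constraint. It is imposed at the nodes before the
  last one, and those are the nodes where the limit controls are required to have Slater
  points.\<close>

lemma discrete_feasible_closed:
  fixes U :: "nat \<Rightarrow> nat \<Rightarrow> real^'n^'m"
  assumes m: "mesh T t \<nu>" and W: "W12 T (\<lambda>s. (ub s, bb s, xb s))" and "closed \<Omega>"
    and lim: "\<And>j. (\<lambda>n. U n j) \<longlonglongrightarrow> U' j" "\<And>j. (\<lambda>n. B n j) \<longlonglongrightarrow> B' j" "\<And>j. (\<lambda>n. X n j) \<longlonglongrightarrow> X' j"
    and feas: "\<And>n. discrete_feasible T x0 \<Omega> ub bb xb \<epsilon> \<delta> \<xi> t \<nu> (U n) (B n) (X n)"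
    and slater: "\<And>j. j < \<nu> \<Longrightarrow> slater (U' j) (B' j)"
  shows "discrete_feasible T x0 \<Omega> ub bb xb \<epsilon> \<delta> \<xi> t \<nu> U' B' X'"
  unfolding discrete_feasible_def
proof (intro conjI allI impI)
  note f = feas[unfolded discrete_feasible_def]
  show "\<exists>v\<in>sweep_map (U' j) (B' j) (X' j). X' (Suc j) = X' j - (t (Suc j) - t j) *\<^sub>R v" if j: "j < \<nu>" for j
  proof -
    have h: "0 < t (Suc j) - t j" using mesh_step[OF m j] by simp
    show ?thesis
      unfolding explicit_step_iff[OF h]
    proof (rule sweep_map_limit[OF lim])
      show "(\<lambda>n. - ((1 / (t (Suc j) - t j)) *\<^sub>R (X n (Suc j) - X n j)))
          \<longlonglongrightarrow> - ((1 / (t (Suc j) - t j)) *\<^sub>R (X' (Suc j) - X' j))"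
        by (intro tendsto_intros lim)
      show "- ((1 / (t (Suc j) - t j)) *\<^sub>R (X n (Suc j) - X n j)) \<in> sweep_map (U n j) (B n j) (X n j)" for n
        using f[of n] j explicit_step_iff[OF h] by blast
    qed (rule slater[OF j])
  qed
  show "X' 0 = x0" "U' 0 = ub 0" "B' 0 = bb 0"
    using lim[of 0] f by (auto intro: LIMSEQ_unique simp: tendsto_const_iff)
  show "x0 \<in> polyhedron_of (ub 0) (bb 0)" using f by blast
  have "X' \<nu> \<in> {p. \<exists>w\<in>\<Omega>. \<exists>y\<in>cball 0 1. p = w + \<xi> *\<^sub>R y}"
    by (rule Lim_in_closed_set[OF closed_enlargement[OF assms(3)] _ sequentially_bot lim(3)])
      (use f in simp)
  then show "\<exists>w\<in>\<Omega>. \<exists>y\<in>cball 0 1. X' \<nu> = w + \<xi> *\<^sub>R y" by simp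
  fix j i assume j: "j \<le> \<nu>"
  have n: "(\<lambda>n. norm (U n j $ i)) \<longlonglongrightarrow> norm (U' j $ i)"
    by (intro tendsto_intros lim)
  show "1 - \<delta> \<le> norm (U' j $ i)"
    by (rule LIMSEQ_le_const[OF n]) (use f j in blast)
  show "norm (U' j $ i) \<le> 1 + \<delta>"
    by (rule LIMSEQ_le_const2[OF n]) (use f j in blast)
next
  note f = feas[unfolded discrete_feasible_def]
  have zlim: "(\<lambda>n. (U n j, B n j, X n j)) \<longlonglongrightarrow> (U' j, B' j, X' j)" for j
    by (intro tendsto_intros lim)
  show "value_defect (\<lambda>s. (ub s, bb s, xb s)) t \<nu> (\<lambda>j. (U' j, B' j, X' j)) \<le> \<epsilon> / 2"
    by (rule LIMSEQ_le_const2[OF value_defect_tendsto[OF m has_ac_deriv_continuous[OF W12D(1)[OF W]] zlim]])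
      (use f in blast)
  show "rate_defect T (\<lambda>s. (ub s, bb s, xb s)) t \<nu> (\<lambda>j. (U' j, B' j, X' j)) \<le> \<epsilon> / 2"
    by (rule LIMSEQ_le_const2[OF rate_defect_tendsto[OF m W zlim]]) (use f in blast)
qed

text \<open>One radius \<open>\<rho>\<close> serves two purposes: within it the controls keep Slater
  points and \<open>\<phi>\<close> is lower semicontinuous. The bound on \<open>\<epsilon>\<close>
  confines all nodes of feasible triples to this range.\<close>

lemma discrete_optimal_exists:
  fixes ub :: "real \<Rightarrow> real^'n^'m"
  assumes T: "0 < T" and m: "mesh T t \<nu>" and W: "W12 T (\<lambda>s. (ub s, bb s, xb s))" and "closed \<Omega>"
    and x0: "xb 0 = x0"
    and \<rho>: "\<And>s u' b'. s \<in> {0..T} \<Longrightarrow> dist (ub s, bb s) (u', b') \<le> \<rho> \<Longrightarrow> slater u' b'"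
    and lsc: "\<And>y. dist y (xb T) \<le> \<rho> \<Longrightarrow> lsc_at \<phi> y"
    and \<epsilon>: "T * (\<epsilon> / 2) \<le> \<rho>\<^sup>2" "0 \<le> \<rho>"
    and ex: "discrete_feasible T x0 \<Omega> ub bb xb \<epsilon> \<delta> \<xi> t \<nu> U0 B0 X0"
  shows "\<exists>U B X. discrete_optimal T x0 \<Omega> \<phi> ub bb xb \<epsilon> \<delta> \<xi> t \<nu> U B X"
proof -
  let ?zb = "\<lambda>s. (ub s, bb s, xb s)"
  let ?U = "\<lambda>z j. fst (z j)" and ?B = "\<lambda>z j. fst (snd (z j))" and ?X = "\<lambda>z j. snd (snd (z j))"
  define feas where "feas U B X \<longleftrightarrow> discrete_feasible T x0 \<Omega> ub bb xb \<epsilon> \<delta> \<xi> t \<nu> U B X"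
    for U :: "nat \<Rightarrow> real^'n^'m" and B X
  define cost where "cost U B X = discrete_cost T \<phi> ub bb xb t \<nu> U B X" for U :: "nat \<Rightarrow> real^'n^'m" and B X
  \<comment> \<open>The zeros beyond \<open>\<nu>\<close> bound every coordinate, so that
    \<open>K\<close> sits in a product of balls.\<close>
  define K where "K = {z :: nat \<Rightarrow> (real^'n^'m) \<times> (real^'m) \<times> (real^'n).
      feas (?U z) (?B z) (?X z) \<and> (\<forall>j>\<nu>. z j = 0)}"
  have node: "norm ((U j, B j, X j) - ?zb (t j)) \<le> \<rho>" if "feas U B X" "j \<le> \<nu>" for U B X j
    using discrete_feasible_node[OF T m W x0 that(2)] that(1) \<epsilon> unfolding feas_def
    by (meson order_trans power2_le_imp_le)
  have near: "dist (ub (t j), bb (t j)) (U j, B j) \<le> \<rho>" "dist (X j) (xb (t j)) \<le> \<rho>"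
    if "norm ((U j, B j, X j) - ?zb (t j)) \<le> \<rho>" for U B X j
    using order_trans[OF norm_triple_le(1) that] order_trans[OF norm_triple_le(2) that]
    unfolding dist_norm norm_minus_commute[of "(ub (t j), bb (t j))"] by simp_all
  have trunc: "feas (\<lambda>j. if j \<le> \<nu> then U j else 0) (\<lambda>j. if j \<le> \<nu> then B j else 0) (\<lambda>j. if j \<le> \<nu> then X j else 0)
        \<longleftrightarrow> feas U B X"
    "cost (\<lambda>j. if j \<le> \<nu> then U j else 0) (\<lambda>j. if j \<le> \<nu> then B j else 0) (\<lambda>j. if j \<le> \<nu> then X j else 0)
        = cost U B X" for U B X
    unfolding feas_def cost_def by (intro discrete_cong; simp)+
  define tr where "tr U B X = (\<lambda>j. if j \<le> \<nu> then (U j, B j, X j) else 0)"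
    for U :: "nat \<Rightarrow> real^'n^'m" and B :: "nat \<Rightarrow> real^'m" and X :: "nat \<Rightarrow> real^'n"
  have trK: "tr U B X \<in> K" "cost (?U (tr U B X)) (?B (tr U B X)) (?X (tr U B X)) = cost U B X" if "feas U B X" for U B X
  proof -
    have eq: "?U (tr U B X) = (\<lambda>j. if j \<le> \<nu> then U j else 0)" "?B (tr U B X) = (\<lambda>j. if j \<le> \<nu> then B j else 0)"
      "?X (tr U B X) = (\<lambda>j. if j \<le> \<nu> then X j else 0)"
      by (auto simp: tr_def)
    show "tr U B X \<in> K"
      unfolding K_def mem_Collect_eq eq trunc using that by (simp add: tr_def)
    show "cost (?U (tr U B X)) (?B (tr U B X)) (?X (tr U B X)) = cost U B X"
      unfolding eq trunc ..
  qed
  have closedK: "closed K"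
    unfolding closed_sequential_limits
  proof (intro allI impI, elim conjE)
    fix z l assume zK: "\<forall>n. z n \<in> K" and zl: "z \<longlonglongrightarrow> l"
    have co: "(\<lambda>n. z n j) \<longlonglongrightarrow> l j" for j
      by (rule tendsto_coordinate_fun[OF zl])
    have feasz: "feas (?U (z n)) (?B (z n)) (?X (z n))" for n
      using zK by (simp add: K_def)
    have "norm (l j - ?zb (t j)) \<le> \<rho>" if "j \<le> \<nu>" for j
    proof (rule LIMSEQ_le_const2)
      show "(\<lambda>n. norm (z n j - ?zb (t j))) \<longlonglongrightarrow> norm (l j - ?zb (t j))"
        by (intro tendsto_intros co)
      show "\<exists>N. \<forall>n\<ge>N. norm (z n j - ?zb (t j)) \<le> \<rho>"
        using node[OF feasz that] by simp
    qed
    then have "slater (?U l j) (?B l j)" if "j < \<nu>" for j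
      using \<rho>[OF mesh_node[OF m, of j] near(1)[of "?U l" j "?B l" "?X l"]] that by simp
    then have "feas (?U l) (?B l) (?X l)"
      unfolding feas_def
      by (intro discrete_feasible_closed[OF m W assms(4) _ _ _ feasz[unfolded feas_def]])
        (auto intro!: tendsto_intros co)
    moreover have "l j = 0" if "j > \<nu>" for j
    proof (rule LIMSEQ_unique[OF co])
      have "z n j = 0" for n using zK that by (simp add: K_def)
      then show "(\<lambda>n. z n j) \<longlonglongrightarrow> 0" by simp
    qed
    ultimately show "l \<in> K" by (simp add: K_def)
  qed
  define a where "a j = (if j \<le> \<nu> then ?zb (t j) else 0)" for j
  have "K \<subseteq> {z. \<forall>j. z j \<in> cball (a j) \<rho>}"
  proof (intro subsetI CollectI allI)
    fix z j assume "z \<in> K"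
    then show "z j \<in> cball (a j) \<rho>"
      using node[of "?U z" "?B z" "?X z" j] \<epsilon>(2)
      by (cases "j \<le> \<nu>") (auto simp: K_def a_def dist_norm norm_minus_commute)
  qed
  then have "compact K"
    using compact_cball_sequences[of a \<rho>] closedK compact_Int_closed[of "{z. \<forall>j. z j \<in> cball (a j) \<rho>}" K]
    by (simp add: Int_absorb1)
  moreover have "K \<noteq> {}"
    using trK(1)[of U0 B0 X0] ex by (auto simp: feas_def)
  moreover have "\<exists>V. open V \<and> z \<in> V \<and> (\<forall>w\<in>V \<inter> K. c < cost (?U w) (?B w) (?X w))"
    if z: "z \<in> K" and c: "c < cost (?U z) (?B z) (?X z)" for z c
  proof -
    let ?r = "\<lambda>z. rate_defect T ?zb t \<nu> z"
    \<comment> \<open>The gap \<open>2 * d\<close> is split evenly: \<open>\<phi>\<close> may drop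
      by \<open>d\<close>, and the rate defect, which enters the cost with factor 1/2, by
      \<open>2 * d\<close>.\<close>
    define d where "d = (cost (?U z) (?B z) (?X z) - c) / 2"
    have d: "0 < d" using c by (simp add: d_def)
    have cost_eq: "cost (?U w) (?B w) (?X w) = \<phi> (?X w \<nu>) + ?r w / 2" for w
      by (simp add: cost_def discrete_cost_def)
    have "dist (?X z \<nu>) (xb T) \<le> \<rho>"
      using near(2)[of "?U z" \<nu> "?B z" "?X z", OF node[of "?U z" "?B z" "?X z" \<nu>]] z mesh_ends(2)[OF m] by (simp add: K_def)
    from lsc[OF this] have "\<forall>\<^sub>F y in nhds (?X z \<nu>). \<phi> (?X z \<nu>) - d < \<phi> y"
      using d by (simp add: lsc_at_def)
    then obtain V where V: "open V" "?X z \<nu> \<in> V" "\<And>y. y \<in> V \<Longrightarrow> \<phi> (?X z \<nu>) - d < \<phi> y"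
      unfolding eventually_nhds by blast
    have coord: "continuous_on UNIV (\<lambda>w :: nat \<Rightarrow> (real^'n^'m) \<times> (real^'m) \<times> (real^'n). snd (snd (w \<nu>)))"
      by (intro continuous_intros continuous_on_product_coordinates)
    have "continuous_on UNIV ?r"
      unfolding continuous_on_sequentially o_def
      by (intro allI ballI impI rate_defect_tendsto[OF m W]) (elim conjE tendsto_coordinate_fun)
    then have "open {w. ?r z - 2 * d < ?r w}"
      by (intro open_Collect_less continuous_intros)
    moreover have "open {w :: nat \<Rightarrow> (real^'n^'m) \<times> (real^'m) \<times> (real^'n). ?X w \<nu> \<in> V}"
      using open_vimage[OF V(1) coord] by (simp add: vimage_def)
    ultimately have "open ({w. ?r z - 2 * d < ?r w} \<inter> {w. ?X w \<nu> \<in> V})"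
      by (rule open_Int)
    moreover have "c < cost (?U w) (?B w) (?X w)" if "?r z - 2 * d < ?r w" "?X w \<nu> \<in> V" for w
    proof -
      have "c = cost (?U z) (?B z) (?X z) - 2 * d" unfolding d_def by argo
      then show ?thesis
        using V(3)[OF that(2)] that(1) unfolding cost_eq by linarith
    qed
    ultimately show ?thesis
      using V(2) d by (intro exI[of _ "{w. ?r z - 2 * d < ?r w} \<inter> {w. ?X w \<nu> \<in> V}"]) auto
  qed
  ultimately have "\<exists>z\<in>K. \<forall>w\<in>K. cost (?U z) (?B z) (?X z) \<le> cost (?U w) (?B w) (?X w)"
    by (rule lsc_attains_min)
  then obtain z where z: "z \<in> K" "\<And>w. w \<in> K \<Longrightarrow> cost (?U z) (?B z) (?X z) \<le> cost (?U w) (?B w) (?X w)"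
    by blast
  have "cost (?U z) (?B z) (?X z) \<le> cost U B X" if "feas U B X" for U B X
    using z(2)[OF trK(1)[OF that]] trK(2)[OF that] by simp
  then have "discrete_optimal T x0 \<Omega> \<phi> ub bb xb \<epsilon> \<delta> \<xi> t \<nu> (?U z) (?B z) (?X z)"
    using z(1) by (simp add: discrete_optimal_def K_def feas_def cost_def)
  then show ?thesis by blast
qed

section \<open>Modified functions, linear images and the derivative part of the norm\<close>

lemma has_ac_deriv_cong:
  assumes "has_ac_deriv T f g" "\<And>s. s \<in> {0..T} \<Longrightarrow> f' s = f s" "0 \<le> T"
  shows "has_ac_deriv T f' g"
  unfolding has_ac_deriv_def
proof (intro conjI ballI)
  show "g absolutely_integrable_on {0..T}" by (rule has_ac_derivD(1)[OF assms(1)])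
  fix s assume s: "s \<in> {0..T}"
  show "f' s = f' 0 + integral {0..s} g"
    using has_ac_derivD(3)[OF assms(1) s] assms(2)[OF s] assms(2)[of 0] assms(3) by simp
qed

text \<open>Meant for the projections of a triple to its controls and to its state, so that bounds
  on the triple carry over unchanged.\<close>

lemma square_integrable_contraction:
  fixes l :: "'a::euclidean_space \<Rightarrow> 'b::euclidean_space"
  assumes "g square_integrable_on {a..b}" "bounded_linear l" and le: "\<And>x. norm (l x) \<le> norm x"
  shows "(\<lambda>s. l (g s)) square_integrable_on {a..b}" "sq_int a b (\<lambda>s. l (g s)) \<le> sq_int a b g"
proof -
  have sq: "(norm (l x))\<^sup>2 \<le> (norm x)\<^sup>2" for x
    by (rule power_mono[OF le]) simp
  have "(\<lambda>s. l (g s)) absolutely_integrable_on {a..b}"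
    using absolutely_integrable_linear[OF square_integrableD(1)[OF assms(1)] assms(2)] by (simp add: o_def)
  then have "(\<lambda>s. l (g s)) \<in> borel_measurable (lebesgue_on {a..b})"
    by (rule absolutely_integrable_imp_borel_measurable) simp
  then show 1: "(\<lambda>s. l (g s)) square_integrable_on {a..b}"
    by (rule square_integrable_bound[OF _ square_integrableD(4)[OF assms(1)] sq])
  show "sq_int a b (\<lambda>s. l (g s)) \<le> sq_int a b g"
    by (rule integral_le[OF square_integrableD(4)[OF 1] square_integrableD(4)[OF assms(1)] sq])
qed

lemma sq_int_ac_deriv_le_W12_norm: "sq_int 0 T (ac_deriv T f) \<le> (W12_norm T f)\<^sup>2"
  unfolding W12_norm_def using sq_int_nonneg[of "{0..T}" f] sq_int_nonneg[of "{0..T}" "ac_deriv T f"]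
  by simp

subsection \<open>Approximating data\<close>

lemma value_defect_le:
  fixes zb :: "real \<Rightarrow> 'a::euclidean_space"
  assumes m: "mesh T t \<nu>" and c: "continuous_on {0..T} zb"
    and e: "\<And>j s. j < \<nu> \<Longrightarrow> s \<in> {t j..t (Suc j)} \<Longrightarrow> norm (z j - zb s) \<le> e"
  shows "value_defect zb t \<nu> z \<le> T * e\<^sup>2"
proof -
  have "value_defect zb t \<nu> z \<le> (\<Sum>j<\<nu>. (t (Suc j) - t j) * e\<^sup>2)"
    unfolding value_defect_def
  proof (rule sum_mono)
    fix j assume "j \<in> {..<\<nu>}"
    then have j: "j < \<nu>" by simp
    have "(\<lambda>s. z j - zb s) square_integrable_on {t j..t (Suc j)}"
      by (intro square_integrable_continuous continuous_intros continuous_on_subset[OF c mesh_cell[OF m j]])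
    note int = integrable_integral[OF square_integrableD(4)[OF this]]
    have const: "((\<lambda>s. e\<^sup>2) has_integral (t (Suc j) - t j) * e\<^sup>2) {t j..t (Suc j)}"
      using has_integral_const_real[of "e\<^sup>2" "t j" "t (Suc j)"] mesh_step[OF m j] by simp
    show "integral {t j..t (Suc j)} (\<lambda>s. (norm (z j - zb s))\<^sup>2) \<le> (t (Suc j) - t j) * e\<^sup>2"
      by (rule has_integral_le[OF int const]) (intro power_mono e j norm_ge_zero)
  qed
  also have "\<dots> = T * e\<^sup>2"
    using mesh_ends[OF m] by (simp add: sum_lessThan_telescope flip: sum_distrib_right)
  finally show ?thesis .
qed

text \<open>The rate defect is the derivative part of the Sobolev distance. Its decay gives uniform
  convergence, and this with uniform continuity of \<open>zb\<close> handles the value defect, which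
  compares a left node with all times of its cell.\<close>

lemma approximating_data_limits:
  fixes ub :: "real \<Rightarrow> real^'n^'m"
  assumes T: "0 < T" and ad: "approximating_data T x0 ub bb xb t \<nu> \<delta> ut bt xt"
    and xb0: "xb 0 = x0"
  defines "zb \<equiv> \<lambda>s. (ub s, bb s, xb s)"
    and "Z \<equiv> \<lambda>k j. (ut k (t k j), bt k (t k j), xt k (t k j))"
  shows "(\<lambda>k. rate_defect T zb (t k) (\<nu> k) (Z k)) \<longlonglongrightarrow> 0"
    and "(\<lambda>k. value_defect zb (t k) (\<nu> k) (Z k)) \<longlonglongrightarrow> 0"
    and "(\<lambda>k. xt k T) \<longlonglongrightarrow> xb T"
proof -
  let ?f = "\<lambda>k s. (ut k s, bt k s, xt k s)"
  note ad' = ad[unfolded approximating_data_def]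
  have m: "mesh T (t k) (\<nu> k)" for k using ad' by blast
  have msize: "(\<lambda>k. mesh_size (t k) (\<nu> k)) \<longlonglongrightarrow> 0" using ad' by blast
  have pl: "ut k s = pl_extension (t k) (\<lambda>j. ut k (t k j)) s" "bt k s = pl_extension (t k) (\<lambda>j. bt k (t k j)) s"
    "xt k s = pl_extension (t k) (\<lambda>j. xt k (t k j)) s" if "s \<in> {0..T}" for k s
    using ad' that unfolding piecewise_linear_def by blast+
  have init: "?f k 0 = zb 0" for k
    using ad' xb0 by (simp add: zb_def)
  have W: "W12 T zb" and conv: "(\<lambda>k. W12_norm T (\<lambda>s. ?f k s - zb s)) \<longlonglongrightarrow> 0"
    using ad' unfolding converges_W12_def zb_def by blast+
  have f_pl: "?f k s = pl_extension (t k) (Z k) s" if "s \<in> {0..T}" for k s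
    unfolding pl[OF that] by (simp add: Z_def pl_extension_def Let_def)
  have init': "Z k 0 = zb 0" for k
    using init[of k] mesh_ends(1)[OF m[of k]] by (simp add: Z_def)
  note dev = pl_extension_deviation[where t = "t k" and \<nu> = "\<nu> k" and v = "Z k" and zb = zb for k, OF m T W init']
  show rate: "(\<lambda>k. rate_defect T zb (t k) (\<nu> k) (Z k)) \<longlonglongrightarrow> 0"
  proof (rule tendsto_sandwich[where f = "\<lambda>_. 0"])
    show "(\<lambda>k. (W12_norm T (\<lambda>s. ?f k s - zb s))\<^sup>2) \<longlonglongrightarrow> 0"
      using tendsto_power[OF conv, of 2] by simp
    have "rate_defect T zb (t k) (\<nu> k) (Z k) \<le> (W12_norm T (\<lambda>s. ?f k s - zb s))\<^sup>2" for k
    proof -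
      have "has_ac_deriv T (\<lambda>s. ?f k s - zb s) (\<lambda>s. pl_slope (t k) (Z k) s - ac_deriv T zb s)"
        by (rule has_ac_deriv_cong[OF dev(1)]) (use f_pl T in auto)
      from sq_int_ac_deriv[OF this dev(2)] show ?thesis
        using sq_int_ac_deriv_le_W12_norm[of T "\<lambda>s. ?f k s - zb s"] by (simp add: rate_defect_eq[OF m W])
    qed
    then show "\<forall>\<^sub>F k in sequentially. rate_defect T zb (t k) (\<nu> k) (Z k) \<le> (W12_norm T (\<lambda>s. ?f k s - zb s))\<^sup>2"
      by simp
    show "\<forall>\<^sub>F k in sequentially. 0 \<le> rate_defect T zb (t k) (\<nu> k) (Z k)"
      by (simp add: rate_defect_eq[OF m W] sq_int_nonneg)
  qed simp
  have close: "\<forall>\<^sub>F k in sequentially. \<forall>s\<in>{0..T}. norm (?f k s - zb s) < e" if "0 < e" for e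
  proof -
    have "(\<lambda>k. T * rate_defect T zb (t k) (\<nu> k) (Z k)) \<longlonglongrightarrow> T * 0"
      by (intro tendsto_intros rate)
    then have "\<forall>\<^sub>F k in sequentially. T * rate_defect T zb (t k) (\<nu> k) (Z k) < e\<^sup>2"
      using that by (intro order_tendstoD) auto
    then show ?thesis
    proof eventually_elim
      case (elim k)
      show ?case
      proof
        fix s assume s: "s \<in> {0..T}"
        have "(norm (?f k s - zb s))\<^sup>2 < e\<^sup>2"
          unfolding f_pl[OF s] using dev(3)[OF s, of k] elim by linarith
        then show "norm (?f k s - zb s) < e"
          using that by (simp add: power2_less_imp_less)
      qed
    qed
  qed
  show "(\<lambda>k. xt k T) \<longlonglongrightarrow> xb T"
  proof (rule tendstoI)
    fix e :: real assume "0 < e"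
    from close[OF this] show "\<forall>\<^sub>F k in sequentially. dist (xt k T) (xb T) < e"
    proof eventually_elim
      case (elim k)
      then have "norm (?f k T - zb T) < e" using T by auto
      then show ?case
        using norm_triple_le(2)[of "?f k T - zb T"] by (simp add: zb_def dist_norm)
    qed
  qed
  have cont: "continuous_on {0..T} zb" by (rule has_ac_deriv_continuous[OF W12D(1)[OF W]])
  have val: "\<forall>\<^sub>F k in sequentially. value_defect zb (t k) (\<nu> k) (Z k) \<le> T * e\<^sup>2" if e: "0 < e" for e
  proof -
    \<comment> \<open>Half of \<open>e\<close> covers the oscillation of \<open>zb\<close> over one
      cell, the other half the distance of the data from \<open>zb\<close>.\<close>
    obtain d where d: "0 < d" "\<And>s r. s \<in> {0..T} \<Longrightarrow> r \<in> {0..T} \<Longrightarrow> dist r s < d \<Longrightarrow> dist (zb r) (zb s) < e/2"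
      using compact_uniformly_continuous[OF cont compact_Icc] e
      unfolding uniformly_continuous_on_def by (metis half_gt_zero)
    have "\<forall>\<^sub>F k in sequentially. mesh_size (t k) (\<nu> k) < d"
      by (rule order_tendstoD(2)[OF msize d(1)])
    moreover have "\<forall>\<^sub>F k in sequentially. \<forall>s\<in>{0..T}. norm (?f k s - zb s) < e/2"
      using e by (intro close) simp
    ultimately show ?thesis
    proof eventually_elim
      case (elim k)
      show ?case
      proof (rule value_defect_le[OF m cont])
        fix j s assume j: "j < \<nu> k" and s: "s \<in> {t k j..t k (Suc j)}"
        have tj: "t k j \<in> {0..T}" "s \<in> {0..T}"
          using mesh_node[OF m, of j k] mesh_cell[OF m j] j s by auto
        have "dist (t k j) s < d"
          using mesh_size_ge[OF m j] elim(1) s by (simp add: dist_real_def)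
        from d(2)[OF tj(2,1) this] have "norm (zb (t k j) - zb s) < e/2" by (simp add: dist_norm)
        moreover have "norm (Z k j - zb (t k j)) < e/2"
          using elim(2) tj(1) by (auto simp: Z_def)
        ultimately show "norm (Z k j - zb s) \<le> e"
          using norm_triangle_ineq[of "Z k j - zb (t k j)" "zb (t k j) - zb s"] by simp
      qed
    qed
  qed
  show "(\<lambda>k. value_defect zb (t k) (\<nu> k) (Z k)) \<longlonglongrightarrow> 0"
  proof (rule tendstoI)
    fix e :: real assume e: "0 < e"
    have "\<forall>\<^sub>F k in sequentially. value_defect zb (t k) (\<nu> k) (Z k) \<le> T * (sqrt (e / (2 * T)))\<^sup>2"
      using e T by (intro val) simp
    then show "\<forall>\<^sub>F k in sequentially. dist (value_defect zb (t k) (\<nu> k) (Z k)) 0 < e"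
    proof eventually_elim
      case (elim k)
      have "0 \<le> value_defect zb (t k) (\<nu> k) (Z k)"
        unfolding value_defect_def by (intro sum_nonneg sq_int_nonneg)
      moreover have "T * (sqrt (e / (2 * T)))\<^sup>2 = e / 2"
        using e T by simp
      ultimately show ?case
        using elim e by simp
    qed
  qed
qed

lemma approximating_data_feasible:
  fixes ub :: "real \<Rightarrow> real^'n^'m"
  assumes T: "0 < T" and ad: "approximating_data T x0 ub bb xb t \<nu> \<delta> ut bt xt"
    and x0: "xb 0 = x0" "x0 \<in> polyhedron_of (ub 0) (bb 0)" "xb T \<in> \<Omega>" and \<epsilon>: "0 < \<epsilon>"
  shows "\<forall>\<^sub>F k in sequentially. discrete_feasible T x0 \<Omega> ub bb xb \<epsilon> (\<delta> k) (norm (xt k T - xb T)) (t k) (\<nu> k)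
    (\<lambda>j. ut k (t k j)) (\<lambda>j. bt k (t k j)) (\<lambda>j. xt k (t k j))"
proof -
  note ad' = ad[unfolded approximating_data_def]
  have m: "mesh T (t k) (\<nu> k)" for k using ad' by blast
  note lims = approximating_data_limits[OF T ad x0(1)]
  have "\<forall>\<^sub>F k in sequentially. rate_defect T (\<lambda>s. (ub s, bb s, xb s)) (t k) (\<nu> k)
      (\<lambda>j. (ut k (t k j), bt k (t k j), xt k (t k j))) < \<epsilon> / 2"
    using \<epsilon> by (intro order_tendstoD(2)[OF lims(1)]) simp
  moreover have "\<forall>\<^sub>F k in sequentially. value_defect (\<lambda>s. (ub s, bb s, xb s)) (t k) (\<nu> k)
      (\<lambda>j. (ut k (t k j), bt k (t k j), xt k (t k j))) < \<epsilon> / 2"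
    using \<epsilon> by (intro order_tendstoD(2)[OF lims(2)]) simp
  ultimately show ?thesis
  proof eventually_elim
    case (elim k)
    have step: "\<exists>v\<in>sweep_map (ut k (t k j)) (bt k (t k j)) (xt k (t k j)).
        xt k (t k (Suc j)) = xt k (t k j) - (t k (Suc j) - t k j) *\<^sub>R v" if j: "j < \<nu> k" for j
    proof -
      have "0 < t k (Suc j) - t k j" using mesh_step[OF m j] by simp
      from explicit_step_iff[OF this] show ?thesis using ad' j by blast
    qed
    have "\<exists>w\<in>\<Omega>. \<exists>y\<in>cball 0 1. xt k (t k (\<nu> k)) = w + norm (xt k T - xb T) *\<^sub>R y"
    proof (intro bexI)
      \<comment> \<open>The point of \<open>\<Omega>\<close> is \<open>xb T\<close> itself, which
        explains the radius \<open>norm (xt k T - xb T)\<close> of the enlargement;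
        \<open>sgn\<close> is 0 when the end points agree.\<close>
      show "xt k (t k (\<nu> k)) = xb T + norm (xt k T - xb T) *\<^sub>R sgn (xt k T - xb T)"
        using mesh_ends(2)[OF m] by (cases "xt k T = xb T") (simp_all add: sgn_div_norm)
    qed (auto simp: x0 norm_sgn)
    moreover have "ut k (t k 0) = ub 0" "bt k (t k 0) = bb 0" "xt k (t k 0) = x0"
      using ad' mesh_ends(1)[OF m] by auto
    moreover have "\<forall>j\<le>\<nu> k. \<forall>i. 1 - \<delta> k \<le> norm (ut k (t k j) $ i) \<and> norm (ut k (t k j) $ i) \<le> 1 + \<delta> k"
      using ad' by blast
    ultimately show ?case
      unfolding discrete_feasible_def using step elim x0 by (intro conjI allI impI) auto
  qed
qed

subsection \<open>Limits of discrete trajectories\<close>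

text \<open>A sequence of discretely feasible triples that has already been thinned out to converge
  uniformly. The assumption \<open>slater\<close> on the limit controls allows the variational
  inequality to be tested with strictly feasible points alone.\<close>

locale discrete_sweeping_limit =
  fixes T \<epsilon> :: real and x0 :: "real^'n" and \<Omega> :: "(real^'n) set"
    and ub :: "real \<Rightarrow> real^'n^'m" and bb :: "real \<Rightarrow> real^'m" and xb :: "real \<Rightarrow> real^'n"
    and t :: "nat \<Rightarrow> nat \<Rightarrow> real" and \<nu> :: "nat \<Rightarrow> nat" and \<delta> \<xi> :: "nat \<Rightarrow> real"
    and U :: "nat \<Rightarrow> nat \<Rightarrow> real^'n^'m" and B :: "nat \<Rightarrow> nat \<Rightarrow> real^'m" and X :: "nat \<Rightarrow> nat \<Rightarrow> real^'n"
    and u :: "real \<Rightarrow> real^'n^'m" and b :: "real \<Rightarrow> real^'m" and x :: "real \<Rightarrow> real^'n"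
  assumes T: "0 < T" and m: "\<And>k. mesh T (t k) (\<nu> k)"
    and msize: "(\<lambda>k. mesh_size (t k) (\<nu> k)) \<longlonglongrightarrow> 0"
    and W: "W12 T (\<lambda>s. (ub s, bb s, xb s))" and xb0: "xb 0 = x0" and closed: "closed \<Omega>"
    and \<delta>: "\<delta> \<longlonglongrightarrow> 0" and \<xi>: "\<xi> \<longlonglongrightarrow> 0"
    and feas: "\<And>k. discrete_feasible T x0 \<Omega> ub bb xb \<epsilon> (\<delta> k) (\<xi> k) (t k) (\<nu> k) (U k) (B k) (X k)"
    and cont: "continuous_on {0..T} (\<lambda>s. (u s, b s, x s))"
    and unif: "\<And>e. 0 < e \<Longrightarrow> \<forall>\<^sub>F k in sequentially. \<forall>s\<in>{0..T}.
        norm (pl_extension (t k) (\<lambda>j. (U k j, B k j, X k j)) s - (u s, b s, x s)) < e"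
    and slater: "\<And>s. s \<in> {0..T} \<Longrightarrow> slater (u s) (b s)"
begin

abbreviation "zb \<equiv> \<lambda>s. (ub s, bb s, xb s)"
abbreviation "z \<equiv> \<lambda>s. (u s, b s, x s)"
abbreviation "Z \<equiv> \<lambda>k j. (U k j, B k j, X k j)"

lemma feasD:
  "j < \<nu> k \<Longrightarrow> - ((1 / (t k (Suc j) - t k j)) *\<^sub>R (X k (Suc j) - X k j)) \<in> sweep_map (U k j) (B k j) (X k j)"
  "Z k 0 = zb 0" "x0 \<in> polyhedron_of (ub 0) (bb 0)"
  "\<exists>w\<in>\<Omega>. \<exists>y\<in>cball 0 1. X k (\<nu> k) = w + \<xi> k *\<^sub>R y"
  "j \<le> \<nu> k \<Longrightarrow> 1 - \<delta> k \<le> norm (U k j $ i)" "j \<le> \<nu> k \<Longrightarrow> norm (U k j $ i) \<le> 1 + \<delta> k"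
  "rate_defect T zb (t k) (\<nu> k) (Z k) \<le> \<epsilon> / 2"
proof -
  note f = feas[of k, unfolded discrete_feasible_def]
  show "j < \<nu> k \<Longrightarrow> - ((1 / (t k (Suc j) - t k j)) *\<^sub>R (X k (Suc j) - X k j)) \<in> sweep_map (U k j) (B k j) (X k j)"
    using explicit_step_iff[of "t k (Suc j) - t k j"] mesh_step[OF m, of j k] f by auto
qed (use feas[of k] xb0 in \<open>auto simp: discrete_feasible_def\<close>)

text \<open>Uniform convergence and continuity of the limit allow the time to move with
  \<open>k\<close>, as the left nodes do.\<close>

lemma pl_tendsto:
  assumes s: "s \<in> {0..T}" and r: "\<And>k. r k \<in> {0..T}" "r \<longlonglongrightarrow> s"
  shows "(\<lambda>k. pl_extension (t k) (Z k) (r k)) \<longlonglongrightarrow> z s"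
proof -
  have "(\<lambda>k. z (r k)) \<longlonglongrightarrow> z s"
    using continuous_on_tendsto_compose[OF cont r(2) s] r(1) by simp
  moreover have "(\<lambda>k. pl_extension (t k) (Z k) (r k) - z (r k)) \<longlonglongrightarrow> 0"
  proof (rule tendstoI)
    fix e :: real assume "0 < e"
    from unif[OF this] show "\<forall>\<^sub>F k in sequentially. dist (pl_extension (t k) (Z k) (r k) - z (r k)) 0 < e"
      by eventually_elim (use r(1) in \<open>simp add: dist_norm\<close>)
  qed
  ultimately have "(\<lambda>k. (pl_extension (t k) (Z k) (r k) - z (r k)) + z (r k)) \<longlonglongrightarrow> 0 + z s"
    by (intro tendsto_add)
  then show ?thesis by simp
qed

text \<open>The discrete constraints hold at nodes, so a pointwise property at \<open>s\<close> is
  read off from the left node of its cell. The index of that node is below \<open>\<nu> k\<close>,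
  so the sweeping inclusion is available there even for \<open>s = T\<close>.\<close>

lemma left_node_tendsto:
  assumes s: "s \<in> {0..T}"
  shows "(\<lambda>k. Z k (mesh_index (t k) s)) \<longlonglongrightarrow> z s"
proof -
  let ?j = "\<lambda>k. mesh_index (t k) s"
  note cell = mesh_index_cell[OF m T s]
  have node: "t k (?j k) \<in> {0..T}" for k
    using mesh_node[OF m less_imp_le[OF cell(1)]] .
  have "(\<lambda>k. s - t k (?j k)) \<longlonglongrightarrow> 0"
  proof (rule tendsto_sandwich[where f = "\<lambda>_. 0"])
    show "\<forall>\<^sub>F k in sequentially. s - t k (?j k) \<le> mesh_size (t k) (\<nu> k)"
    proof (rule always_eventually, rule allI)
      fix k
      show "s - t k (?j k) \<le> mesh_size (t k) (\<nu> k)"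
        using mesh_size_ge[OF m cell(1), of k] cell(3)[of k] by simp
    qed
  qed (use cell(2) msize in auto)
  then have "(\<lambda>k. s - (s - t k (?j k))) \<longlonglongrightarrow> s - 0"
    by (intro tendsto_intros)
  then have "(\<lambda>k. t k (?j k)) \<longlonglongrightarrow> s" by simp
  from pl_tendsto[OF s node this] show ?thesis
    by (simp only: pl_extension_node[OF m T less_imp_le[OF cell(1)]])
qed

lemma left_node_components:
  assumes "s \<in> {0..T}"
  shows "(\<lambda>k. U k (mesh_index (t k) s)) \<longlonglongrightarrow> u s" "(\<lambda>k. B k (mesh_index (t k) s)) \<longlonglongrightarrow> b s"
    "(\<lambda>k. X k (mesh_index (t k) s)) \<longlonglongrightarrow> x s"
  using tendsto_fst[OF left_node_tendsto[OF assms]] tendsto_fst[OF tendsto_snd[OF left_node_tendsto[OF assms]]]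
    tendsto_snd[OF tendsto_snd[OF left_node_tendsto[OF assms]]] by simp_all

lemma pl_X_tendsto:
  assumes "s \<in> {0..T}"
  shows "(\<lambda>k. pl_extension (t k) (X k) s) \<longlonglongrightarrow> x s"
proof -
  have "(\<lambda>k. snd (snd (pl_extension (t k) (Z k) s))) \<longlonglongrightarrow> snd (snd (z s))"
    by (intro tendsto_snd pl_tendsto assms) auto
  then show ?thesis
    by (simp add: pl_extension_def Let_def)
qed

text \<open>The density is sought for the deviation \<open>z - zb\<close> rather than for
  \<open>z\<close>: the limit then inherits the bound \<open>\<epsilon> / 2\<close> of the rate
  constraint, which later places it within the radius of local minimality.\<close>

lemma limit_density:
  obtains h where "has_ac_deriv T (\<lambda>s. z s - zb s) h" "h square_integrable_on {0..T}"
    "sq_int 0 T h \<le> \<epsilon> / 2" "z 0 = zb 0"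
proof -
  let ?h = "\<lambda>k s. pl_slope (t k) (Z k) s - ac_deriv T zb s"
  note dev = pl_extension_deviation[where t = "t k" and \<nu> = "\<nu> k" and v = "Z k" and zb = zb for k, OF m T W feasD(2)]
  have 0: "0 \<in> {0..T}" using T by simp
  have init: "pl_extension (t k) (Z k) 0 = zb 0" for k
    using pl_extension_node[OF m T, of 0 k "Z k"] mesh_ends(1)[OF m] feasD(2)[of k] by simp
  have "(\<lambda>k. pl_extension (t k) (Z k) 0) \<longlonglongrightarrow> z 0"
    by (rule pl_tendsto[OF 0]) (use 0 in simp_all)
  then have z0: "z 0 = zb 0"
    unfolding init by (rule LIMSEQ_unique) (rule tendsto_const)
  obtain h where h: "h square_integrable_on {0..T}" "sq_int 0 T h \<le> \<epsilon> / 2"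
    "\<And>s. s \<in> {0..T} \<Longrightarrow> z s - zb s = integral {0..s} h"
  proof (rule L2_density_of_uniform_limit)
    fix e :: real assume "0 < e"
    then obtain k where k: "\<forall>s\<in>{0..T}. norm (pl_extension (t k) (Z k) s - z s) < e"
      using eventually_happens'[OF sequentially_bot unif] by blast
    show "\<exists>g. g square_integrable_on {0..T} \<and> sq_int 0 T g \<le> \<epsilon> / 2 \<and>
        (\<forall>s\<in>{0..T}. norm (integral {0..s} g - (z s - zb s)) \<le> e)"
    proof (intro exI conjI ballI)
      show "?h k square_integrable_on {0..T}" by (rule dev(2))
      show "sq_int 0 T (?h k) \<le> \<epsilon> / 2"
        using feasD(7)[of k] unfolding rate_defect_eq[OF m W] .
      fix s assume s: "s \<in> {0..T}"
      have eq: "integral {0..s} (?h k) = pl_extension (t k) (Z k) s - zb s"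
        using has_ac_derivD(3)[OF dev(1) s, of k] init[of k] by simp
      have cancel: "(p - q) - (w - q) = p - w" for p q w :: "(real^'n^'m) \<times> (real^'m) \<times> (real^'n)"
        by simp
      show "norm (integral {0..s} (?h k) - (z s - zb s)) \<le> e"
        unfolding eq cancel using k s by (blast intro: less_imp_le)
    qed
  qed (use T in auto)
  have "has_ac_deriv T (\<lambda>s. z s - zb s) h"
    unfolding has_ac_deriv_def using square_integrableD(1)[OF h(1)] h(3) z0 by simp
  then show ?thesis using that h(1,2) z0 by blast
qed

text \<open>A nonempty normal cone already places the discrete state in its polyhedron.\<close>

lemma limit_in_polyhedron:
  assumes "s \<in> {0..T}"
  shows "x s \<in> polyhedron_of (u s) (b s)"
proof (rule polyhedron_of_limit[OF left_node_components[OF assms]])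
  have "X k (mesh_index (t k) s) \<in> polyhedron_of (U k (mesh_index (t k) s)) (B k (mesh_index (t k) s))" for k
    using feasD(1)[OF mesh_index_cell(1)[OF m T assms], of k]
    by (auto simp: sweep_map_def normal_cone_def split: if_splits)
  then show "\<forall>\<^sub>F k in sequentially. X k (mesh_index (t k) s) \<in>
      polyhedron_of (U k (mesh_index (t k) s)) (B k (mesh_index (t k) s))"
    by simp
qed

lemma limit_unit_normals:
  assumes "s \<in> {0..T}"
  shows "norm (u s $ i) = 1"
proof (rule LIMSEQ_unique)
  let ?j = "\<lambda>k. mesh_index (t k) s"
  show "(\<lambda>k. norm (U k (?j k) $ i)) \<longlonglongrightarrow> norm (u s $ i)"
    by (intro tendsto_intros left_node_components(1)[OF assms])
  have j: "?j k \<le> \<nu> k" for k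
    using mesh_index_cell(1)[OF m T assms, of k] by simp
  show "(\<lambda>k. norm (U k (?j k) $ i)) \<longlonglongrightarrow> 1"
  proof (rule tendsto_sandwich)
    show "(\<lambda>k. 1 - \<delta> k) \<longlonglongrightarrow> 1" "(\<lambda>k. 1 + \<delta> k) \<longlonglongrightarrow> 1"
      using tendsto_diff[OF tendsto_const[of "1::real"] \<delta>] tendsto_add[OF tendsto_const[of "1::real"] \<delta>] by simp_all
  qed (use feasD(5,6)[OF j] in auto)
qed

lemma limit_endpoint: "x T \<in> \<Omega>"
proof -
  have "\<forall>k. \<exists>w y. w \<in> \<Omega> \<and> y \<in> cball 0 1 \<and> X k (\<nu> k) = w + \<xi> k *\<^sub>R y"
    using feasD(4) by blast
  then obtain w y where w: "\<And>k. w k \<in> \<Omega>" "\<And>k. y k \<in> cball 0 1" "\<And>k. X k (\<nu> k) = w k + \<xi> k *\<^sub>R y k"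
    by metis
  have end1: "pl_extension (t k) (X k) T = X k (\<nu> k)" for k
    using pl_extension_node[OF m T, of "\<nu> k" k "X k"] mesh_ends(2)[OF m] by simp
  have "(\<lambda>k. \<xi> k *\<^sub>R y k) \<longlonglongrightarrow> 0"
  proof (rule Lim_null_comparison)
    show "\<forall>\<^sub>F k in sequentially. norm (\<xi> k *\<^sub>R y k) \<le> \<bar>\<xi> k\<bar>"
      using w(2) by (simp add: mult_left_le)
    show "(\<lambda>k. \<bar>\<xi> k\<bar>) \<longlonglongrightarrow> 0" using tendsto_rabs[OF \<xi>] by simp
  qed
  moreover have "(\<lambda>k. X k (\<nu> k)) \<longlonglongrightarrow> x T"
    using pl_X_tendsto[of T] T by (simp add: end1)
  ultimately have "(\<lambda>k. X k (\<nu> k) - \<xi> k *\<^sub>R y k) \<longlonglongrightarrow> x T - 0"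
    by (intro tendsto_diff)
  then have "w \<longlonglongrightarrow> x T" using w(3) by simp
  then show ?thesis
    by (rule Lim_in_closed_set[OF closed _ sequentially_bot, rotated]) (simp add: w(1))
qed

text \<open>The distance to a point that stays strictly feasible cannot increase. This integrated form of
  the variational inequality involves no derivatives and so survives uniform limits.\<close>

lemma limit_distance_decrease:
  assumes s: "s \<in> {0..<T}" and y: "\<And>i. u s $ i \<bullet> y < b s $ i"
  shows "\<forall>\<^sub>F h in at_right 0. (norm (x (s + h) - y))\<^sup>2 \<le> (norm (x s - y))\<^sup>2"
proof -
  let ?O = "{p :: (real^'n^'m) \<times> (real^'m). \<forall>i. fst p $ i \<bullet> y < snd p $ i}"
  \<comment> \<open>Controls within \<open>r\<close> of \<open>(u s, b s)\<close> keep
    \<open>y\<close> strictly inside. Half of \<open>r\<close> is spent on the continuity of the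
    limit, half on the uniform approximation.\<close>
  obtain r where r: "0 < r" "ball (u s, b s) r \<subseteq> ?O"
    using open_strictly_inside[of y] y by (force simp: open_contains_ball)
  have sT: "s \<in> {0..T}" using s by auto
  obtain d where d: "0 < d" "\<And>s'. s' \<in> {0..T} \<Longrightarrow> dist s' s < d \<Longrightarrow> dist (z s') (z s) < r/2"
    using cont r(1) sT unfolding continuous_on_iff by (metis half_gt_zero)
  \<comment> \<open>Both \<open>h\<close> and, eventually, the mesh size stay below
    \<open>d/2\<close>, so the left node of every cell meeting \<open>{s..s + h}\<close> is within
    \<open>d\<close> of \<open>s\<close>.\<close>
  have "(norm (x (s + h) - y))\<^sup>2 \<le> (norm (x s - y))\<^sup>2" if h: "0 < h" "h < min (d/2) (T - s)" for h
  proof -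
    have sh: "s + h \<in> {0..T}" using h s by auto
    \<comment> \<open>The factor 2 comes from \<open>sq_int_pl_slope_le\<close>, and twice the rate
      bound \<open>\<epsilon> / 2\<close> gives \<open>\<epsilon>\<close>.\<close>
    define M where "M = 2 * sq_int 0 T (ac_deriv T zb) + \<epsilon>"
    have slope: "sq_int 0 T (pl_slope (t k) (X k)) \<le> M" for k
    proof -
      have lin: "bounded_linear (\<lambda>z :: (real^'n^'m) \<times> (real^'m) \<times> (real^'n). snd (snd z))"
        by (intro bounded_linear_compose[OF bounded_linear_snd bounded_linear_snd])
      have "pl_slope (t k) (X k) = (\<lambda>s. snd (snd (pl_slope (t k) (Z k) s)))"
        by (simp add: pl_slope_def Let_def fun_eq_iff)
      then have "sq_int 0 T (pl_slope (t k) (X k)) \<le> sq_int 0 T (pl_slope (t k) (Z k))"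
        using square_integrable_contraction(2)[OF pl_slope_square_integrable[OF m] lin norm_triple_le(2)] by simp
      also have "\<dots> \<le> M"
        using sq_int_pl_slope_le[OF m W, of k "Z k"] feasD(7)[of k] unfolding M_def by linarith
      finally show ?thesis .
    qed
    have "\<forall>\<^sub>F k in sequentially. mesh_size (t k) (\<nu> k) < d/2"
      using d(1) by (intro order_tendstoD(2)[OF msize]) simp
    moreover have "\<forall>\<^sub>F k in sequentially. \<forall>s\<in>{0..T}. norm (pl_extension (t k) (Z k) s - z s) < r/2"
      using r(1) by (intro unif) simp
    ultimately have "\<forall>\<^sub>F k in sequentially. (norm (pl_extension (t k) (X k) (s + h) - y))\<^sup>2
        - (norm (pl_extension (t k) (X k) s - y))\<^sup>2 \<le> 2 * mesh_size (t k) (\<nu> k) * M"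
    proof eventually_elim
      case (elim k)
      have "((1 / (t k (Suc j) - t k j)) *\<^sub>R (X k (Suc j) - X k j)) \<bullet> (X k j - y) \<le> 0"
        if j: "j < \<nu> k" "s \<le> t k (Suc j)" "t k j \<le> s + h" for j
      proof -
        have tj: "t k j \<in> {0..T}" using mesh_node[OF m] j(1) by simp
        have "dist (t k j) s < d"
          using mesh_size_ge[OF m j(1)] elim(1) j h(1) h(2)[unfolded min_less_iff_conj]
          unfolding dist_real_def abs_less_iff by linarith
        from d(2)[OF tj this] have "norm (z (t k j) - z s) < r/2" by (simp add: dist_norm)
        moreover have "norm (Z k j - z (t k j)) < r/2"
          using elim(2) tj pl_extension_node[OF m T, of j k "Z k"] j(1) by fastforce
        ultimately have "norm (Z k j - z s) < r"
          using norm_triangle_ineq[of "Z k j - z (t k j)" "z (t k j) - z s"] by simp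
        then have "norm ((U k j, B k j) - (u s, b s)) < r"
          using norm_triple_le(1)[of "Z k j - z s"] by simp
        then have "(U k j, B k j) \<in> ball (u s, b s) r"
          unfolding mem_ball dist_norm norm_minus_commute[of "(u s, b s)"] .
        then have "(U k j, B k j) \<in> ?O"
          using r(2) by blast
        then have "y \<in> polyhedron_of (U k j) (B k j)"
          by (auto simp: polyhedron_of_def intro: less_imp_le)
        then have "- ((1 / (t k (Suc j) - t k j)) *\<^sub>R (X k (Suc j) - X k j)) \<bullet> (y - X k j) \<le> 0"
          using feasD(1)[OF j(1)] by (auto simp: sweep_map_def normal_cone_def split: if_splits)
        then show ?thesis
          by (simp add: inner_diff_right)
      qed
      from pl_distance_decrease[OF m T _ _ _ this, of s "s + h"] sh s h
      have "(norm (pl_extension (t k) (X k) (s + h) - y))\<^sup>2 - (norm (pl_extension (t k) (X k) s - y))\<^sup>2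
          \<le> 2 * mesh_size (t k) (\<nu> k) * sq_int 0 T (pl_slope (t k) (X k))" by simp
      also have "\<dots> \<le> 2 * mesh_size (t k) (\<nu> k) * M"
      proof (intro mult_left_mono slope)
        have "0 < \<nu> k" using T mesh_ends[OF m, of k] by (cases "\<nu> k") auto
        then show "0 \<le> 2 * mesh_size (t k) (\<nu> k)"
          using mesh_size_ge[OF m, of 0 k] mesh_step[OF m, of 0 k] by linarith
      qed
      finally show ?case .
    qed
    moreover have "(\<lambda>k. (norm (pl_extension (t k) (X k) (s + h) - y))\<^sup>2
        - (norm (pl_extension (t k) (X k) s - y))\<^sup>2) \<longlonglongrightarrow> (norm (x (s + h) - y))\<^sup>2 - (norm (x s - y))\<^sup>2"
      by (intro tendsto_intros pl_X_tendsto sh sT)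
    moreover have "(\<lambda>k. 2 * mesh_size (t k) (\<nu> k) * M) \<longlonglongrightarrow> 2 * 0 * M"
      by (intro tendsto_intros msize)
    ultimately have "(norm (x (s + h) - y))\<^sup>2 - (norm (x s - y))\<^sup>2 \<le> 2 * 0 * M"
      by (intro tendsto_le[OF sequentially_bot])
    then show ?thesis by simp
  qed
  then show ?thesis
    unfolding eventually_at_right_field
    using d(1) s by (intro exI[of _ "min (d/2) (T - s)"]) auto
qed

text \<open>Where \<open>x\<close> has the right derivative \<open>v s\<close>, dividing the
  decrease of the squared distance by the time step gives the variational inequality for strictly
  feasible points; the Slater condition extends it to the whole polyhedron.\<close>

lemma limit_sweeping:
  assumes v: "has_ac_deriv T x v"
  shows "AE s in lebesgue. s \<in> {0..T} \<longrightarrow> - v s \<in> sweep_map (u s) (b s) (x s)"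
proof -
  obtain N where N: "negligible N"
    "\<And>s. s \<in> {0..<T} - N \<Longrightarrow> ((\<lambda>h. (1/h) *\<^sub>R (x (s + h) - x s)) \<longlongrightarrow> v s) (at_right 0)"
    by (rule has_ac_deriv_right_derivative[OF v]) blast
  have incl: "- v s \<in> sweep_map (u s) (b s) (x s)" if s: "s \<in> {0..<T} - N" for s
  proof -
    have sT: "s \<in> {0..T}" using s by auto
    let ?q = "\<lambda>h. (1/h) *\<^sub>R (x (s + h) - x s)"
    have "- v s \<bullet> (y - x s) \<le> 0" if y: "y \<in> polyhedron_of (u s) (b s)" for y
    proof (rule variational_inequality_from_strict[OF slater[OF sT] y])
      fix w assume w: "\<And>i. u s $ i \<bullet> w < b s $ i"
      have "\<forall>\<^sub>F h in at_right 0. 2 * ((x s - w) \<bullet> ?q h) + h * (norm (?q h))\<^sup>2 \<le> 0"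
      proof -
        have "\<forall>\<^sub>F h in at_right 0. (norm (x (s + h) - w))\<^sup>2 \<le> (norm (x s - w))\<^sup>2"
          using s by (intro limit_distance_decrease w) auto
        then show ?thesis
          using eventually_at_right_less[of 0]
        proof eventually_elim
          case (elim h)
          \<comment> \<open>Expanding the square around \<open>x s - w\<close> factors out
            \<open>h\<close>. What remains is the difference quotient of the squared distance, whose
            quadratic part vanishes as \<open>h\<close> tends to 0.\<close>
          have "x (s + h) - w = (x s - w) + h *\<^sub>R ?q h" using elim by simp
          then have "(norm (x (s + h) - w))\<^sup>2 = (norm (x s - w))\<^sup>2 + h * (2 * ((x s - w) \<bullet> ?q h) + h * (norm (?q h))\<^sup>2)"
            by (simp only: power2_norm_eq_inner) (simp add: algebra_simps inner_commute power2_eq_square)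
          then have "h * (2 * ((x s - w) \<bullet> ?q h) + h * (norm (?q h))\<^sup>2) \<le> 0"
            using elim by simp
          then show ?case
            using elim(2) by (simp add: mult_le_0_iff)
        qed
      qed
      moreover have "((\<lambda>h. 2 * ((x s - w) \<bullet> ?q h) + h * (norm (?q h))\<^sup>2) \<longlongrightarrow>
          2 * ((x s - w) \<bullet> v s) + 0 * (norm (v s))\<^sup>2) (at_right 0)"
        by (intro tendsto_intros N(2) s)
      ultimately have "2 * ((x s - w) \<bullet> v s) + 0 * (norm (v s))\<^sup>2 \<le> 0"
        by (intro tendsto_upperbound[OF _ _ trivial_limit_at_right_real])
      then show "- v s \<bullet> (w - x s) \<le> 0"
        by (simp add: inner_diff_right inner_diff_left inner_commute)
    qed
    then show ?thesis
      using limit_in_polyhedron[OF sT] by (simp add: sweep_map_def normal_cone_def)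
  qed
  have "AE s in lebesgue. s \<notin> insert T N"
    using N(1) by (intro AE_not_in) (simp add: negligible_iff_null_sets[symmetric] negligible_insert)
  then show ?thesis
    by eventually_elim (use incl in auto)
qed

text \<open>The density of the deviation is projected to controls and state separately. Each part
  obeys the same bound, so the sum tested in local minimality is at most twice that bound.\<close>

lemma limit_feasible:
  "feasible_P T x0 \<Omega> u b x"
  "W12 T (\<lambda>s. x s - xb s)"
  "W12_norm T (\<lambda>s. (u s, b s) - (ub s, bb s)) \<le> sqrt ((T\<^sup>2 + 1) * (\<epsilon> / 2))"
  "W12_norm T (\<lambda>s. x s - xb s) \<le> sqrt ((T\<^sup>2 + 1) * (\<epsilon> / 2))"
proof -
  obtain h where h: "has_ac_deriv T (\<lambda>s. z s - zb s) h" "h square_integrable_on {0..T}"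
    "sq_int 0 T h \<le> \<epsilon> / 2" "z 0 = zb 0"
    using limit_density .
  define g where "g s = h s + ac_deriv T zb s" for s
  have g: "has_ac_deriv T z g" "g square_integrable_on {0..T}"
    using has_ac_deriv_add[OF h(1) W12D(1)[OF W]] square_integrable_add[OF h(2) W12D(2)[OF W]]
    by (simp_all add: g_def[abs_def])
  let ?c = "\<lambda>z :: (real^'n^'m) \<times> (real^'m) \<times> (real^'n). (fst z, fst (snd z))"
  let ?s = "\<lambda>z :: (real^'n^'m) \<times> (real^'m) \<times> (real^'n). snd (snd z)"
  have c: "bounded_linear ?c"
    by (intro bounded_linear_Pair bounded_linear_fst bounded_linear_compose[OF bounded_linear_fst bounded_linear_snd])
  have s: "bounded_linear ?s"
    by (rule bounded_linear_compose[OF bounded_linear_snd bounded_linear_snd])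
  note hc = square_integrable_contraction[OF h(2) c norm_triple_le(1)]
    and hs = square_integrable_contraction[OF h(2) s norm_triple_le(2)]
  have dc: "has_ac_deriv T (\<lambda>s. (u s, b s) - (ub s, bb s)) (\<lambda>s. ?c (h s))"
    using has_ac_deriv_linear[OF h(1) c] by simp
  have ds: "has_ac_deriv T (\<lambda>s. x s - xb s) (\<lambda>s. ?s (h s))"
    using has_ac_deriv_linear[OF h(1) s] by simp
  show "W12 T (\<lambda>s. x s - xb s)"
    by (rule W12I[OF ds hs(1)])
  show "W12_norm T (\<lambda>s. (u s, b s) - (ub s, bb s)) \<le> sqrt ((T\<^sup>2 + 1) * (\<epsilon> / 2))"
    by (rule W12_norm_le[OF dc hc(1)]) (use h(3,4) hc(2) T in auto)
  show "W12_norm T (\<lambda>s. x s - xb s) \<le> sqrt ((T\<^sup>2 + 1) * (\<epsilon> / 2))"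
    by (rule W12_norm_le[OF ds hs(1)]) (use h(3,4) hs(2) T in auto)
  have "has_ac_deriv T (\<lambda>s. (u s, b s)) (\<lambda>s. ?c (g s))"
    using has_ac_deriv_linear[OF g(1) c] by simp
  then have "W12 T (\<lambda>s. (u s, b s))"
    by (rule W12I[OF _ square_integrable_contraction(1)[OF g(2) c norm_triple_le(1)]])
  moreover have "has_ac_deriv T x (\<lambda>s. ?s (g s))"
    using has_ac_deriv_linear[OF g(1) s] by simp
  moreover from limit_sweeping[OF this]
  have "AE s in lebesgue. s \<in> {0..T} \<longrightarrow> - ?s (g s) \<in> sweep_map (u s) (b s) (x s)" .
  ultimately show "feasible_P T x0 \<Omega> u b x"
    unfolding feasible_P_def sweeping_trajectory_def
    using limit_unit_normals limit_endpoint h(4) feasD(3) xb0 by auto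
qed

end

subsection \<open>Convergence of discrete minimizers\<close>

text \<open>Hoelder continuity with exponent 1/2 and a constant given by the energy; this is the
  equicontinuity behind Arzela-Ascoli.\<close>

lemma norm_sq_ac_increment_le:
  assumes "has_ac_deriv T f g" "g square_integrable_on {0..T}" "sq_int 0 T g \<le> M"
    and "s \<in> {0..T}" "r \<in> {0..T}"
  shows "(norm (f s - f r))\<^sup>2 \<le> \<bar>s - r\<bar> * M"
proof -
  have le: "(norm (f s - f r))\<^sup>2 \<le> (s - r) * M" if "r \<le> s" "0 \<le> r" "s \<le> T" for s r
  proof -
    have sub: "{r..s} \<subseteq> {0..T}" using that by auto
    have "(norm (f s - f r))\<^sup>2 = (norm (integral {r..s} g))\<^sup>2"
      using has_ac_deriv_increment[OF assms(1) that(2,1,3)] by simp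
    also have "\<dots> \<le> (s - r) * sq_int r s g"
      by (intro Cauchy_Schwarz_integral square_integrable_subinterval[OF assms(2) sub] that)
    also have "\<dots> \<le> (s - r) * M"
      using sq_int_subinterval_le[OF assms(2) sub] assms(3) that by (intro mult_left_mono) auto
    finally show ?thesis .
  qed
  show ?thesis
  proof (cases "r \<le> s")
    case True
    then show ?thesis using le[of r s] assms(4,5) by simp
  next
    case False
    then show ?thesis using le[of s r] assms(4,5) by (simp add: norm_minus_commute)
  qed
qed

lemma not_tendsto_0_subsequence:
  fixes a :: "nat \<Rightarrow> real"
  assumes "\<not> a \<longlonglongrightarrow> 0" "\<And>k. 0 \<le> a k" "\<forall>\<^sub>F k in sequentially. P k"
  shows "\<exists>\<eta> r. 0 < \<eta> \<and> strict_mono (r :: nat \<Rightarrow> nat) \<and> (\<forall>n. \<eta> \<le> a (r n) \<and> P (r n))"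
proof -
  obtain \<eta> where \<eta>: "0 < \<eta>" "\<not> (\<forall>\<^sub>F k in sequentially. dist (a k) 0 < \<eta>)"
    using assms(1) unfolding tendsto_iff by blast
  have "\<exists>\<^sub>F k in sequentially. \<eta> \<le> a k"
    using \<eta>(2) assms(2) by (simp add: frequently_def not_le)
  then have "\<exists>\<^sub>F k in sequentially. \<eta> \<le> a k \<and> P k"
    using assms(3) by (rule frequently_eventually_frequently)
  then have "infinite {k. \<eta> \<le> a k \<and> P k}"
    by (simp add: frequently_cofinite flip: cofinite_eq_sequentially)
  then obtain r :: "nat \<Rightarrow> nat" where "strict_mono r" "\<And>n. r n \<in> {k. \<eta> \<le> a k \<and> P k}"
    using infinite_enumerate by blast
  then show ?thesis using \<eta>(1) by blast
qed

text \<open>The hypothesis \<open>min\<close> states local minimality in exactly the form that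
  \<open>limit_feasible\<close> delivers, and \<open>\<rho>\<close> is a common radius for Slater
  points and for continuity of \<open>\<phi>\<close>.\<close>

lemma optimal_rate_defect_tendsto_0:
  fixes ub :: "real \<Rightarrow> real^'n^'m"
  assumes T: "0 < T" and ad: "approximating_data T x0 ub bb xb t \<nu> \<delta> ut bt xt"
    and x0: "xb 0 = x0" "x0 \<in> polyhedron_of (ub 0) (bb 0)" "xb T \<in> \<Omega>" and closed: "closed \<Omega>"
    and \<rho>: "\<And>s u' b'. s \<in> {0..T} \<Longrightarrow> dist (ub s, bb s) (u', b') \<le> \<rho> \<Longrightarrow> slater u' b'"
    and cont: "\<And>y. dist y (xb T) \<le> \<rho> \<Longrightarrow> isCont \<phi> y"
    and \<epsilon>: "0 < \<epsilon>" "T * (\<epsilon> / 2) \<le> \<rho>\<^sup>2" "0 \<le> \<rho>"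
    and min: "\<And>u b x. feasible_P T x0 \<Omega> u b x \<Longrightarrow> W12 T (\<lambda>s. x s - xb s) \<Longrightarrow>
        W12_norm T (\<lambda>s. (u s, b s) - (ub s, bb s)) \<le> sqrt ((T\<^sup>2 + 1) * (\<epsilon> / 2)) \<Longrightarrow>
        W12_norm T (\<lambda>s. x s - xb s) \<le> sqrt ((T\<^sup>2 + 1) * (\<epsilon> / 2)) \<Longrightarrow> \<phi> (xb T) \<le> \<phi> (x T)"
    and opt: "\<forall>\<^sub>F k in sequentially. discrete_optimal T x0 \<Omega> \<phi> ub bb xb \<epsilon> (\<delta> k)
        (norm (xt k T - xb T)) (t k) (\<nu> k) (U k) (B k) (X k)"
  shows "(\<lambda>k. rate_defect T (\<lambda>s. (ub s, bb s, xb s)) (t k) (\<nu> k) (\<lambda>j. (U k j, B k j, X k j))) \<longlonglongrightarrow> 0"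
proof (rule ccontr)
  let ?zb = "\<lambda>s. (ub s, bb s, xb s)" and ?Z = "\<lambda>k j. (U k j, B k j, X k j)"
  let ?Zt = "\<lambda>k j. (ut k (t k j), bt k (t k j), xt k (t k j))"
  let ?rate = "\<lambda>k. rate_defect T ?zb (t k) (\<nu> k)"
  note ad' = ad[unfolded approximating_data_def]
  have m: "mesh T (t k) (\<nu> k)" for k using ad' by blast
  have msize: "(\<lambda>k. mesh_size (t k) (\<nu> k)) \<longlonglongrightarrow> 0" and \<delta>: "\<delta> \<longlonglongrightarrow> 0" using ad' by blast+
  have W: "W12 T ?zb" using ad' unfolding converges_W12_def by blast
  have contb: "continuous_on {0..T} ?zb" by (rule has_ac_deriv_continuous[OF W12D(1)[OF W]])
  note lims = approximating_data_limits[OF T ad x0(1)]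
  have \<xi>: "(\<lambda>k. norm (xt k T - xb T)) \<longlonglongrightarrow> 0"
    using tendsto_norm_zero[OF LIM_zero[OF lims(3)]] .
  define a where "a k = ?rate k (?Z k)" for k
  assume "\<not> (\<lambda>k. ?rate k (?Z k)) \<longlonglongrightarrow> 0"
  then have a_lim: "\<not> a \<longlonglongrightarrow> 0"
    unfolding a_def[abs_def] .
  have a_nonneg: "0 \<le> a k" for k
    unfolding a_def rate_defect_eq[OF m W] by (rule sq_int_nonneg)
  \<comment> \<open>Optimality of the solutions and feasibility of the data hold only eventually;
    bundled, they are available at every index of one subsequence, as the limit locale demands for
    feasibility.\<close>
  define good where "good k \<longleftrightarrow>
      discrete_optimal T x0 \<Omega> \<phi> ub bb xb \<epsilon> (\<delta> k) (norm (xt k T - xb T)) (t k) (\<nu> k) (U k) (B k) (X k) \<and>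
      discrete_feasible T x0 \<Omega> ub bb xb \<epsilon> (\<delta> k) (norm (xt k T - xb T)) (t k) (\<nu> k)
        (\<lambda>j. ut k (t k j)) (\<lambda>j. bt k (t k j)) (\<lambda>j. xt k (t k j))" for k
  have good: "\<forall>\<^sub>F k in sequentially. good k"
    unfolding good_def by (rule eventually_conj[OF opt approximating_data_feasible[OF T ad x0 \<epsilon>(1)]])
  obtain \<eta> and r :: "nat \<Rightarrow> nat" where \<eta>: "0 < \<eta>" and r: "strict_mono r"
    and all: "\<forall>n. \<eta> \<le> a (r n) \<and> good (r n)"
    using not_tendsto_0_subsequence[OF a_lim a_nonneg good] by blast
  have rate: "\<eta> \<le> ?rate (r n) (?Z (r n))" for n
    using all by (simp add: a_def)
  have ropt: "good (r n)" for n
    using all by simp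
  let ?f = "\<lambda>n. pl_extension (t (r n)) (?Z (r n))"
  have feas: "discrete_feasible T x0 \<Omega> ub bb xb \<epsilon> (\<delta> (r n))
        (norm (xt (r n) T - xb T)) (t (r n)) (\<nu> (r n)) (U (r n)) (B (r n)) (X (r n))" for n
    using ropt[of n] by (simp add: good_def discrete_optimal_def)
  have init: "?Z (r n) 0 = ?zb 0" and bound: "?rate (r n) (?Z (r n)) \<le> \<epsilon> / 2" for n
    using feas[of n] x0(1) by (auto simp: discrete_feasible_def)
  note dev = pl_extension_deviation[where t = "t (r n)" and \<nu> = "\<nu> (r n)" and v = "?Z (r n)" and zb = ?zb for n,
      OF m T W init]
  have near: "norm (?f n s - ?zb s) \<le> \<rho>" if "s \<in> {0..T}" for n s
  proof -
    have "(norm (?f n s - ?zb s))\<^sup>2 \<le> T * ?rate (r n) (?Z (r n))" by (rule dev(3)[OF that])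
    also have "\<dots> \<le> T * (\<epsilon> / 2)" using bound T by (intro mult_left_mono) auto
    finally show ?thesis using \<epsilon>(2,3) by (meson order_trans power2_le_imp_le)
  qed
  obtain R where R: "\<forall>s\<in>{0..T}. norm (?zb s) \<le> R"
    using compact_imp_bounded[OF compact_continuous_image[OF contb compact_Icc]]
    unfolding bounded_iff by auto
  define M where "M = 2 * sq_int 0 T (ac_deriv T ?zb) + \<epsilon>"
  have M: "sq_int 0 T (pl_slope (t (r n)) (?Z (r n))) \<le> M" for n
    using sq_int_pl_slope_le[OF m W, of "r n" "?Z (r n)"] bound[of n] unfolding M_def by linarith
  have M0: "0 < M"
    using \<epsilon>(1) sq_int_nonneg[of "{0..T}" "ac_deriv T ?zb"] unfolding M_def by linarith
  have bnd: "norm (?f n s) \<le> R + \<rho>" if "s \<in> {0..T}" for n s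
      using norm_triangle_ineq[of "?f n s - ?zb s" "?zb s"] near[OF that, of n] bspec[OF R that] by simp
  have equi: "\<exists>d>0. \<forall>n s'. s' \<in> {0..T} \<and> norm (s - s') < d \<longrightarrow> norm (?f n s - ?f n s') < e"
      if s: "s \<in> {0..T}" and e: "0 < e" for s e
    proof (intro exI conjI allI impI)
      show "0 < e\<^sup>2 / M" using e M0 by simp
      fix n s' assume s': "s' \<in> {0..T} \<and> norm (s - s') < e\<^sup>2 / M"
      have "(norm (?f n s - ?f n s'))\<^sup>2 \<le> \<bar>s - s'\<bar> * M"
        using norm_sq_ac_increment_le[OF pl_extension_has_ac_deriv[OF m T] pl_slope_square_integrable[OF m] M] s s'
        by blast
      also have "\<dots> < e\<^sup>2" using s' M0 by (simp add: pos_less_divide_eq)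
      finally show "norm (?f n s - ?f n s') < e"
        using e by (simp add: power2_less_imp_less)
    qed
  obtain g and q :: "nat \<Rightarrow> nat" where g: "continuous_on {0..T} g" and q: "strict_mono q"
    and unif: "\<And>e. 0 < e \<Longrightarrow> \<exists>N. \<forall>n s. n \<ge> N \<and> s \<in> {0..T} \<longrightarrow> norm (?f (q n) s - g s) < e"
  proof (rule Arzela_Ascoli[OF compact_Icc bnd equi])
    fix g and q :: "nat \<Rightarrow> nat"
    assume "continuous_on {0..T} g" "strict_mono q"
      "\<And>e. 0 < e \<Longrightarrow> \<exists>N. \<forall>n s. n \<ge> N \<and> s \<in> {0..T} \<longrightarrow> norm (?f (q n) s - g s) < e"
    then show thesis by (rule that)
  qed
  define p where "p n = r (q n)" for n
  have p: "strict_mono p" unfolding p_def using strict_mono_o[OF r q] by (simp add: o_def)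
  define u b x where "u s = fst (g s)" and "b s = fst (snd (g s))" and "x s = snd (snd (g s))" for s
  have g_eq: "(u s, b s, x s) = g s" for s by (simp add: u_def b_def x_def)
  have conv: "(\<lambda>n. ?f (q n) s) \<longlonglongrightarrow> g s" if s: "s \<in> {0..T}" for s
    unfolding LIMSEQ_iff using unif s by blast
  have g_near: "norm (g s - ?zb s) \<le> \<rho>" if s: "s \<in> {0..T}" for s
  proof (rule LIMSEQ_le_const2)
    show "(\<lambda>n. norm (?f (q n) s - ?zb s)) \<longlonglongrightarrow> norm (g s - ?zb s)"
      by (intro tendsto_intros conv s)
  qed (use near[OF s] in blast)
  interpret lim: discrete_sweeping_limit T \<epsilon> x0 \<Omega> ub bb xb "\<lambda>n. t (p n)" "\<lambda>n. \<nu> (p n)" "\<lambda>n. \<delta> (p n)"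
    "\<lambda>n. norm (xt (p n) T - xb T)" "\<lambda>n. U (p n)" "\<lambda>n. B (p n)" "\<lambda>n. X (p n)" u b x
  proof
    show "(\<lambda>n. mesh_size (t (p n)) (\<nu> (p n))) \<longlonglongrightarrow> 0"
      using LIMSEQ_subseq_LIMSEQ[OF msize p] by (simp add: o_def)
    show "(\<lambda>n. \<delta> (p n)) \<longlonglongrightarrow> 0"
      using LIMSEQ_subseq_LIMSEQ[OF \<delta> p] by (simp add: o_def)
    show "(\<lambda>n. norm (xt (p n) T - xb T)) \<longlonglongrightarrow> 0"
      using LIMSEQ_subseq_LIMSEQ[OF \<xi> p] by (simp add: o_def)
    show "continuous_on {0..T} (\<lambda>s. (u s, b s, x s))"
      using g by (simp add: g_eq)
    show "\<forall>\<^sub>F n in sequentially. \<forall>s\<in>{0..T}.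
        norm (pl_extension (t (p n)) (\<lambda>j. (U (p n) j, B (p n) j, X (p n) j)) s - (u s, b s, x s)) < e" if "0 < e" for e
      using unif[OF that] unfolding eventually_sequentially g_eq p_def by blast
    show "slater (u s) (b s)" if s: "s \<in> {0..T}" for s
    proof (rule \<rho>[OF s])
      show "dist (ub s, bb s) (u s, b s) \<le> \<rho>"
        using order_trans[OF norm_triple_le(1) g_near[OF s]]
        unfolding dist_norm norm_minus_commute[of "(ub s, bb s)"] by (simp add: u_def b_def)
    qed
  qed (use T m W x0(1) closed feas in \<open>simp_all add: p_def\<close>)
  have "\<phi> (xb T) \<le> \<phi> (x T)"
    by (rule min[OF lim.limit_feasible])
  \<comment> \<open>Continuity of \<open>\<phi>\<close> enters at two points: at \<open>x T\<close>
    for the optimal solutions and at \<open>xb T\<close> for the approximating data.\<close>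
  moreover have "\<phi> (x T) + \<eta> / 2 \<le> \<phi> (xb T) + 0 / 2"
  proof (rule tendsto_le[OF sequentially_bot])
    have end1: "X (p n) (\<nu> (p n)) = pl_extension (t (p n)) (X (p n)) T" for n
      using pl_extension_node[OF m T, of "\<nu> (p n)" "p n" "X (p n)"] mesh_ends(2)[OF m] by simp
    have "dist (x T) (xb T) \<le> \<rho>"
      using order_trans[OF norm_triple_le(2) g_near[of T]] T by (simp add: x_def dist_norm)
    then have "isCont \<phi> (x T)" by (rule cont)
    then show "(\<lambda>n. \<phi> (X (p n) (\<nu> (p n))) + \<eta> / 2) \<longlonglongrightarrow> \<phi> (x T) + \<eta> / 2"
      unfolding end1 by (intro tendsto_intros isCont_tendsto_compose[of _ \<phi>] lim.pl_X_tendsto) (use T in auto)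
    have "isCont \<phi> (xb T)" using \<epsilon>(3) by (intro cont) simp
    moreover have "(\<lambda>n. xt (p n) T) \<longlonglongrightarrow> xb T"
      using LIMSEQ_subseq_LIMSEQ[OF lims(3) p] by (simp add: o_def)
    moreover have "(\<lambda>n. ?rate (p n) (?Zt (p n))) \<longlonglongrightarrow> 0"
      using LIMSEQ_subseq_LIMSEQ[OF lims(1) p] by (simp add: o_def)
    ultimately show "(\<lambda>n. \<phi> (xt (p n) T) + ?rate (p n) (?Zt (p n)) / 2) \<longlonglongrightarrow> \<phi> (xb T) + 0 / 2"
      by (intro tendsto_intros isCont_tendsto_compose[of _ \<phi>]) auto
    have "\<phi> (X (p n) (\<nu> (p n))) + \<eta> / 2 \<le> \<phi> (xt (p n) T) + ?rate (p n) (?Zt (p n)) / 2" for n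
    proof -
      have "discrete_cost T \<phi> ub bb xb (t (p n)) (\<nu> (p n)) (U (p n)) (B (p n)) (X (p n))
        \<le> discrete_cost T \<phi> ub bb xb (t (p n)) (\<nu> (p n)) (\<lambda>j. ut (p n) (t (p n) j))
            (\<lambda>j. bt (p n) (t (p n) j)) (\<lambda>j. xt (p n) (t (p n) j))"
        using ropt[of "q n"] unfolding p_def good_def discrete_optimal_def by blast
      then show ?thesis
        using rate[of "q n"] mesh_ends(2)[OF m[of "p n"]]
        unfolding discrete_cost_def p_def by simp
    qed
    then show "\<forall>\<^sub>F n in sequentially. \<phi> (X (p n) (\<nu> (p n))) + \<eta> / 2
        \<le> \<phi> (xt (p n) T) + ?rate (p n) (?Zt (p n)) / 2"
      by simp
  qed
  ultimately show False using \<eta> by simp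
qed

section \<open>Choice of the radius and proof of both claims\<close>

theorem theorem6:
  fixes T :: real
    and x0 :: "real^'n"
    and \<Omega> :: "(real^'n) set"
    and \<phi> :: "real^'n \<Rightarrow> real"
    and ub :: "real \<Rightarrow> real^'n^'m"
    and bb :: "real \<Rightarrow> real^'m"
    and xb :: "real \<Rightarrow> real^'n"
  assumes "0 < T"
    and "closed \<Omega>"
    and "canonical_pair T x0 ub bb xb"
    and "intermediate_local_minimizer T x0 \<Omega> \<phi> ub bb xb"
  shows "\<exists>\<epsilon>0>0. \<forall>\<epsilon>. 0 < \<epsilon> \<and> \<epsilon> \<le> \<epsilon>0 \<longrightarrow>
    local_minimizer_radius T x0 \<Omega> \<phi> ub bb xb \<epsilon> \<and>
    (\<forall>t \<nu> \<delta> ut bt xt. approximating_data T x0 ub bb xb t \<nu> \<delta> ut bt xt \<longrightarrow>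
      (let optimal = (\<lambda>k. discrete_optimal T x0 \<Omega> \<phi> ub bb xb
                            \<epsilon> (\<delta> k) (norm (xt k T - xb T)) (t k) (\<nu> k))
       in
        (lsc_around \<phi> (xb T) \<longrightarrow>
           (\<forall>\<^sub>F k in sequentially. \<exists>U B X. optimal k U B X)) \<and>
        (lsc_around \<phi> (xb T) \<and> continuous_around \<phi> (xb T) \<longrightarrow>
           (\<forall>U B X. (\<forall>\<^sub>F k in sequentially. optimal k (U k) (B k) (X k)) \<longrightarrow>
              converges_W12 T
                (\<lambda>k. pl_extension (t k) (\<lambda>j. (U k j, B k j, X k j)))
                (\<lambda>s. (ub s, bb s, xb s))))))"
proof -
  note T = assms(1) and can = assms(3)[unfolded canonical_pair_def]
  obtain \<epsilon>h where \<epsilon>h: "local_minimizer_radius T x0 \<Omega> \<phi> ub bb xb \<epsilon>h" and feasb: "feasible_P T x0 \<Omega> ub bb xb"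
    using assms(4) unfolding intermediate_local_minimizer_def by blast
  then have \<epsilon>h0: "0 < \<epsilon>h" by (simp add: local_minimizer_radius_def)
  have x0: "xb 0 = x0" "x0 \<in> polyhedron_of (ub 0) (bb 0)" "xb T \<in> \<Omega>"
    using feasb by (auto simp: feasible_P_def sweeping_trajectory_def)
  have "continuous_on {0..T} (\<lambda>t. (ub t, bb t))"
    using can by (auto intro!: continuous_intros intro: lipschitz_on_continuous_on)
  moreover have "slater (ub t) (bb t)" if "t \<in> {0..T}" for t
    using can that by (simp add: slater_def)
  ultimately obtain \<rho>s where \<rho>s: "0 < \<rho>s"
    "\<And>t u' b'. t \<in> {0..T} \<Longrightarrow> dist (ub t, bb t) (u', b') \<le> \<rho>s \<Longrightarrow> slater u' b'"
    by (rule slater_radius) blast+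
  \<comment> \<open>The bound \<open>\<epsilon>0\<close> is fixed before semicontinuity or
    continuity is assumed; the radius 1 stands in when the property fails.\<close>
  obtain rl where rl: "0 < rl" "lsc_around \<phi> (xb T) \<Longrightarrow> dist y (xb T) < rl \<Longrightarrow> lsc_at \<phi> y" for y
  proof (cases "lsc_around \<phi> (xb T)")
    case True
    then obtain r where "r > 0" "\<forall>y\<in>ball (xb T) r. lsc_at \<phi> y" by (auto simp: lsc_around_def)
    then show ?thesis using that[of r] by (simp add: dist_commute)
  qed (use that[of 1] in simp)
  obtain rc where rc: "0 < rc" "continuous_around \<phi> (xb T) \<Longrightarrow> dist y (xb T) < rc \<Longrightarrow> isCont \<phi> y" for y
  proof (cases "continuous_around \<phi> (xb T)")
    case True
    then obtain r where "r > 0" "continuous_on (ball (xb T) r) \<phi>" by (auto simp: continuous_around_def)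
    then show ?thesis using that[of r] by (simp add: dist_commute continuous_on_eq_continuous_at)
  qed (use that[of 1] in simp)
  \<comment> \<open>Halving lets the closed ball of radius \<open>\<rho>\<close> fit into the open
    balls of radii \<open>rl\<close> and \<open>rc\<close>.\<close>
  define \<rho> where "\<rho> = min \<rho>s (min (rl / 2) (rc / 2))"
  have \<rho>0: "0 < \<rho>" using \<rho>s(1) rl(1) rc(1) by (simp add: \<rho>_def)
  have \<rho>_slater: "slater u' b'" if "s \<in> {0..T}" "dist (ub s, bb s) (u', b') \<le> \<rho>" for s u' b'
    using \<rho>s(2)[OF that(1)] that(2) by (simp add: \<rho>_def)
  \<comment> \<open>The second bound amounts to
    \<open>T * (\<epsilon> / 2) \<le> \<rho>\<^sup>2\<close>, the size of the tube. The third
    amounts to \<open>sqrt ((T\<^sup>2 + 1) * (\<epsilon> / 2)) \<le> \<epsilon>h / 2\<close>, so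
    that the control and state parts add up to at most \<open>\<epsilon>h\<close>.\<close>
  define \<epsilon>0 where "\<epsilon>0 = min \<epsilon>h (min (2 * \<rho>\<^sup>2 / T) (\<epsilon>h\<^sup>2 / (2 * (T\<^sup>2 + 1))))"
  have T1: "0 < T\<^sup>2 + 1" by (simp add: add_nonneg_pos)
  have "0 < \<epsilon>0" using \<epsilon>h0 \<rho>0 T T1 by (simp add: \<epsilon>0_def)
  moreover have "local_minimizer_radius T x0 \<Omega> \<phi> ub bb xb \<epsilon>" if "0 < \<epsilon>" "\<epsilon> \<le> \<epsilon>0" for \<epsilon>
    using \<epsilon>h that unfolding local_minimizer_radius_def \<epsilon>0_def by force
  moreover have "\<forall>\<^sub>F k in sequentially. \<exists>U B X. discrete_optimal T x0 \<Omega> \<phi> ub bb xb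
        \<epsilon> (\<delta> k) (norm (xt k T - xb T)) (t k) (\<nu> k) U B X"
    if \<epsilon>: "0 < \<epsilon>" "\<epsilon> \<le> \<epsilon>0" and ad: "approximating_data T x0 ub bb xb t \<nu> \<delta> ut bt xt"
      and lsc: "lsc_around \<phi> (xb T)" for \<epsilon> t \<nu> \<delta> ut bt xt
  proof -
    note ad' = ad[unfolded approximating_data_def]
    have m: "mesh T (t k) (\<nu> k)" for k using ad' by blast
    have W: "W12 T (\<lambda>s. (ub s, bb s, xb s))" using ad' unfolding converges_W12_def by blast
    have \<epsilon>\<rho>: "T * (\<epsilon> / 2) \<le> \<rho>\<^sup>2"
      using \<epsilon>(2) T by (simp add: \<epsilon>0_def pos_le_divide_eq mult.commute)
    have lsc_near: "lsc_at \<phi> y" if "dist y (xb T) \<le> \<rho>" for y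
      using that rl by (intro rl(2)[OF lsc]) (simp add: \<rho>_def)
    show ?thesis
      using approximating_data_feasible[OF T ad x0 \<epsilon>(1)]
    proof eventually_elim
      case (elim k)
      show ?case
        by (rule discrete_optimal_exists[OF T m W assms(2) x0(1) \<rho>_slater lsc_near \<epsilon>\<rho> less_imp_le[OF \<rho>0] elim])
    qed
  qed
  moreover have "converges_W12 T (\<lambda>k. pl_extension (t k) (\<lambda>j. (U k j, B k j, X k j))) (\<lambda>s. (ub s, bb s, xb s))"
    if \<epsilon>: "0 < \<epsilon>" "\<epsilon> \<le> \<epsilon>0" and ad: "approximating_data T x0 ub bb xb t \<nu> \<delta> ut bt xt"
      and cont: "continuous_around \<phi> (xb T)"
      and opt: "\<forall>\<^sub>F k in sequentially. discrete_optimal T x0 \<Omega> \<phi> ub bb xb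
          \<epsilon> (\<delta> k) (norm (xt k T - xb T)) (t k) (\<nu> k) (U k) (B k) (X k)"
    for \<epsilon> t \<nu> \<delta> ut bt xt U B X
  proof -
    let ?zb = "\<lambda>s. (ub s, bb s, xb s)" and ?Z = "\<lambda>k j. (U k j, B k j, X k j)"
    let ?rate = "\<lambda>k. rate_defect T ?zb (t k) (\<nu> k) (?Z k)"
    note ad' = ad[unfolded approximating_data_def]
    have m: "mesh T (t k) (\<nu> k)" for k using ad' by blast
    have W: "W12 T ?zb" using ad' unfolding converges_W12_def by blast
    have \<epsilon>\<rho>: "T * (\<epsilon> / 2) \<le> \<rho>\<^sup>2"
      using \<epsilon>(2) T by (simp add: \<epsilon>0_def pos_le_divide_eq mult.commute)
    have half: "sqrt ((T\<^sup>2 + 1) * (\<epsilon> / 2)) \<le> \<epsilon>h / 2"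
    proof (rule real_le_lsqrt)
      have "\<epsilon> * (2 * (T\<^sup>2 + 1)) \<le> \<epsilon>h\<^sup>2"
        using \<epsilon>(2) T1 by (simp add: \<epsilon>0_def pos_le_divide_eq)
      then show "(T\<^sup>2 + 1) * (\<epsilon> / 2) \<le> (\<epsilon>h / 2)\<^sup>2"
        by (simp add: power_divide algebra_simps)
    qed (use \<epsilon>h0 in simp)
    have cont_near: "isCont \<phi> y" if "dist y (xb T) \<le> \<rho>" for y
      using that rc by (intro rc(2)[OF cont]) (simp add: \<rho>_def)
    have min: "\<phi> (xb T) \<le> \<phi> (x T)"
      if "feasible_P T x0 \<Omega> u b x" "W12 T (\<lambda>s. x s - xb s)"
        "W12_norm T (\<lambda>s. (u s, b s) - (ub s, bb s)) \<le> sqrt ((T\<^sup>2 + 1) * (\<epsilon> / 2))"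
        "W12_norm T (\<lambda>s. x s - xb s) \<le> sqrt ((T\<^sup>2 + 1) * (\<epsilon> / 2))" for u b x
    proof -
      have "W12_norm T (\<lambda>s. (u s, b s) - (ub s, bb s)) + W12_norm T (\<lambda>s. x s - xb s) \<le> \<epsilon>h"
        using that(3,4) half by linarith
      with \<epsilon>h that(1,2) show ?thesis unfolding local_minimizer_radius_def by blast
    qed
    have rate: "?rate \<longlonglongrightarrow> 0"
      by (rule optimal_rate_defect_tendsto_0[where \<phi> = \<phi> and \<rho> = \<rho>, OF T ad x0 assms(2)])
        (fact \<rho>_slater cont_near \<epsilon>(1) \<epsilon>\<rho> less_imp_le[OF \<rho>0] min opt)+
    have "(\<lambda>k. W12_norm T (\<lambda>s. pl_extension (t k) (?Z k) s - ?zb s)) \<longlonglongrightarrow> 0"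
    proof (rule tendsto_sandwich[where f = "\<lambda>_. 0"])
      show "\<forall>\<^sub>F k in sequentially. 0 \<le> W12_norm T (\<lambda>s. pl_extension (t k) (?Z k) s - ?zb s)"
        by (simp add: W12_norm_def add_nonneg_nonneg sq_int_nonneg)
      show "\<forall>\<^sub>F k in sequentially. W12_norm T (\<lambda>s. pl_extension (t k) (?Z k) s - ?zb s) \<le> sqrt ((T\<^sup>2 + 1) * ?rate k)"
        using opt
      proof eventually_elim
        case (elim k)
        then have "?Z k 0 = ?zb 0"
          using x0(1) by (simp add: discrete_optimal_def discrete_feasible_def)
        then show ?case by (rule pl_extension_deviation(4)[OF m T W])
      qed
      have "(\<lambda>k. sqrt ((T\<^sup>2 + 1) * ?rate k)) \<longlonglongrightarrow> sqrt ((T\<^sup>2 + 1) * 0)"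
        by (intro tendsto_intros rate)
      then show "(\<lambda>k. sqrt ((T\<^sup>2 + 1) * ?rate k)) \<longlonglongrightarrow> 0" by simp
    qed simp
    \<comment> \<open>Membership in \<open>W12\<close> is required for every \<open>k\<close>;
      piecewise linear extensions have it at each index, also before optimality sets in.\<close>
    then show ?thesis
      unfolding converges_W12_def using W pl_extension_W12[OF m T] by blast
  qed
  ultimately show ?thesis
    unfolding Let_def by (intro exI[of _ \<epsilon>0]) blast
qed

end
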